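(* Let $q\in\mathbb{C}$ with $|q|=1$ and $q$ not a root of unity, and $\mathcal{A}_q=\mathcal{O}(U_q(2))$. The Fourier transform $\mathcal{F}:\mathcal{A}_q\to\widehat{\mathcal{A}_q}$, $f\mapsto\hat f=(\hat f^{(l,k)})$, is a $\mathbb{C}$-isomorphism. The inverse transform is given by $$f=\sum_{l\in\frac12\mathbb{N}}\sum_{k\in\mathbb{Z}}(2l+1)\sum_{i,j\in I_l}\overline{\hat f^{(l,k)}_{j,i}}\,t^l_{ij}D^k,$$ and the following Plancherel formula holds: $$\langle f,g\rangle=\sum_{l\in\frac12\mathbb{N}}\sum_{k\in\mathbb{Z}}(2l+1)\sum_{i,j\in I_l}\overline{\hat f^{(l,k)}_{j,i}}\,\hat g^{(l,k)}_{j,i}=\sum_{l\in\frac12\mathbb{N}}\sum_{k\in\mathbb{Z}}(2l+1)\langle\hat f^{(l,k)},\hat g^{(l,k)}\rangle_l$$ (here $f,g\in\mathcal{A}_q$).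
   Context: $\mathbb{N}=\{0,1,2,\dots\}$. For $q\in\mathbb{C}\setminus\{0\}$, $C(U_q(2))$ is the universal unital $C^*$-algebra generated by $a,b,D$ subject to $$ba=qab,\quad a^*b=qba^*,\quad bb^*=b^*b,\quad aa^*+bb^*=1,\quad aD=Da,\quad bD=q^2|q|^{-2}Db,\quad DD^*=D^*D=1,\quad a^*a+|q|^2b^*b=1,$$ with comultiplication $\Delta(a)=a\otimes a-\bar q\,b\otimes Db^*$, $\Delta(b)=a\otimes b+b\otimes Da^*$, $\Delta(D)=D\otimes D$. $\mathcal{A}_q=\mathcal{O}(U_q(2))$ is the $*$-subalgebra generated by $a,b,D$; it is a Hopf $*$-algebra with antipode $S(a)=a^*$, $S(b)=-qbD^*$, $S(D)=D^*$, $S(a^* )=a$, $S(b^* )=-\bar q^{-1}b^*D$. $h$ is the Haar state of $C(U_q(2))$ (the unique state that is left and right invariant under $\Delta$), and $\langle x,y\rangle=h(x^*y)$. For $l\in\frac12\mathbb{N}$ put $I_l=\{-l,-l+1,\dots,l\}$, and for $j\in I_l$ let $f^l_j=\binom{2l}{l+j}^{1/2}a^{l-j}b^{l+j}$ (ordinary binomial coefficient) and $V_l^R=\bigoplus_{j\in I_l}\mathbb{C}f^l_j\subset\mathcal{A}_q$. The comultiplication restricts to a right corepresentation $V_l^R\to V_l^R\otimes\mathcal{A}_q$, with matrix coefficients $t^l_{ij}\in\mathcal{A}_q$ defined by $\Delta(f^l_j)=\sum_{i\in I_l}f^l_i\otimes t^l_{ij}$. For $f\in\mathcal{A}_q$,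 $l\in\frac12\mathbb{N}$, $k\in\mathbb{Z}$ define $\hat f^{(l,k)}=(\hat f^{(l,k)}_{m,n})_{m,n\in I_l}\in M_{2l+1}(\mathbb{C})$ by $\hat f^{(l,k)}_{m,n}=h\big(S(t^l_{m,n}D^k)f\big)$. Let $\widehat{\mathcal{A}_q}=\bigoplus_{(l,k)\in\frac12\mathbb{N}\times\mathbb{Z}}M_{2l+1,k}(\mathbb{C})$ (algebraic direct sum), each $M_{2l+1,k}(\mathbb{C})=M_{2l+1}(\mathbb{C})$, and $\mathcal{F}(f)=\hat f=(\hat f^{(l,k)})_{(l,k)}$. Finally $\langle M,N\rangle_l=\mathrm{Tr}(M^*N)$ with $\mathrm{Tr}$ the usual matrix trace on $M_{2l+1}(\mathbb{C})$.
   Formalization: In the inverse transform the coefficient of $t^l_{ij}D^k$ is $\hat f^{(l,k)}_{j,i}$ without complex conjugation; the printed formula with the conjugate is false, e.g. for $f=i\cdot 1$ its right side gives $-i\cdot 1$. *)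

theory Defs
  imports
    "HOL-Analysis.Elementary_Topology"
    "HOL-Library.Poly_Mapping"
    "HOL-Library.Groups_Big_Fun"
    "Jordan_Normal_Form.Schur_Decomposition"
begin

section \<open>Complex unital C*-algebras\<close>

class complex_vector = ab_group_add +
  fixes scaleC :: "complex \<Rightarrow> 'a \<Rightarrow> 'a" (infixr "*\<^sub>C" 75)
  assumes scaleC_add_right: "c *\<^sub>C (x + y) = c *\<^sub>C x + c *\<^sub>C y"
    and scaleC_add_left: "(c + d) *\<^sub>C x = c *\<^sub>C x + d *\<^sub>C x"
    and scaleC_scaleC: "c *\<^sub>C d *\<^sub>C x = (c * d) *\<^sub>C x"
    and scaleC_one: "1 *\<^sub>C x = x"

interpretation cvec: vector_space "scaleC :: complex \<Rightarrow> 'a \<Rightarrow> 'a::complex_vector"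
  by unfold_locales (simp_all add: scaleC_add_right scaleC_add_left scaleC_scaleC scaleC_one)

instantiation complex :: complex_vector
begin
definition scaleC_complex :: "complex \<Rightarrow> complex \<Rightarrow> complex" where "scaleC_complex = (*)"
instance by standard (simp_all add: scaleC_complex_def algebra_simps)
end

lemma scaleC_complex: "c *\<^sub>C z = c * z" for z :: complex
  by (simp add: scaleC_complex_def)

abbreviation clinear :: "('a::complex_vector \<Rightarrow> 'b::complex_vector) \<Rightarrow> bool" where
  "clinear \<equiv> Vector_Spaces.linear scaleC scaleC"

class complex_star_algebra_1 = complex_vector + ring_1 +
  fixes adj :: "'a \<Rightarrow> 'a"
  assumes mult_scaleC_left: "(c *\<^sub>C x) * y = c *\<^sub>C (x * y)"
    and mult_scaleC_right: "x * (c *\<^sub>C y) = c *\<^sub>C (x * y)"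
    and adj_add: "adj (x + y) = adj x + adj y"
    and adj_scaleC: "adj (c *\<^sub>C x) = cnj c *\<^sub>C adj x"
    and adj_mult: "adj (x * y) = adj y * adj x"
    and adj_adj: "adj (adj x) = x"

class cstar_algebra_1 = complex_star_algebra_1 + real_normed_algebra_1 + complete_space +
  assumes scaleR_scaleC: "scaleR r x = complex_of_real r *\<^sub>C x"
    and norm_scaleC: "norm (c *\<^sub>C x) = cmod c * norm x"
    and norm_cstar: "norm (adj x * x) = (norm x)\<^sup>2"


section \<open>The algebraic tensor product\<close>

text \<open>
  Finite formal sums, given as lists of pairs, are identified when every bilinear form takes
  the same value on them; that is, \<open>x \<boxtimes> y\<close> is the functional \<open>B \<mapsto> B x y\<close> on
  the space of bilinear forms.
\<close>

definition cbilinear :: "('a::complex_vector \<Rightarrow> 'b::complex_vector \<Rightarrow> complex) \<Rightarrow> bool" where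
  "cbilinear B \<longleftrightarrow> (\<forall>x. clinear (B x)) \<and> (\<forall>y. clinear (\<lambda>x. B x y))"

definition tval :: "('a \<Rightarrow> 'b \<Rightarrow> complex) \<Rightarrow> ('a \<times> 'b) list \<Rightarrow> complex" where
  "tval B u = (\<Sum>(x, y)\<leftarrow>u. B x y)"

definition tensor_eq ::
  "('a::complex_vector \<times> 'b::complex_vector) list \<Rightarrow> ('a \<times> 'b) list \<Rightarrow> bool" where
  "tensor_eq u v \<longleftrightarrow> (\<forall>B. cbilinear B \<longrightarrow> tval B u = tval B v)"

quotient_type (overloaded) ('a, 'b) tensor =
  "('a::complex_vector \<times> 'b::complex_vector) list" / tensor_eq
  by (rule equivpI) (auto simp: reflp_def symp_def transp_def tensor_eq_def)

lemma clinear_iff: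
  "clinear f \<longleftrightarrow> (\<forall>x y. f (x + y) = f x + f y) \<and> (\<forall>c x. f (c *\<^sub>C x) = c *\<^sub>C f x)"
  by (auto simp: Vector_Spaces.linear_iff cvec.vector_space_axioms)

lemma cbilinear_iff:
  "cbilinear B \<longleftrightarrow> (\<forall>x x' y. B (x + x') y = B x y + B x' y) \<and> (\<forall>c x y. B (c *\<^sub>C x) y = c * B x y)
     \<and> (\<forall>x y y'. B x (y + y') = B x y + B x y') \<and> (\<forall>c x y. B x (c *\<^sub>C y) = c * B x y)"
  unfolding cbilinear_def clinear_iff by (simp add: scaleC_complex) blast

lemma tval_simps [simp]:
  "tval B [] = 0" "tval B (z # u) = B (fst z) (snd z) + tval B u"
  by (auto simp: tval_def split: prod.split)

lemma tval_append [simp]: "tval B (u @ v) = tval B u + tval B v"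
  by (induction u) auto

lift_definition tensor_pure :: "'a::complex_vector \<Rightarrow> 'b::complex_vector \<Rightarrow> ('a, 'b) tensor"
  (infixl "\<boxtimes>" 72) is "\<lambda>x y. [(x, y)]" .

lemma tval_scale:
  assumes "cbilinear B"
  shows "tval B (map (\<lambda>(x, y). (c *\<^sub>C x, y)) u) = c * tval B u"
  using assms by (induction u) (auto simp: cbilinear_iff algebra_simps)

lemma tval_uminus:
  assumes "cbilinear B"
  shows "tval B (map (\<lambda>(x, y). (- x, y)) u) = - tval B u"
proof -
  have "- x = (-1) *\<^sub>C x" for x :: 'a by simp
  then have "map (\<lambda>(x, y). (- x, y)) u = map (\<lambda>(x, y). ((-1) *\<^sub>C x, y)) u"
    by simp
  then show ?thesis using tval_scale[OF assms, of "-1" u] by simp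
qed

instantiation tensor :: (complex_vector, complex_vector) complex_vector
begin
lift_definition zero_tensor :: "('a, 'b) tensor" is "[]" .
lift_definition plus_tensor :: "('a, 'b) tensor \<Rightarrow> ('a, 'b) tensor \<Rightarrow> ('a, 'b) tensor" is "(@)"
  by (auto simp: tensor_eq_def)
lift_definition uminus_tensor :: "('a, 'b) tensor \<Rightarrow> ('a, 'b) tensor"
  is "map (\<lambda>(x, y). (- x, y))"
  by (auto simp: tensor_eq_def tval_uminus)
definition minus_tensor :: "('a, 'b) tensor \<Rightarrow> ('a, 'b) tensor \<Rightarrow> ('a, 'b) tensor" where
  "minus_tensor u v = u + (- v)"
lift_definition scaleC_tensor :: "complex \<Rightarrow> ('a, 'b) tensor \<Rightarrow> ('a, 'b) tensor"
  is "\<lambda>c. map (\<lambda>(x, y). (c *\<^sub>C x, y))"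
  by (auto simp: tensor_eq_def tval_scale)
instance
proof
  fix u v w :: "('a, 'b) tensor" and c d :: complex
  show "u + v + w = u + (v + w)" by transfer (simp add: tensor_eq_def)
  show "u + v = v + u" by transfer (simp add: tensor_eq_def)
  show "0 + u = u" by transfer (simp add: tensor_eq_def)
  show "- u + u = 0" by transfer (simp add: tensor_eq_def tval_uminus)
  show "u - v = u + - v" by (simp add: minus_tensor_def)
  show "c *\<^sub>C (u + v) = c *\<^sub>C u + c *\<^sub>C v"
    by transfer (simp add: tensor_eq_def tval_scale algebra_simps)
  show "(c + d) *\<^sub>C u = c *\<^sub>C u + d *\<^sub>C u"
    by transfer (simp add: tensor_eq_def tval_scale distrib_right del: cvec.scale_left_distrib)
  show "c *\<^sub>C d *\<^sub>C u = (c * d) *\<^sub>C u"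
    by transfer (simp add: tensor_eq_def tval_scale algebra_simps del: map_map)
  show "1 *\<^sub>C u = u"
    by transfer (simp add: tensor_eq_def tval_scale)
qed
end

lemma functional_separates:
  fixes v :: "'a::complex_vector"
  assumes "v \<noteq> 0"
  obtains f :: "'a \<Rightarrow> complex" where "clinear f" "f v = 1"
proof -
  interpret p: vector_space_pair "scaleC :: complex \<Rightarrow> 'a \<Rightarrow> 'a" "scaleC :: complex \<Rightarrow> complex \<Rightarrow> complex"
    by unfold_locales
  have "cvec.independent {v}" using assms by simp
  from p.linear_independent_extend[OF this, of "\<lambda>_. 1"] show ?thesis using that by auto
qed

definition list_mult ::
  "('a::times \<times> 'b::times) list \<Rightarrow> ('a \<times> 'b) list \<Rightarrow> ('a \<times> 'b) list" where
  "list_mult u v = concat (map (\<lambda>(x, y). map (\<lambda>(x', y'). (x * x', y * y')) v) u)"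

lemma tval_list_mult_left:
  "tval B (list_mult u v) = tval (\<lambda>x y. tval (\<lambda>x' y'. B (x * x') (y * y')) v) u"
proof -
  have "tval B (map (\<lambda>(x', y'). (x * x', y * y')) v) = tval (\<lambda>x' y'. B (x * x') (y * y')) v" for x y
    by (induction v) auto
  then show ?thesis unfolding list_mult_def by (induction u) auto
qed

lemma tval_add: "tval (\<lambda>x y. B x y + C x y) u = tval B u + tval C u"
  by (induction u) auto

lemma tval_cmult: "tval (\<lambda>x y. c * B x y) u = c * tval B u"
  by (induction u) (auto simp: algebra_simps)

lemma tval_swap: "tval (\<lambda>x y. tval (\<lambda>x' y'. B x y x' y') v) u = tval (\<lambda>x' y'. tval (\<lambda>x y. B x y x' y') u) v"
proof (induction u)
  case Nil
  have "tval (\<lambda>_ _. 0) v = 0" by (induction v) auto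
  then show ?case by simp
qed (simp add: tval_add)

lemma tval_list_mult_right:
  "tval B (list_mult u v) = tval (\<lambda>x' y'. tval (\<lambda>x y. B (x * x') (y * y')) u) v"
  unfolding tval_list_mult_left by (rule tval_swap)

lemma cbilinear_mult_left:
  fixes B :: "'a::complex_star_algebra_1 \<Rightarrow> 'b::complex_star_algebra_1 \<Rightarrow> complex"
  assumes "cbilinear B"
  shows "cbilinear (\<lambda>x y. tval (\<lambda>x' y'. B (x * x') (y * y')) v)"
  using assms
  by (simp add: cbilinear_iff distrib_right mult_scaleC_left tval_add tval_cmult)

lemma cbilinear_mult_right:
  fixes B :: "'a::complex_star_algebra_1 \<Rightarrow> 'b::complex_star_algebra_1 \<Rightarrow> complex"
  assumes "cbilinear B"
  shows "cbilinear (\<lambda>x' y'. tval (\<lambda>x y. B (x * x') (y * y')) u)"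
  using assms
  by (simp add: cbilinear_iff distrib_left mult_scaleC_right tval_add tval_cmult)

lemma tensor_eq_mult:
  fixes u u' v v' :: "('a::complex_star_algebra_1 \<times> 'b::complex_star_algebra_1) list"
  assumes "tensor_eq u u'" "tensor_eq v v'"
  shows "tensor_eq (list_mult u v) (list_mult u' v')"
  unfolding tensor_eq_def
proof safe
  fix B :: "'a \<Rightarrow> 'b \<Rightarrow> complex" assume B: "cbilinear B"
  have "tval B (list_mult u v) = tval B (list_mult u' v)"
    unfolding tval_list_mult_left using assms(1) cbilinear_mult_left[OF B] by (auto simp: tensor_eq_def)
  also have "\<dots> = tval B (list_mult u' v')"
    unfolding tval_list_mult_right using assms(2) cbilinear_mult_right[OF B] by (auto simp: tensor_eq_def)
  finally show "tval B (list_mult u v) = tval B (list_mult u' v')" .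
qed

lemma tval_cnj: "tval (\<lambda>x y. cnj (B x y)) u = cnj (tval B u)"
  by (induction u) auto

lemma tval_map_adj: "tval B (map (\<lambda>(x, y). (adj x, adj y)) u) = tval (\<lambda>x y. B (adj x) (adj y)) u"
  by (induction u) auto

lemma tensor_eq_adj:
  fixes u v :: "('a::complex_star_algebra_1 \<times> 'b::complex_star_algebra_1) list"
  assumes "tensor_eq u v"
  shows "tensor_eq (map (\<lambda>(x, y). (adj x, adj y)) u) (map (\<lambda>(x, y). (adj x, adj y)) v)"
  unfolding tensor_eq_def
proof safe
  fix B :: "'a \<Rightarrow> 'b \<Rightarrow> complex" assume B: "cbilinear B"
  have "cbilinear (\<lambda>x y. cnj (B (adj x) (adj y)))"
    using B by (simp add: cbilinear_iff adj_add adj_scaleC)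
  then have "tval (\<lambda>x y. cnj (B (adj x) (adj y))) u = tval (\<lambda>x y. cnj (B (adj x) (adj y))) v"
    using assms by (auto simp: tensor_eq_def)
  then show "tval B (map (\<lambda>(x, y). (adj x, adj y)) u) = tval B (map (\<lambda>(x, y). (adj x, adj y)) v)"
    by (simp add: tval_map_adj tval_cnj)
qed

instantiation tensor :: (complex_star_algebra_1, complex_star_algebra_1) complex_star_algebra_1
begin
lift_definition one_tensor :: "('a, 'b) tensor" is "[(1, 1)]" .
lift_definition times_tensor :: "('a, 'b) tensor \<Rightarrow> ('a, 'b) tensor \<Rightarrow> ('a, 'b) tensor" is list_mult
  by (rule tensor_eq_mult)
lift_definition adj_tensor :: "('a, 'b) tensor \<Rightarrow> ('a, 'b) tensor"
  is "map (\<lambda>(x, y). (adj x, adj y))"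
  by (rule tensor_eq_adj)
instance
proof
  fix u v w :: "('a, 'b) tensor" and c :: complex
  show "u * v * w = u * (v * w)"
    by transfer (simp add: tensor_eq_def tval_list_mult_left mult.assoc)
  show "1 * u = u"
    by transfer (simp add: tensor_eq_def tval_list_mult_left)
  show "u * 1 = u"
    by transfer (simp add: tensor_eq_def tval_list_mult_left)
  show "(u + v) * w = u * w + v * w"
    by transfer (simp add: tensor_eq_def tval_list_mult_left)
  show "u * (v + w) = u * v + u * w"
    by transfer (simp add: tensor_eq_def tval_list_mult_left tval_add)
  show "(c *\<^sub>C u) * v = c *\<^sub>C (u * v)"
    by transfer (simp add: tensor_eq_def tval_list_mult_left tval_scale cbilinear_mult_left)
  show "u * (c *\<^sub>C v) = c *\<^sub>C (u * v)"
    by transfer (simp add: tensor_eq_def tval_list_mult_right tval_scale cbilinear_mult_right)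
  show "adj (u + v) = adj u + adj v"
    by transfer (simp add: tensor_eq_def)
  show "adj (adj u) = u"
    by transfer (simp add: tensor_eq_def tval_map_adj adj_adj del: map_map)
  show "adj (u * v) = adj v * adj u"
    by transfer
      (auto simp: tensor_eq_def tval_map_adj tval_list_mult_left adj_mult intro: tval_swap)
  show "adj (c *\<^sub>C u) = cnj c *\<^sub>C adj u"
  proof (transfer, unfold tensor_eq_def, safe)
    fix c :: complex and u :: "('a \<times> 'b) list" and B :: "'a \<Rightarrow> 'b \<Rightarrow> complex"
    assume B: "cbilinear B"
    show "tval B (map (\<lambda>(x, y). (adj x, adj y)) (map (\<lambda>(x, y). (c *\<^sub>C x, y)) u)) =
          tval B (map (\<lambda>(x, y). (cnj c *\<^sub>C x, y)) (map (\<lambda>(x, y). (adj x, adj y)) u))"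
      by (simp add: case_prod_beta' o_def adj_scaleC)
  qed
  show "(0::('a, 'b) tensor) \<noteq> 1"
  proof (transfer, unfold tensor_eq_def, safe)
    assume *: "\<forall>B. cbilinear B \<longrightarrow> tval B [] = tval B [(1::'a, 1::'b)]"
    obtain f :: "'a \<Rightarrow> complex" where f: "clinear f" "f 1 = 1"
      using functional_separates[of "1::'a"] by auto
    obtain g :: "'b \<Rightarrow> complex" where g: "clinear g" "g 1 = 1"
      using functional_separates[of "1::'b"] by auto
    have "cbilinear (\<lambda>x y. f x * g y)"
      using f g by (auto simp: cbilinear_iff clinear_iff scaleC_complex algebra_simps)
    with * f g show False by fastforce
  qed
qed
end

text \<open>
  The slice maps \<open>\<phi> \<otimes> id\<close> and \<open>id \<otimes> \<phi>\<close> for a linear functional \<open>\<phi>\<close>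
  (a nonlinear \<open>\<phi>\<close> is replaced by 0).
\<close>

lemma tensor_eq_slice:
  fixes u v :: "('a::complex_vector \<times> 'b::complex_vector) list"
  assumes uv: "tensor_eq u v" and phi: "clinear \<phi>"
  shows "(\<Sum>(x, y)\<leftarrow>u. \<phi> x *\<^sub>C y) = (\<Sum>(x, y)\<leftarrow>v. \<phi> x *\<^sub>C y)"
proof (rule ccontr)
  define s where "s w = (\<Sum>(x, y)\<leftarrow>w. \<phi> x *\<^sub>C y)" for w :: "('a \<times> 'b) list"
  assume "\<not> ?thesis"
  then have "s u - s v \<noteq> 0" by (simp add: s_def)
  then obtain f :: "'b \<Rightarrow> complex" where f: "clinear f" "f (s u - s v) = 1"
    using functional_separates by blast
  interpret f: Vector_Spaces.linear scaleC scaleC f by (rule f)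
  have "f (s w) = tval (\<lambda>x y. \<phi> x * f y) w" for w
    by (induction w) (auto simp: s_def f.add f.scale f.zero scaleC_complex)
  moreover have "cbilinear (\<lambda>x y. \<phi> x * f y)"
    using f phi by (auto simp: cbilinear_iff clinear_iff scaleC_complex algebra_simps)
  ultimately have "f (s u) = f (s v)" using uv by (simp add: tensor_eq_def)
  with f(2) show False by (simp add: f.diff)
qed

lift_definition slice_left ::
  "('a::complex_vector \<Rightarrow> complex) \<Rightarrow> ('a, 'b::complex_vector) tensor \<Rightarrow> 'b"
  is "\<lambda>\<phi> u. if clinear \<phi> then (\<Sum>(x, y)\<leftarrow>u. \<phi> x *\<^sub>C y) else 0"
  using tensor_eq_slice by auto

lemma tensor_eq_swap:
  assumes "tensor_eq u v"
  shows "tensor_eq (map prod.swap u) (map prod.swap v)"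
  unfolding tensor_eq_def
proof safe
  fix B :: "'b \<Rightarrow> 'a \<Rightarrow> complex" assume "cbilinear B"
  then have "cbilinear (\<lambda>x y. B y x)" by (auto simp: cbilinear_def)
  moreover have "tval B (map prod.swap w) = tval (\<lambda>x y. B y x) w" for w
    by (induction w) auto
  ultimately show "tval B (map prod.swap u) = tval B (map prod.swap v)"
    using assms by (simp add: tensor_eq_def)
qed

lift_definition tensor_flip ::
  "('a::complex_vector, 'b::complex_vector) tensor \<Rightarrow> ('b, 'a) tensor" is "map prod.swap"
  by (rule tensor_eq_swap)

definition slice_right ::
  "('b::complex_vector \<Rightarrow> complex) \<Rightarrow> ('a::complex_vector, 'b) tensor \<Rightarrow> 'a" where
  "slice_right \<phi> u = slice_left \<phi> (tensor_flip u)"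

lemma tensor_pure_bilinear:
  "(x + x') \<boxtimes> y = x \<boxtimes> y + x' \<boxtimes> y" "x \<boxtimes> (y + y') = x \<boxtimes> y + x \<boxtimes> y'"
  "(c *\<^sub>C x) \<boxtimes> y = c *\<^sub>C (x \<boxtimes> y)" "x \<boxtimes> (c *\<^sub>C y) = c *\<^sub>C (x \<boxtimes> y)"
  by (transfer; simp add: tensor_eq_def cbilinear_iff)+

lemma tensor_pure_mult: "(x \<boxtimes> y) * (x' \<boxtimes> y') = (x * x') \<boxtimes> (y * y')"
  by transfer (simp add: tensor_eq_def list_mult_def)

lemma tensor_pure_one: "1 \<boxtimes> 1 = 1"
  by transfer (simp add: tensor_eq_def)

lemma tensor_pure_adj: "adj (x \<boxtimes> y) = adj x \<boxtimes> adj y"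
  by transfer (simp add: tensor_eq_def)

lemma slice_left_pure: "clinear \<phi> \<Longrightarrow> slice_left \<phi> (x \<boxtimes> y) = \<phi> x *\<^sub>C y"
  by transfer simp

lemma slice_left_add: "slice_left \<phi> (u + v) = slice_left \<phi> u + slice_left \<phi> v"
  by transfer simp

lemma slice_right_pure: "clinear \<phi> \<Longrightarrow> slice_right \<phi> (x \<boxtimes> y) = \<phi> y *\<^sub>C x"
  unfolding slice_right_def by transfer simp

lemma slice_right_add: "slice_right \<phi> (u + v) = slice_right \<phi> u + slice_right \<phi> v"
  unfolding slice_right_def by transfer simp


section \<open>The free *-algebra on three generators\<close>

datatype uq2_gen = GenA | GenB | GenD

text \<open>A letter \<open>(g, True)\<close> stands for the adjoint of the generator \<open>g\<close>.\<close>

datatype word = Word (letters: "(uq2_gen \<times> bool) list")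

instantiation word :: monoid_add
begin
definition zero_word :: word where "zero_word = Word []"
definition plus_word :: "word \<Rightarrow> word \<Rightarrow> word" where
  "plus_word v w = Word (letters v @ letters w)"
instance by standard (auto simp: zero_word_def plus_word_def)
end

definition word_adj :: "word \<Rightarrow> word" where
  "word_adj w = Word (rev (map (\<lambda>(g, s). (g, \<not> s)) (letters w)))"

lemma word_adj_word_adj: "word_adj (word_adj w) = w"
  by (cases w) (simp add: word_adj_def rev_map o_def case_prod_beta)

text \<open>Addition of words is concatenation, so the convolution product of
  \<^typ>\<open>word \<Rightarrow>\<^sub>0 complex\<close> is the multiplication of the free algebra.\<close>

type_synonym star_poly = "word \<Rightarrow>\<^sub>0 complex"

lift_definition fadj :: "star_poly \<Rightarrow> star_poly" is "\<lambda>p w. cnj (p (word_adj w))"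
proof -
  fix p :: "word \<Rightarrow> complex" assume "finite {w. p w \<noteq> 0}"
  then have "finite (word_adj ` {w. p w \<noteq> 0})" by simp
  moreover have "{w. cnj (p (word_adj w)) \<noteq> 0} \<subseteq> word_adj ` {w. p w \<noteq> 0}"
    by (auto intro!: image_eqI[where x = "word_adj _"] simp: word_adj_word_adj)
  ultimately show "finite {w. cnj (p (word_adj w)) \<noteq> 0}" by (rule rev_finite_subset)
qed

definition fconst :: "complex \<Rightarrow> star_poly" where
  "fconst c = Poly_Mapping.single 0 c"

definition fgen :: "uq2_gen \<Rightarrow> star_poly" where
  "fgen g = Poly_Mapping.single (Word [(g, False)]) 1"

definition cstar_seminorm :: "(star_poly \<Rightarrow> real) \<Rightarrow> bool" where
  "cstar_seminorm \<gamma> \<longleftrightarrow>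
     (\<forall>p r. \<gamma> (p + r) \<le> \<gamma> p + \<gamma> r) \<and> (\<forall>c p. \<gamma> (fconst c * p) = cmod c * \<gamma> p) \<and>
     (\<forall>p r. \<gamma> (p * r) \<le> \<gamma> p * \<gamma> r) \<and> (\<forall>p. \<gamma> (fadj p * p) = (\<gamma> p)\<^sup>2)"

fun letter_val :: "'a::complex_star_algebra_1 \<Rightarrow> 'a \<Rightarrow> 'a \<Rightarrow> uq2_gen \<times> bool \<Rightarrow> 'a" where
  "letter_val a b D (g, s) =
     (let x = (case g of GenA \<Rightarrow> a | GenB \<Rightarrow> b | GenD \<Rightarrow> D) in if s then adj x else x)"

definition feval :: "'a::complex_star_algebra_1 \<Rightarrow> 'a \<Rightarrow> 'a \<Rightarrow> star_poly \<Rightarrow> 'a" where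
  "feval a b D p = (\<Sum>w\<in>Poly_Mapping.keys p.
     Poly_Mapping.lookup p w *\<^sub>C prod_list (map (letter_val a b D) (letters w)))"


section \<open>The quantum group\<close>

text \<open>Each relation \<open>x = y\<close> is recorded as the element \<open>x - y\<close>.\<close>

definition uq2_relators :: "complex \<Rightarrow> star_poly set" where
  "uq2_relators q = (let a = fgen GenA; b = fgen GenB; D = fgen GenD in
     {b * a - fconst q * (a * b),
      fadj a * b - fconst q * (b * fadj a),
      b * fadj b - fadj b * b,
      a * fadj a + b * fadj b - 1,
      a * D - D * a,
      b * D - fconst (q\<^sup>2 / complex_of_real ((cmod q)\<^sup>2)) * (D * b),
      D * fadj D - 1,
      fadj D * D - 1,
      fadj a * a + fconst (complex_of_real ((cmod q)\<^sup>2)) * (fadj b * b) - 1})"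

text \<open>
  The ambient C*-algebra with its elements \<open>a, b, D\<close> is the universal C*-algebra \<open>C(U\<^sub>q(2))\<close>,
  i.e. the completion of the free *-algebra in its greatest C*-seminorm that vanishes on the
  relators. The C*-algebras generated by a solution \<open>a', b', D'\<close> of the relations correspond to
  these seminorms \<open>\<gamma>\<close> (with \<open>\<gamma> p\<close> the norm of \<open>p(a', b', D')\<close>), and the last
  condition says that \<open>a, b, D \<mapsto> a', b', D'\<close> extends to a *-homomorphism.
\<close>

definition universal_Uq2 :: "complex \<Rightarrow> 'a::cstar_algebra_1 \<Rightarrow> 'a \<Rightarrow> 'a \<Rightarrow> bool" where
  "universal_Uq2 q a b D \<longleftrightarrow>
     (\<forall>r\<in>uq2_relators q. feval a b D r = 0) \<and>
     closure (range (feval a b D)) = UNIV \<and>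
     (\<forall>\<gamma>. cstar_seminorm \<gamma> \<and> (\<forall>r\<in>uq2_relators q. \<gamma> r = 0) \<longrightarrow> (\<forall>p. \<gamma> p \<le> norm (feval a b D p)))"

definition star_subalgebra :: "'a::complex_star_algebra_1 set \<Rightarrow> bool" where
  "star_subalgebra A \<longleftrightarrow> 1 \<in> A \<and> (\<forall>x\<in>A. \<forall>y\<in>A. x + y \<in> A \<and> x * y \<in> A) \<and>
     (\<forall>c. \<forall>x\<in>A. c *\<^sub>C x \<in> A) \<and> (\<forall>x\<in>A. adj x \<in> A)"

definition Oq :: "'a::complex_star_algebra_1 \<Rightarrow> 'a \<Rightarrow> 'a \<Rightarrow> 'a set" where
  "Oq a b D = star_subalgebra hull {a, b, D}"

text \<open>The comultiplication, restricted to the dense *-subalgebra, where it takes values in the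
  algebraic tensor product and is determined by its values on the generators.\<close>

definition comultiplication ::
  "complex \<Rightarrow> 'a::complex_star_algebra_1 \<Rightarrow> 'a \<Rightarrow> 'a \<Rightarrow> ('a \<Rightarrow> ('a, 'a) tensor) \<Rightarrow> bool" where
  "comultiplication q a b D \<Delta> \<longleftrightarrow>
     (\<forall>x\<in>Oq a b D. \<forall>y\<in>Oq a b D. \<Delta> (x + y) = \<Delta> x + \<Delta> y \<and> \<Delta> (x * y) = \<Delta> x * \<Delta> y) \<and>
     (\<forall>c. \<forall>x\<in>Oq a b D. \<Delta> (c *\<^sub>C x) = c *\<^sub>C \<Delta> x) \<and>
     (\<forall>x\<in>Oq a b D. \<Delta> (adj x) = adj (\<Delta> x)) \<and> \<Delta> 1 = 1 \<and>
     \<Delta> a = a \<boxtimes> a - cnj q *\<^sub>C (b \<boxtimes> (D * adj b)) \<and>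
     \<Delta> b = a \<boxtimes> b + b \<boxtimes> (D * adj a) \<and>
     \<Delta> D = D \<boxtimes> D"

text \<open>The antipode is linear and antimultiplicative, but not *-preserving in general.\<close>

definition antipode ::
  "complex \<Rightarrow> 'a::complex_star_algebra_1 \<Rightarrow> 'a \<Rightarrow> 'a \<Rightarrow> ('a \<Rightarrow> 'a) \<Rightarrow> bool" where
  "antipode q a b D S \<longleftrightarrow>
     (\<forall>x\<in>Oq a b D. \<forall>y\<in>Oq a b D. S (x + y) = S x + S y \<and> S (x * y) = S y * S x) \<and>
     (\<forall>c. \<forall>x\<in>Oq a b D. S (c *\<^sub>C x) = c *\<^sub>C S x) \<and> S 1 = 1 \<and>
     S a = adj a \<and> S b = (- q) *\<^sub>C (b * adj D) \<and> S D = adj D \<and>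
     S (adj a) = a \<and> S (adj b) = (- inverse (cnj q)) *\<^sub>C (adj b * D)"

definition state :: "('a::cstar_algebra_1 \<Rightarrow> complex) \<Rightarrow> bool" where
  "state h \<longleftrightarrow> clinear h \<and> h 1 = 1 \<and> (\<forall>x. h (adj x * x) \<in> \<real> \<and> 0 \<le> Re (h (adj x * x)))"

text \<open>\<open>(h \<otimes> id) \<Delta>(x) = h(x) 1 = (id \<otimes> h) \<Delta>(x)\<close>; states being continuous, it is
  equivalent to demand this on the dense *-subalgebra or on the whole C*-algebra.\<close>

definition haar_state ::
  "'a::cstar_algebra_1 \<Rightarrow> 'a \<Rightarrow> 'a \<Rightarrow> ('a \<Rightarrow> ('a, 'a) tensor) \<Rightarrow> ('a \<Rightarrow> complex) \<Rightarrow> bool" where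
  "haar_state a b D \<Delta> h \<longleftrightarrow> state h \<and>
     (\<forall>x\<in>Oq a b D. slice_left h (\<Delta> x) = h x *\<^sub>C 1 \<and> slice_right h (\<Delta> x) = h x *\<^sub>C 1)"


section \<open>Matrix coefficients and the Fourier transform\<close>

text \<open>
  A half-integer \<open>l\<close> is represented by the natural number \<open>n = 2l\<close>, and the index
  \<open>j \<in> {-l, -l+1, \<dots>, l}\<close> by \<open>l + j \<in> {0, \<dots>, n}\<close>; thus \<open>2l + 1 = n + 1\<close> and
  \<open>l - j\<close> becomes \<open>n - j\<close>. Matrix rows and columns are indexed accordingly.
\<close>

definition fvec :: "'a::complex_star_algebra_1 \<Rightarrow> 'a \<Rightarrow> nat \<Rightarrow> nat \<Rightarrow> 'a" where
  "fvec a b n j = complex_of_real (sqrt (real (n choose j))) *\<^sub>C (a ^ (n - j) * b ^ j)"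

definition matrix_coefficients ::
  "'a::complex_star_algebra_1 \<Rightarrow> 'a \<Rightarrow> 'a \<Rightarrow> ('a \<Rightarrow> ('a, 'a) tensor) \<Rightarrow>
     (nat \<Rightarrow> nat \<Rightarrow> nat \<Rightarrow> 'a) \<Rightarrow> bool" where
  "matrix_coefficients a b D \<Delta> t \<longleftrightarrow>
     (\<forall>n. \<forall>i\<le>n. \<forall>j\<le>n. t n i j \<in> Oq a b D) \<and>
     (\<forall>n. \<forall>j\<le>n. \<Delta> (fvec a b n j) = (\<Sum>i\<le>n. fvec a b n i \<boxtimes> t n i j))"

text \<open>Integer powers of a unitary.\<close>

definition upow :: "'a::complex_star_algebra_1 \<Rightarrow> int \<Rightarrow> 'a" where
  "upow u k = (if 0 \<le> k then u ^ nat k else adj u ^ nat (- k))"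

definition fourier ::
  "'a::complex_star_algebra_1 \<Rightarrow> ('a \<Rightarrow> 'a) \<Rightarrow> ('a \<Rightarrow> complex) \<Rightarrow> (nat \<Rightarrow> nat \<Rightarrow> nat \<Rightarrow> 'a) \<Rightarrow>
     'a \<Rightarrow> nat \<times> int \<Rightarrow> complex mat" where
  "fourier D S h t f = (\<lambda>(n, k). mat (n + 1) (n + 1) (\<lambda>(i, j). h (S (t n i j * upow D k) * f)))"

text \<open>The algebraic direct sum of the matrix algebras.\<close>

definition dual_algebra :: "(nat \<times> int \<Rightarrow> complex mat) set" where
  "dual_algebra = {M. (\<forall>n k. M (n, k) \<in> carrier_mat (n + 1) (n + 1)) \<and>
     finite {(n, k). M (n, k) \<noteq> 0\<^sub>m (n + 1) (n + 1)}}"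

definition dual_add ::
  "(nat \<times> int \<Rightarrow> complex mat) \<Rightarrow> (nat \<times> int \<Rightarrow> complex mat) \<Rightarrow> nat \<times> int \<Rightarrow> complex mat" where
  "dual_add M N = (\<lambda>p. M p + N p)"

definition dual_scale :: "complex \<Rightarrow> (nat \<times> int \<Rightarrow> complex mat) \<Rightarrow> nat \<times> int \<Rightarrow> complex mat" where
  "dual_scale c M = (\<lambda>p. c \<cdot>\<^sub>m M p)"

definition mat_trace :: "complex mat \<Rightarrow> complex" where
  "mat_trace M = (\<Sum>i<dim_row M. M $$ (i, i))"

definition mat_inner :: "complex mat \<Rightarrow> complex mat \<Rightarrow> complex" where
  "mat_inner M N = mat_trace (mat_adjoint M * N)"

end

theory Submission
  imports Defs "HOL-Analysis.L2_Norm"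
begin

text \<open>
  Write \<open>f n i\<close> for the basis of the corepresentation of dimension \<open>n + 1\<close>. For \<open>|q| = 1\<close> both
  \<open>\<Sum> f n i * adj (f n i)\<close> and \<open>\<Sum> adj (f n i) * f n i\<close> equal 1. Universality provides
  representations by weighted shifts, depending on parameters, in which the monomials act with
  distinguishable matrix entries, so the products \<open>f n i * adj (f n k)\<close> and
  \<open>adj (f n i * D^k) * (f m r * D^l)\<close> are linearly independent. Applying the comultiplication to
  the first sum shows that \<open>t n\<close> is a coisometry; as \<open>S\<close> is a left inverse of it, \<open>t n\<close>
  is unitary and \<open>S (t n i j) = adj (t n j i)\<close>. Applying \<open>(id \<otimes> h) \<Delta>\<close> to
  \<open>adj (f n j * D^k) * (f m p * D^l)\<close> and comparing coefficients gives all orthogonality relations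
  at once, without coassociativity or Schur's lemma. Finally the words of length \<open>n\<close> in
  \<open>a, b, D b*, D a*\<close> span a space of dimension at most \<open>\<Sum> (m + 1)^2\<close>, \<open>m = n, n - 2, \<dots>\<close>,
  which is the number of the orthogonal elements \<open>t m i j * D^k\<close>, \<open>m + 2 k = n\<close>, in it; so
  these elements span the whole algebra.
\<close>

section \<open>Linear extension from a basis\<close>

text \<open>At \<open>|q| = 1\<close> the two sphere relations force \<open>a\<close> to be normal.
  Then \<open>a * adj a\<close> and \<open>b * adj b\<close> commute and add up to 1, so the
  ordinary binomial theorem makes both sums equal to 1. This is why ordinary binomial coefficients
  are the right normalisation and why every squared norm is \<open>1 / (n + 1)\<close>, with no
  q-deformed trace. Invariance of \<open>h\<close> turns the slice of a product into a scalar
  multiple of 1. If the two corepresentations differ, the diagonal matrix entries of the slice carry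
  a nontrivial power of a free phase, and the scalar is 0. If they agree, 1 is itself the sum of the
  independent products with equal indices, so only those coefficients survive and they all coincide;
  unitarity of \<open>t n\<close> then fixes their value. Orthogonality already bounds dimensions
  from below. Hence an upper bound, obtained by counting monomials, is all that spanning requires,
  in place of a Clebsch-Gordan decomposition.\<close>

lemma poly_mapping_expand: "p = (\<Sum>k\<in>Poly_Mapping.keys p. Poly_Mapping.single k (Poly_Mapping.lookup p k))"
  by (rule poly_mapping_eqI)
    (auto simp: lookup_sum lookup_single when_def in_keys_iff sum.delta)

text \<open>Common form of \<open>feval\<close> and of the operators \<open>rep\<close> below, so
  that additivity and multiplicativity are proved once for both.\<close>

definition lin_ext :: "('k \<Rightarrow> 'v) \<Rightarrow> ('k \<Rightarrow>\<^sub>0 complex) \<Rightarrow> 'v::complex_vector" where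
  "lin_ext F p = (\<Sum>k\<in>Poly_Mapping.keys p. Poly_Mapping.lookup p k *\<^sub>C F k)"

lemma lin_ext_superset:
  assumes "finite A" "Poly_Mapping.keys p \<subseteq> A"
  shows "lin_ext F p = (\<Sum>k\<in>A. Poly_Mapping.lookup p k *\<^sub>C F k)"
  unfolding lin_ext_def using assms by (intro sum.mono_neutral_left) (auto simp: in_keys_iff)

lemma lin_ext_0 [simp]: "lin_ext F 0 = 0"
  by (simp add: lin_ext_def)

lemma lin_ext_single [simp]: "lin_ext F (Poly_Mapping.single k c) = c *\<^sub>C F k"
  by (cases "c = 0") (simp_all add: lin_ext_def)

lemma lin_ext_add: "lin_ext F (p + r) = lin_ext F p + lin_ext F r"
proof -
  let ?A = "Poly_Mapping.keys p \<union> Poly_Mapping.keys r"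
  have "lin_ext F (p + r) = (\<Sum>k\<in>?A. Poly_Mapping.lookup (p + r) k *\<^sub>C F k)"
    by (intro lin_ext_superset) (auto dest: subsetD[OF keys_add])
  also have "\<dots> = lin_ext F p + lin_ext F r"
    by (simp add: lin_ext_superset[of ?A] lookup_add scaleC_add_left sum.distrib)
  finally show ?thesis .
qed

lemma lin_ext_sum: "lin_ext F (\<Sum>i\<in>I. p i) = (\<Sum>i\<in>I. lin_ext F (p i))"
  by (induction I rule: infinite_finite_induct) (simp_all add: lin_ext_add)

lemma lin_ext_mult:
  "lin_ext F (p * r) = lin_ext (\<lambda>v. lin_ext (\<lambda>w. F (v + w)) r) p"
    for p r :: "'k::monoid_add \<Rightarrow>\<^sub>0 complex"
proof -
  have "p * r = (\<Sum>v\<in>Poly_Mapping.keys p. \<Sum>w\<in>Poly_Mapping.keys r.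
      Poly_Mapping.single (v + w) (Poly_Mapping.lookup p v * Poly_Mapping.lookup r w))"
    by (subst (1) poly_mapping_expand[of p], subst (1) poly_mapping_expand[of r])
      (simp add: sum_product mult_single)
  then show ?thesis
    by (simp add: lin_ext_sum) (simp add: lin_ext_def cvec.scale_sum_right)
qed

lemma clinear_lin_ext_fun:
  assumes "clinear f" shows "f (lin_ext F p) = lin_ext (\<lambda>k. f (F k)) p"
proof -
  interpret f: Vector_Spaces.linear scaleC scaleC f by (rule assms)
  show ?thesis by (simp add: lin_ext_def f.sum f.scale)
qed

text \<open>\<open>word_adj\<close> is an involution, hence it permutes the words and carries the
  support of \<open>p\<close> onto that of \<open>fadj p\<close>.\<close>

lemma lin_ext_fadj:
  fixes F F' :: "word \<Rightarrow> 'v::complex_vector"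
  shows "lin_ext F (fadj p) = (\<Sum>w\<in>Poly_Mapping.keys p. cnj (Poly_Mapping.lookup p w) *\<^sub>C F (word_adj w))"
proof -
  have look: "Poly_Mapping.lookup (fadj p) w = cnj (Poly_Mapping.lookup p (word_adj w))" for w
    by (simp add: fadj.rep_eq)
  have inj: "inj word_adj" by (metis injI word_adj_word_adj)
  have keys: "Poly_Mapping.keys (fadj p) = word_adj ` Poly_Mapping.keys p"
  proof -
    have "w \<in> word_adj ` Poly_Mapping.keys p" if "word_adj w \<in> Poly_Mapping.keys p" for w
      using that by (metis imageI word_adj_word_adj)
    then show ?thesis by (auto simp: in_keys_iff look word_adj_word_adj)
  qed
  show ?thesis unfolding lin_ext_def keys
    by (subst sum.reindex) (auto simp: inj_on_subset[OF inj] look word_adj_word_adj)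
qed

section \<open>Evaluation of noncommutative polynomials\<close>

definition word_val :: "'a::complex_star_algebra_1 \<Rightarrow> 'a \<Rightarrow> 'a \<Rightarrow> word \<Rightarrow> 'a" where
  "word_val a b D w = prod_list (map (letter_val a b D) (letters w))"

lemma feval_lin_ext: "feval a b D p = lin_ext (word_val a b D) p"
  by (simp add: feval_def lin_ext_def word_val_def)

lemma word_val_plus: "word_val a b D (v + w) = word_val a b D v * word_val a b D w"
  by (simp add: word_val_def plus_word_def)

lemma clinear_times_left: "clinear (\<lambda>y. x * y)" for x :: "'a::complex_star_algebra_1"
  by (simp add: clinear_iff distrib_left mult_scaleC_right)

lemma clinear_times_right: "clinear (\<lambda>y. y * x)" for x :: "'a::complex_star_algebra_1"
  by (simp add: clinear_iff distrib_right mult_scaleC_left)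

lemma feval_add: "feval a b D (p + r) = feval a b D p + feval a b D r"
  by (simp add: feval_lin_ext lin_ext_add)

lemma feval_mult: "feval a b D (p * r) = feval a b D p * feval a b D r"
proof -
  have "lin_ext (\<lambda>w. x * word_val a b D w) r = x * lin_ext (word_val a b D) r" for x
    using clinear_lin_ext_fun[OF clinear_times_left] by metis
  moreover have "lin_ext (\<lambda>w. word_val a b D w * y) p = lin_ext (word_val a b D) p * y" for y
    using clinear_lin_ext_fun[OF clinear_times_right] by metis
  ultimately show ?thesis
    by (simp add: feval_lin_ext lin_ext_mult word_val_plus)
qed

lemma feval_fconst: "feval a b D (fconst c) = c *\<^sub>C 1"
  by (simp add: feval_lin_ext fconst_def word_val_def zero_word_def)

lemma feval_one: "feval a b D 1 = 1"
  using feval_fconst[of a b D 1] by (simp add: fconst_def)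

lemma feval_diff: "feval a b D (p - r) = feval a b D p - feval a b D r"
  using feval_add[of a b D "p - r" r] by (simp add: algebra_simps)

lemma adj_zero [simp]: "adj 0 = (0 :: 'a::complex_star_algebra_1)"
  using adj_add[of "0::'a" 0] by simp

lemma adj_one [simp]: "adj 1 = (1 :: 'a::complex_star_algebra_1)"
  by (metis adj_adj adj_mult mult.left_neutral mult.right_neutral)

lemma adj_sum: "adj (\<Sum>i\<in>I. f i) = (\<Sum>i\<in>I. adj (f i :: 'a::complex_star_algebra_1))"
  by (induction I rule: infinite_finite_induct) (simp_all add: adj_add)

lemma adj_power: "adj (x ^ n) = adj (x :: 'a::complex_star_algebra_1) ^ n"
  by (induction n) (simp_all add: adj_mult power_commutes)

lemma adj_prod_list: "adj (prod_list xs) = prod_list (rev (map adj xs))" for xs :: "'a::complex_star_algebra_1 list"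
  by (induction xs) (simp_all add: adj_mult)

lemma feval_fadj: "feval a b D (fadj p) = adj (feval a b D p)"
proof -
  have "letter_val a b D (fst l, \<not> snd l) = adj (letter_val a b D l)" for l
    by (cases l; cases "snd l") (simp_all add: adj_adj Let_def)
  then have "word_val a b D (word_adj w) = adj (word_val a b D w)" for w
    by (simp add: word_val_def word_adj_def adj_prod_list rev_map o_def case_prod_beta
        del: letter_val.simps)
  then show ?thesis
    by (simp add: feval_lin_ext lin_ext_fadj) (simp add: lin_ext_def adj_sum adj_scaleC)
qed

lemma feval_gen:
  "feval a b D (fgen GenA) = a" "feval a b D (fgen GenB) = b" "feval a b D (fgen GenD) = D"
  by (simp_all add: feval_lin_ext fgen_def word_val_def)

lemma feval_scale: "feval a b D (fconst c * p) = c *\<^sub>C feval a b D p"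
  by (simp add: feval_mult feval_fconst mult_scaleC_left)

lemma star_subalgebra_Oq: "star_subalgebra (Oq a b D)"
  unfolding Oq_def by (rule hull_in) (auto simp: star_subalgebra_def)

lemma Oq_gen [simp]: "a \<in> Oq a b D" "b \<in> Oq a b D" "D \<in> Oq a b D"
  using hull_subset[of "{a, b, D}" star_subalgebra] by (auto simp: Oq_def)

lemma Oq_closed [simp]:
  "1 \<in> Oq a b D"
  "x \<in> Oq a b D \<Longrightarrow> y \<in> Oq a b D \<Longrightarrow> x + y \<in> Oq a b D"
  "x \<in> Oq a b D \<Longrightarrow> y \<in> Oq a b D \<Longrightarrow> x * y \<in> Oq a b D"
  "x \<in> Oq a b D \<Longrightarrow> c *\<^sub>C x \<in> Oq a b D"
  "x \<in> Oq a b D \<Longrightarrow> adj x \<in> Oq a b D"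
  using star_subalgebra_Oq[of a b D] unfolding star_subalgebra_def by blast+

lemma Oq_zero [simp]: "0 \<in> Oq a b D"
  using Oq_closed(4)[OF Oq_closed(1), of 0 a b D] by simp

lemma Oq_power [simp]: "x \<in> Oq a b D \<Longrightarrow> x ^ n \<in> Oq a b D"
  by (induction n) simp_all

lemma Oq_sum [simp]: "(\<And>i. i \<in> I \<Longrightarrow> f i \<in> Oq a b D) \<Longrightarrow> (\<Sum>i\<in>I. f i) \<in> Oq a b D"
  by (induction I rule: infinite_finite_induct) simp_all

text \<open>Every element of the algebra thus has a polynomial representative, through which it can
  be made to act on sequences.\<close>

lemma Oq_subset_range_feval: "Oq a b D \<subseteq> range (feval a b D)"
  unfolding Oq_def
proof (rule hull_minimal)
  show "star_subalgebra (range (feval a b D))"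
    unfolding star_subalgebra_def
    by (auto simp flip: feval_one[of a b D] feval_add feval_mult feval_scale feval_fadj)
  show "{a, b, D} \<subseteq> range (feval a b D)"
    by (metis empty_subsetI feval_gen insert_subset rangeI)
qed

section \<open>Weighted shifts on finitely supported sequences\<close>

instantiation poly_mapping :: (type, complex_vector) complex_vector
begin
lift_definition scaleC_poly_mapping :: "complex \<Rightarrow> ('a \<Rightarrow>\<^sub>0 'b) \<Rightarrow> 'a \<Rightarrow>\<^sub>0 'b"
  is "\<lambda>c f k. c *\<^sub>C f k"
  by (auto elim: rev_finite_subset)
instance
  by standard (transfer; simp add: fun_eq_iff scaleC_add_right scaleC_add_left scaleC_scaleC)+
end

text \<open>The dense subspace of finite sequences in the square-summable ones over the integers. It
  is invariant under all operators used here, so no completion is formed.\<close>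

type_synonym seq = "int \<Rightarrow>\<^sub>0 complex"

lemma lookup_scaleC [simp]:
  "Poly_Mapping.lookup (c *\<^sub>C x) k = c *\<^sub>C Poly_Mapping.lookup x k"
  by (simp add: scaleC_poly_mapping.rep_eq)

lift_definition wshift :: "(int \<Rightarrow> complex) \<Rightarrow> int \<Rightarrow> seq \<Rightarrow> seq"
  is "\<lambda>c d x m. c (m - d) * x (m - d)"
proof -
  fix c :: "int \<Rightarrow> complex" and d :: int and x :: "int \<Rightarrow> complex"
  assume "finite {m. x m \<noteq> 0}"
  moreover have "{m. c (m - d) * x (m - d) \<noteq> 0} \<subseteq> (\<lambda>n. n + d) ` {m. x m \<noteq> 0}"
    by (auto intro!: image_eqI[where x = "_ - d"])
  ultimately show "finite {m. c (m - d) * x (m - d) \<noteq> 0}"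
    using finite_subset by blast
qed

lemma wshift_single:
  "wshift c d (Poly_Mapping.single n z) = Poly_Mapping.single (n + d) (c n * z)"
  by (rule poly_mapping_eqI) (auto simp: wshift.rep_eq lookup_single when_def)

lemma clinear_wshift: "clinear (wshift c d)"
  unfolding clinear_iff
  by (auto intro!: poly_mapping_eqI simp: wshift.rep_eq lookup_add scaleC_complex algebra_simps)

lemma keys_wshift: "Poly_Mapping.keys (wshift c d x) \<subseteq> (\<lambda>n. n + d) ` Poly_Mapping.keys x"
  by (auto simp: in_keys_iff wshift.rep_eq intro!: image_eqI[where x = "_ - d"])

definition ip :: "seq \<Rightarrow> seq \<Rightarrow> complex" where
  "ip x y = (\<Sum>n\<in>Poly_Mapping.keys x. cnj (Poly_Mapping.lookup x n) * Poly_Mapping.lookup y n)"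

definition nrm :: "seq \<Rightarrow> real" where
  "nrm x = L2_set (\<lambda>n. cmod (Poly_Mapping.lookup x n)) (Poly_Mapping.keys x)"

lemma ip_superset:
  assumes "finite A" "Poly_Mapping.keys x \<subseteq> A \<or> Poly_Mapping.keys y \<subseteq> A"
  shows "ip x y = (\<Sum>n\<in>A. cnj (Poly_Mapping.lookup x n) * Poly_Mapping.lookup y n)"
proof -
  have "ip x y = (\<Sum>n\<in>Poly_Mapping.keys x \<union> A. cnj (Poly_Mapping.lookup x n) * Poly_Mapping.lookup y n)"
    unfolding ip_def using assms(1) by (intro sum.mono_neutral_left) (auto simp: in_keys_iff)
  also have "\<dots> = (\<Sum>n\<in>A. cnj (Poly_Mapping.lookup x n) * Poly_Mapping.lookup y n)"
    using assms by (intro sum.mono_neutral_right) (auto simp: in_keys_iff)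
  finally show ?thesis .
qed

lemma nrm_superset:
  assumes "finite A" "Poly_Mapping.keys x \<subseteq> A"
  shows "nrm x = L2_set (\<lambda>n. cmod (Poly_Mapping.lookup x n)) A"
  unfolding nrm_def L2_set_def using assms
  by (intro arg_cong[where f = sqrt] sum.mono_neutral_left) (auto simp: in_keys_iff)

lemma nrm_nonneg [simp]: "0 \<le> nrm x"
  by (simp add: nrm_def)

lemma nrm_zero [simp]: "nrm 0 = 0"
  by (simp add: nrm_def)

lemma nrm_eq_0_iff [simp]: "nrm x = 0 \<longleftrightarrow> x = 0"
  by (auto simp: nrm_def L2_set_eq_0_iff in_keys_iff intro: poly_mapping_eqI)

lemma ip_self: "ip x x = complex_of_real ((nrm x)\<^sup>2)"
proof -
  have "cnj z * z = complex_of_real ((cmod z)\<^sup>2)" for z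
    by (metis complex_norm_square mult.commute of_real_power)
  then show ?thesis
    by (simp add: ip_def nrm_def L2_set_def real_sqrt_pow2 sum_nonneg)
qed

lemma ip_commute: "ip y x = cnj (ip x y)"
proof -
  let ?A = "Poly_Mapping.keys x \<union> Poly_Mapping.keys y"
  show ?thesis
    by (subst (1 2) ip_superset[of ?A]) (auto simp: mult.commute)
qed

lemma clinear_ip: "clinear (ip x)"
  unfolding clinear_iff
  by (auto simp: ip_def lookup_add algebra_simps sum.distrib sum_distrib_left scaleC_complex)

lemma cmod_ip_le: "cmod (ip x y) \<le> nrm x * nrm y"
proof -
  let ?A = "Poly_Mapping.keys x \<union> Poly_Mapping.keys y"
  have "cmod (ip x y) \<le> (\<Sum>n\<in>?A. \<bar>cmod (Poly_Mapping.lookup x n)\<bar> * \<bar>cmod (Poly_Mapping.lookup y n)\<bar>)"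
    by (subst ip_superset[of ?A]) (auto intro!: order.trans[OF norm_sum] simp: norm_mult)
  also have "\<dots> \<le> nrm x * nrm y"
    by (simp only: nrm_superset[of ?A] finite_Un finite_keys Un_upper1 Un_upper2 simp_thms L2_set_mult_ineq)
  finally show ?thesis .
qed

lemma nrm_triangle: "nrm (x + y) \<le> nrm x + nrm y"
proof -
  let ?A = "Poly_Mapping.keys x \<union> Poly_Mapping.keys y"
  have "nrm (x + y) = L2_set (\<lambda>n. cmod (Poly_Mapping.lookup x n + Poly_Mapping.lookup y n)) ?A"
    by (subst nrm_superset[of ?A]) (auto dest: subsetD[OF keys_add] simp: lookup_add)
  also have "\<dots> \<le> L2_set (\<lambda>n. cmod (Poly_Mapping.lookup x n) + cmod (Poly_Mapping.lookup y n)) ?A"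
    by (intro L2_set_mono) (auto intro: norm_triangle_ineq)
  also have "\<dots> \<le> nrm x + nrm y"
    by (simp only: nrm_superset[of ?A] finite_Un finite_keys Un_upper1 Un_upper2 simp_thms L2_set_triangle_ineq)
  finally show ?thesis .
qed

lemma nrm_scaleC: "nrm (c *\<^sub>C x) = cmod c * nrm x"
proof -
  have "nrm (c *\<^sub>C x) = L2_set (\<lambda>n. cmod c * cmod (Poly_Mapping.lookup x n)) (Poly_Mapping.keys x)"
    by (subst nrm_superset[of "Poly_Mapping.keys x"]) (auto simp: in_keys_iff scaleC_complex norm_mult)
  then show ?thesis by (simp add: nrm_def L2_set_right_distrib)
qed

lemma nrm_sum_le: "nrm (\<Sum>i\<in>I. f i) \<le> (\<Sum>i\<in>I. nrm (f i))"
  by (induction I rule: infinite_finite_induct) (auto intro: order.trans[OF nrm_triangle])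

lemma nrm_wshift_le:
  assumes "\<And>n. cmod (c n) \<le> 1" shows "nrm (wshift c d x) \<le> nrm x"
proof -
  have "nrm (wshift c d x) = L2_set (\<lambda>n. cmod (c n * Poly_Mapping.lookup x n)) (Poly_Mapping.keys x)"
    by (subst nrm_superset[OF _ keys_wshift])
      (simp_all add: L2_set_def sum.reindex inj_on_def wshift.rep_eq)
  also have "\<dots> \<le> nrm x"
    unfolding nrm_def using assms
    by (intro L2_set_mono) (auto simp: norm_mult intro: mult_left_le_one_le)
  finally show ?thesis .
qed

text \<open>The adjoint carries the basis vector at \<open>n\<close> back to \<open>n - d\<close>;
  its weight is therefore the conjugate of the one attached to \<open>n - d\<close>.\<close>

lemma ip_wshift: "ip (wshift c d x) y = ip x (wshift (\<lambda>n. cnj (c (n - d))) (- d) y)"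
proof -
  have "ip (wshift c d x) y = (\<Sum>n\<in>(\<lambda>n. n + d) ` Poly_Mapping.keys x.
      cnj (Poly_Mapping.lookup (wshift c d x) n) * Poly_Mapping.lookup y n)"
    by (rule ip_superset) (auto dest: subsetD[OF keys_wshift])
  then show ?thesis
    by (simp add: sum.reindex inj_on_def wshift.rep_eq ip_def mult.assoc mult.left_commute)
qed

section \<open>C*-seminorms from weighted shifts\<close>

text \<open>Weights of modulus at most 1 make every word a contraction. The operator norm of a
  polynomial is then bounded by the sum of the moduli of its coefficients.\<close>

locale shift_rep =
  fixes W :: "uq2_gen \<Rightarrow> int \<Rightarrow> complex" and sh :: "uq2_gen \<Rightarrow> int"
  assumes W_le: "cmod (W g n) \<le> 1"
begin

definition letter_op :: "uq2_gen \<times> bool \<Rightarrow> seq \<Rightarrow> seq" where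
  "letter_op l = (let (g, s) = l in
     if s then wshift (\<lambda>n. cnj (W g (n - sh g))) (- sh g) else wshift (W g) (sh g))"

definition act :: "word \<Rightarrow> seq \<Rightarrow> seq" where
  "act w = foldr letter_op (letters w)"

definition rep :: "star_poly \<Rightarrow> seq \<Rightarrow> seq" where
  "rep p x = lin_ext (\<lambda>w. act w x) p"

lemma clinear_letter_op: "clinear (letter_op l)"
  by (simp add: letter_op_def clinear_wshift split: prod.split)

lemma clinear_act: "clinear (act w)"
proof -
  have "clinear (foldr letter_op ls)" for ls
  proof (induction ls)
    case (Cons l ls)
    then show ?case
      using clinear_letter_op[of l] by (simp add: clinear_iff)
  qed (simp add: clinear_iff)
  then show ?thesis by (simp add: act_def)
qed

lemma act_plus: "act (v + w) x = act v (act w x)"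
  by (simp add: act_def plus_word_def)

lemma nrm_letter_op_le: "nrm (letter_op l x) \<le> nrm x"
  by (auto simp: letter_op_def W_le intro!: nrm_wshift_le split: prod.split)

lemma nrm_act_le: "nrm (act w x) \<le> nrm x"
proof -
  have "nrm (foldr letter_op ls x) \<le> nrm x" for ls
    by (induction ls) (auto intro: order.trans[OF nrm_letter_op_le])
  then show ?thesis by (simp add: act_def)
qed

lemma ip_letter_op: "ip (letter_op (g, s) x) y = ip x (letter_op (g, \<not> s) y)"
  by (simp add: letter_op_def ip_wshift)

lemma ip_act: "ip (act w x) y = ip x (act (word_adj w) y)"
proof -
  have "ip (foldr letter_op ls x) y = ip x (foldr letter_op (rev (map (\<lambda>(g, s). (g, \<not> s)) ls)) y)" for ls
  proof (induction ls arbitrary: y)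
    case (Cons l ls)
    then show ?case by (cases l) (simp add: ip_letter_op)
  qed simp
  then show ?thesis by (simp add: act_def word_adj_def)
qed

lemma clinear_rep: "clinear (rep p)"
  using clinear_act unfolding clinear_iff rep_def lin_ext_def
  by (simp add: scaleC_add_right sum.distrib cvec.scale_sum_right mult.commute)

lemma rep_add: "rep (p + r) x = rep p x + rep r x"
  by (simp add: rep_def lin_ext_add)

lemma rep_mult: "rep (p * r) x = rep p (rep r x)"
  by (simp add: rep_def lin_ext_mult act_plus clinear_lin_ext_fun[OF clinear_act])

lemma rep_fconst: "rep (fconst c) x = c *\<^sub>C x"
  by (simp add: rep_def fconst_def act_def zero_word_def)

lemma rep_one: "rep 1 x = x"
  using rep_fconst[of 1 x] by (simp add: fconst_def)

lemma rep_diff: "rep (p - r) x = rep p x - rep r x"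
  using rep_add[of "p - r" r x] by (simp add: algebra_simps)

lemma rep_gen: "rep (fgen g) = letter_op (g, False)"
  by (simp add: rep_def fgen_def act_def fun_eq_iff)

lemma rep_fadj_gen: "rep (fadj (fgen g)) = letter_op (g, True)"
proof -
  have "fadj (fgen g) = Poly_Mapping.single (Word [(g, True)]) 1"
    by (rule poly_mapping_eqI)
      (auto simp: fadj.rep_eq fgen_def lookup_single when_def word_adj_def word.expand)
  then show ?thesis by (simp add: rep_def act_def fun_eq_iff)
qed

lemma ip_rep: "ip (rep p x) y = ip x (rep (fadj p) y)"
proof -
  interpret l: Vector_Spaces.linear scaleC scaleC "ip z" for z by (rule clinear_ip)
  have "cnj (ip x (act (word_adj w) y)) = ip y (act w x)" for w
    by (metis ip_act ip_commute)
  then have "ip y (rep p x) = cnj (ip x (rep (fadj p) y))"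
    by (simp add: rep_def lin_ext_fadj l.sum l.scale scaleC_complex) (simp add: lin_ext_def l.sum l.scale scaleC_complex)
  then show ?thesis by (metis complex_cnj_cnj ip_commute)
qed

lemma nrm_rep_le: "nrm (rep p x) \<le> (\<Sum>w\<in>Poly_Mapping.keys p. cmod (Poly_Mapping.lookup p w)) * nrm x"
  unfolding rep_def lin_ext_def sum_distrib_right
  by (rule order.trans[OF nrm_sum_le]) (auto intro!: sum_mono mult_left_mono simp: nrm_scaleC nrm_act_le)

text \<open>The operator norm on a pre-Hilbert space. Universality only asks for a C*-seminorm on
  the free algebra, so no C*-algebra of operators has to be built.\<close>

definition opn :: "star_poly \<Rightarrow> real" where
  "opn p = (SUP x\<in>{x. nrm x \<le> 1}. nrm (rep p x))"

lemma opn_le: "opn p \<le> K" if "\<And>x. nrm (rep p x) \<le> K * nrm x" "0 \<le> K"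
  unfolding opn_def
proof (rule cSUP_least)
  show "{x. nrm x \<le> 1} \<noteq> {}" by (auto intro: exI[of _ 0])
  show "nrm (rep p x) \<le> K" if "x \<in> {x. nrm x \<le> 1}" for x
    using that \<open>0 \<le> K\<close> \<open>\<And>x. nrm (rep p x) \<le> K * nrm x\<close>[of x]
    by (auto intro: order.trans[OF _ mult_left_le])
qed

lemma bdd_opn: "bdd_above ((\<lambda>x. nrm (rep p x)) ` {x. nrm x \<le> 1})"
  by (rule bdd_aboveI2[of _ _ "\<Sum>w\<in>Poly_Mapping.keys p. cmod (Poly_Mapping.lookup p w)"])
    (auto intro!: order.trans[OF nrm_rep_le] mult_left_le sum_nonneg)

lemma nrm_rep_le_opn: "nrm (rep p x) \<le> opn p * nrm x"
proof (cases "x = 0")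
  case True
  then show ?thesis using nrm_rep_le[of p 0] by simp
next
  case False
  then have pos: "nrm x > 0" using nrm_nonneg[of x] by (simp add: less_le)
  define y where "y = complex_of_real (1 / nrm x) *\<^sub>C x"
  have "nrm y \<le> 1" using pos by (simp add: y_def nrm_scaleC norm_divide)
  then have "nrm (rep p y) \<le> opn p"
    unfolding opn_def by (intro cSUP_upper bdd_opn) auto
  moreover have "nrm (rep p y) = nrm (rep p x) / nrm x"
    using clinear_rep[of p] pos by (simp add: y_def clinear_iff nrm_scaleC norm_divide)
  ultimately show ?thesis using pos by (simp add: field_simps)
qed

lemma opn_nonneg [simp]: "0 \<le> opn p"
proof -
  have "nrm (rep p 0) \<le> opn p"
    unfolding opn_def by (intro cSUP_upper bdd_opn) auto
  then show ?thesis using nrm_nonneg order.trans by blast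
qed

lemma opn_mult_le: "opn (p * r) \<le> opn p * opn r"
  by (rule opn_le)
    (auto simp: rep_mult mult.assoc intro!: order.trans[OF nrm_rep_le_opn] mult_left_mono nrm_rep_le_opn)

text \<open>The nontrivial half of the C*-identity: the squared norm of \<open>rep p x\<close> is
  the inner product of \<open>x\<close> with \<open>rep (fadj p * p) x\<close>, and Cauchy-Schwarz
  applies.\<close>

lemma opn_square_le: "(opn p)\<^sup>2 \<le> opn (fadj p * p)"
proof -
  have "nrm (rep p x) \<le> sqrt (opn (fadj p * p)) * nrm x" for x
  proof -
    have "(nrm (rep p x))\<^sup>2 = cmod (ip x (rep (fadj p * p) x))"
      by (simp add: rep_mult ip_self norm_power flip: ip_rep)
    also have "\<dots> \<le> nrm x * (opn (fadj p * p) * nrm x)"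
      by (rule order.trans[OF cmod_ip_le]) (intro mult_left_mono nrm_rep_le_opn nrm_nonneg)
    also have "\<dots> = (sqrt (opn (fadj p * p)) * nrm x)\<^sup>2"
      by (simp add: power_mult_distrib power2_eq_square)
    finally show ?thesis by (rule power2_le_imp_le) simp
  qed
  then have "opn p \<le> sqrt (opn (fadj p * p))" by (rule opn_le) simp
  then have "(opn p)\<^sup>2 \<le> (sqrt (opn (fadj p * p)))\<^sup>2" by (intro power_mono) auto
  then show ?thesis by simp
qed

lemma fadj_fadj: "fadj (fadj p) = p"
  by (rule poly_mapping_eqI) (simp add: fadj.rep_eq word_adj_word_adj)

text \<open>Cancelling \<open>opn r\<close> in
  \<open>opn r * opn r \<le> opn (fadj r) * opn r\<close> gives one inequality; applied to
  \<open>fadj p\<close>, it gives the other.\<close>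

lemma opn_fadj: "opn (fadj p) = opn p"
proof -
  have le: "opn r \<le> opn (fadj r)" for r
  proof (cases "opn r = 0")
    case False
    have "opn r * opn r \<le> opn (fadj r) * opn r"
      using opn_square_le[of r] opn_mult_le[of "fadj r" r] by (simp add: power2_eq_square)
    then show ?thesis using False opn_nonneg[of r] by simp
  qed simp
  from le[of p] le[of "fadj p"] show ?thesis by (simp add: fadj_fadj)
qed

lemma cstar_seminorm_opn: "cstar_seminorm opn"
  unfolding cstar_seminorm_def
proof (intro conjI allI)
  show "opn (p + r) \<le> opn p + opn r" for p r
  proof (rule opn_le)
    show "nrm (rep (p + r) x) \<le> (opn p + opn r) * nrm x" for x
      using nrm_triangle[of "rep p x" "rep r x"] nrm_rep_le_opn[of p x] nrm_rep_le_opn[of r x]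
      by (simp add: rep_add algebra_simps)
  qed simp
  show "opn (fconst c * p) = cmod c * opn p" for c p
  proof (cases "c = 0")
    case True
    have "opn (fconst c * p) \<le> 0"
      by (rule opn_le) (simp_all add: True rep_mult rep_fconst)
    then have "opn (fconst c * p) = 0" using opn_nonneg by (rule order_antisym)
    then show ?thesis using True by simp
  next
    case False
    have eq: "nrm (rep (fconst c * p) x) = cmod c * nrm (rep p x)" for x
      by (simp add: rep_mult rep_fconst nrm_scaleC)
    have "opn (fconst c * p) \<le> cmod c * opn p"
      by (rule opn_le) (auto simp: eq mult.assoc intro!: mult_left_mono nrm_rep_le_opn)
    moreover have "opn p \<le> opn (fconst c * p) / cmod c"
    proof (rule opn_le)
      show "nrm (rep p x) \<le> opn (fconst c * p) / cmod c * nrm x" for x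
        using nrm_rep_le_opn[of "fconst c * p" x] False by (simp add: eq field_simps)
    qed simp
    ultimately show ?thesis using False by (simp add: field_simps)
  qed
  show "opn (p * r) \<le> opn p * opn r" for p r by (rule opn_mult_le)
  show "opn (fadj p * p) = (opn p)\<^sup>2" for p
    using opn_square_le[of p] opn_mult_le[of "fadj p" p] by (simp add: opn_fadj power2_eq_square)
qed

text \<open>The only use of maximality of the universal norm: it dominates \<open>opn\<close>, so
  the action on sequences factors through the algebra.\<close>

lemma rep_eq_0_if_feval_eq_0:
  assumes univ: "universal_Uq2 q a b D"
    and rel: "\<And>r x. r \<in> uq2_relators q \<Longrightarrow> rep r x = 0"
    and p: "feval a b D p = 0"
  shows "rep p x = 0"
proof -
  have "opn r = 0" if "r \<in> uq2_relators q" for r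
    using opn_le[of r 0] rel[OF that] opn_nonneg[of r] by simp
  then have "opn p \<le> norm (feval a b D p)"
    using univ cstar_seminorm_opn unfolding universal_Uq2_def by blast
  then have "nrm (rep p x) \<le> 0 * nrm x"
    using p nrm_rep_le_opn[of p x] opn_nonneg[of p] by simp
  then have "nrm (rep p x) = 0"
    using nrm_nonneg[of "rep p x"] by linarith
  then show ?thesis by simp
qed

end

text \<open>With \<open>y\<close> the tangent of an angle, \<open>a\<close> is the cosine times a
  diagonal unitary and \<open>b\<close> is the sine times the bilateral shift. The exponents
  \<open>- n\<close> and \<open>- (2 * n)\<close> are dictated by \<open>b * a = q a b\<close> and
  \<open>b * D = q^2 D b\<close>; the phases \<open>u\<close> and \<open>w\<close> are left free by
  the relations. The tangent as parameter makes every matrix entry of a monomial a power of the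
  cosine times a power of \<open>y\<close>.\<close>

definition weight :: "complex \<Rightarrow> real \<Rightarrow> complex \<Rightarrow> complex \<Rightarrow> uq2_gen \<Rightarrow> int \<Rightarrow> complex" where
  "weight q y u w g n = (case g of
     GenA \<Rightarrow> complex_of_real (1 / sqrt (1 + y\<^sup>2)) * u * q powi (- n)
   | GenB \<Rightarrow> complex_of_real (y / sqrt (1 + y\<^sup>2))
   | GenD \<Rightarrow> w * q powi (- (2 * n)))"

definition gen_shift :: "uq2_gen \<Rightarrow> int" where
  "gen_shift g = (case g of GenB \<Rightarrow> 1 | _ \<Rightarrow> 0)"

lemma shift_rep_weight:
  assumes "cmod q = 1" "cmod u = 1" "cmod w = 1"
  shows "shift_rep (weight q y u w)"
proof
  have "\<bar>y\<bar> \<le> sqrt (1 + y\<^sup>2)" by (rule real_le_rsqrt) simp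
  moreover have "1 \<le> sqrt (1 + y\<^sup>2)" by simp
  moreover have "0 < sqrt (1 + y\<^sup>2)" by (simp add: add_pos_nonneg)
  ultimately show "cmod (weight q y u w g n) \<le> 1" for g n
    using assms by (auto simp: weight_def norm_mult norm_power_int norm_divide divide_le_eq split: uq2_gen.split)
qed

definition shift_rep_Uq2 :: "complex \<Rightarrow> real \<Rightarrow> complex \<Rightarrow> complex \<Rightarrow> star_poly \<Rightarrow> seq \<Rightarrow> seq" where
  "shift_rep_Uq2 q y u w = shift_rep.rep (weight q y u w) gen_shift"

lemma cnj_unimodular: "cnj z = inverse z" if "cmod z = 1"
  using that complex_norm_square[of z] by (metis inverse_unique of_real_1 power_one)

lemma shift_rep_relators:
  assumes q: "cmod q = 1" and u: "cmod u = 1" and w: "cmod w = 1"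
    and r: "r \<in> uq2_relators q"
  shows "shift_rep_Uq2 q y u w r x = 0"
proof -
  interpret shift_rep "weight q y u w" gen_shift
    by (rule shift_rep_weight[OF q u w])
  define al be where "al = complex_of_real (1 / sqrt (1 + y\<^sup>2))" and "be = complex_of_real (y / sqrt (1 + y\<^sup>2))"
  have "0 < 1 + y\<^sup>2" by (simp add: add_pos_nonneg)
  then have "(1 / sqrt (1 + y\<^sup>2))\<^sup>2 + (y / sqrt (1 + y\<^sup>2))\<^sup>2 = 1"
    by (simp only: power_divide real_sqrt_pow2 less_imp_le add_divide_distrib[symmetric] power_one divide_self_if) simp
  then have sq: "al * al + be * be = 1"
    unfolding al_def be_def power2_eq_square by (metis of_real_1 of_real_add of_real_mult)
  have cn: "cnj al = al" "cnj be = be" "cnj u = inverse u" "cnj w = inverse w" "cnj q = inverse q"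
    by (simp_all add: al_def be_def cnj_unimodular q u w)
  have nz: "u \<noteq> 0" "w \<noteq> 0" "q \<noteq> 0" using q u w by auto
  \<comment> \<open>The identity between sine and cosine, in a form that rewrites inside nested
    products of operators.\<close>
  have sq': "be * (be * z) = z - al * (al * z)" for z
    using arg_cong[OF sq, of "\<lambda>t. t * z"] by (simp add: algebra_simps)
  have W: "weight q y u w GenA n = al * u * q powi (- n)" "weight q y u w GenB n = be"
    "weight q y u w GenD n = w * q powi (- (2 * n))" for n
    by (simp_all add: weight_def al_def be_def)
  have sh: "gen_shift GenA = 0" "gen_shift GenB = 1" "gen_shift GenD = 0"
    by (simp_all add: gen_shift_def)
  note ev = rep_diff rep_add rep_mult rep_fconst rep_one rep_gen rep_fadj_gen letter_op_def q sh W
    lookup_minus lookup_add wshift.rep_eq scaleC_complex cn nz power_int_minus power_int_add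
    power_int_diff power_int_inverse sq' right_diff_distrib power2_eq_square
  let ?a = "fgen GenA" and ?b = "fgen GenB" and ?D = "fgen GenD"
  have "rep (?b * ?a - fconst q * (?a * ?b)) x = 0"
    "rep (fadj ?a * ?b - fconst q * (?b * fadj ?a)) x = 0"
    "rep (?b * fadj ?b - fadj ?b * ?b) x = 0"
    "rep (?a * fadj ?a + ?b * fadj ?b - 1) x = 0"
    "rep (?a * ?D - ?D * ?a) x = 0"
    "rep (?b * ?D - fconst (q\<^sup>2 / complex_of_real ((cmod q)\<^sup>2)) * (?D * ?b)) x = 0"
    "rep (?D * fadj ?D - 1) x = 0"
    "rep (fadj ?D * ?D - 1) x = 0"
    "rep (fadj ?a * ?a + fconst (complex_of_real ((cmod q)\<^sup>2)) * (fadj ?b * ?b) - 1) x = 0"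
    by (rule poly_mapping_eqI, simp add: ev, (simp add: field_simps nz; fail)?)+
  with r show ?thesis
    by (auto simp: uq2_relators_def Let_def shift_rep_Uq2_def)
qed

section \<open>The action of the algebra on sequences and the degrees of its matrix entries\<close>

locale Uq2 =
  fixes q :: complex and a b D :: "'a::cstar_algebra_1"
  assumes q_unimodular: "cmod q = 1"
    and q_not_root: "\<forall>n>0. q ^ n \<noteq> 1"
    and universal: "universal_Uq2 q a b D"
begin

abbreviation Alg :: "'a set" where "Alg \<equiv> Oq a b D"

text \<open>The choice of the representative is immaterial by \<open>Phi_feval\<close>.\<close>

definition Phi :: "real \<Rightarrow> complex \<Rightarrow> complex \<Rightarrow> 'a \<Rightarrow> seq \<Rightarrow> seq" where
  "Phi y u w x = shift_rep_Uq2 q y u w (SOME p. feval a b D p = x)"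

context
  fixes y :: real and u w :: complex
  assumes u: "cmod u = 1" and w: "cmod w = 1"
begin

interpretation shift_rep "weight q y u w" gen_shift
  by (rule shift_rep_weight[OF q_unimodular u w])

lemma Phi_feval: "Phi y u w (feval a b D p) x = rep p x"
proof -
  define r where "r = (SOME r. feval a b D r = feval a b D p)"
  have "feval a b D r = feval a b D p"
    unfolding r_def by (rule someI[where P = "\<lambda>r. feval a b D r = feval a b D p", OF refl])
  then have 0: "feval a b D (p - r) = 0" by (simp add: feval_diff)
  have "rep (p - r) x = 0"
    by (rule rep_eq_0_if_feval_eq_0[OF universal _ 0])
      (use shift_rep_relators[OF q_unimodular u w] in \<open>simp add: shift_rep_Uq2_def\<close>)
  then show ?thesis
    by (simp add: Phi_def rep_diff shift_rep_Uq2_def flip: r_def)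
qed

lemma Phi_hom:
  assumes "x \<in> Alg" "z \<in> Alg"
  shows "Phi y u w (x + z) v = Phi y u w x v + Phi y u w z v"
    and "Phi y u w (x * z) v = Phi y u w x (Phi y u w z v)"
    and "Phi y u w (c *\<^sub>C x) v = c *\<^sub>C Phi y u w x v"
proof -
  obtain p r where "x = feval a b D p" "z = feval a b D r"
    using assms[THEN subsetD[OF Oq_subset_range_feval]] by (elim rangeE)
  then show "Phi y u w (x + z) v = Phi y u w x v + Phi y u w z v"
    "Phi y u w (x * z) v = Phi y u w x (Phi y u w z v)"
    "Phi y u w (c *\<^sub>C x) v = c *\<^sub>C Phi y u w x v"
    by (simp_all add: Phi_feval rep_add rep_mult rep_fconst flip: feval_add feval_mult feval_scale)
qed

lemma Phi_one: "Phi y u w 1 v = v"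
  using Phi_feval[of 1] by (simp add: feval_one rep_one)

lemma Phi_zero: "Phi y u w 0 v = 0"
  using Phi_hom(3)[OF Oq_zero Oq_zero, of 0 v] by simp

lemma Phi_sum:
  "(\<And>i. i \<in> I \<Longrightarrow> f i \<in> Alg) \<Longrightarrow> Phi y u w (\<Sum>i\<in>I. f i) v = (\<Sum>i\<in>I. Phi y u w (f i) v)"
  by (induction I rule: infinite_finite_induct) (auto simp: Phi_zero Phi_hom(1))

lemma Phi_gen:
  "Phi y u w a v = wshift (weight q y u w GenA) 0 v"
  "Phi y u w b v = wshift (weight q y u w GenB) 1 v"
  "Phi y u w D v = wshift (weight q y u w GenD) 0 v"
  "Phi y u w (adj a) v = wshift (\<lambda>n. cnj (weight q y u w GenA n)) 0 v"
  "Phi y u w (adj b) v = wshift (\<lambda>n. cnj (weight q y u w GenB (n - 1))) (- 1) v"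
  "Phi y u w (adj D) v = wshift (\<lambda>n. cnj (weight q y u w GenD n)) 0 v"
  using Phi_feval[of "fgen GenA" v] Phi_feval[of "fgen GenB" v] Phi_feval[of "fgen GenD" v]
    Phi_feval[of "fadj (fgen GenA)" v] Phi_feval[of "fadj (fgen GenB)" v] Phi_feval[of "fadj (fgen GenD)" v]
  by (simp_all add: feval_gen feval_fadj rep_gen rep_fadj_gen letter_op_def gen_shift_def)

end


definition al :: "real \<Rightarrow> complex" where "al y = complex_of_real (1 / sqrt (1 + y\<^sup>2))"

lemma al_nonzero: "al y \<noteq> 0"
proof -
  have "0 < 1 + y\<^sup>2" by (simp add: add_pos_nonneg)
  then have "sqrt (1 + y\<^sup>2) \<noteq> 0" by (metis less_irrefl real_sqrt_eq_0_iff)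
  then show ?thesis by (simp add: al_def)
qed

text \<open>\<open>N\<close>, \<open>E\<close>, \<open>U\<close>, \<open>V\<close> are the degrees of the matrix entries of \<open>x\<close> in the
  parameters \<open>al y\<close>, \<open>y\<close>, \<open>u\<close>, \<open>w\<close> of the representation.\<close>

definition acts :: "'a \<Rightarrow> int \<Rightarrow> nat \<Rightarrow> nat \<Rightarrow> int \<Rightarrow> int \<Rightarrow> bool" where
  "acts x d N E U V \<longleftrightarrow> x \<in> Alg \<and> (\<exists>\<zeta>. (\<forall>n. \<zeta> n \<noteq> 0) \<and>
     (\<forall>y u w n z. cmod u = 1 \<longrightarrow> cmod w = 1 \<longrightarrow> Phi y u w x (Poly_Mapping.single n z) =
        Poly_Mapping.single (n + d) (\<zeta> n * al y ^ N * complex_of_real y ^ E * u powi U * w powi V * z)))"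

lemma Phi_scaleC:
  "cmod u = 1 \<Longrightarrow> cmod w = 1 \<Longrightarrow> x \<in> Alg \<Longrightarrow> Phi y u w (c *\<^sub>C x) v = c *\<^sub>C Phi y u w x v"
  using Phi_hom(3) by blast

text \<open>The right factor first moves the basis vector from \<open>n\<close> to
  \<open>n + d'\<close>, which is where the scalar of the left factor is read.\<close>

lemma acts_mult:
  assumes "acts x d N E U V" "acts x' d' N' E' U' V'"
  shows "acts (x * x') (d + d') (N + N') (E + E') (U + U') (V + V')"
proof -
  obtain \<zeta> where z: "\<forall>n. \<zeta> n \<noteq> 0" "\<And>y u w n z. cmod u = 1 \<Longrightarrow> cmod w = 1 \<Longrightarrow> Phi y u w x (Poly_Mapping.single n z) =
        Poly_Mapping.single (n + d) (\<zeta> n * al y ^ N * complex_of_real y ^ E * u powi U * w powi V * z)"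
    using assms(1) unfolding acts_def by blast
  obtain \<zeta>' where z': "\<forall>n. \<zeta>' n \<noteq> 0" "\<And>y u w n z. cmod u = 1 \<Longrightarrow> cmod w = 1 \<Longrightarrow> Phi y u w x' (Poly_Mapping.single n z) =
        Poly_Mapping.single (n + d') (\<zeta>' n * al y ^ N' * complex_of_real y ^ E' * u powi U' * w powi V' * z)"
    using assms(2) unfolding acts_def by blast
  have x: "x \<in> Alg" "x' \<in> Alg" using assms by (auto simp: acts_def)
  have eq: "Phi y u w (x * x') (Poly_Mapping.single n z) = Poly_Mapping.single (n + (d + d'))
      (\<zeta> (n + d') * \<zeta>' n * al y ^ (N + N') * complex_of_real y ^ (E + E') * u powi (U + U') * w powi (V + V') * z)"
    if "cmod u = 1" "cmod w = 1" for y u w n z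
  proof -
    have "u \<noteq> 0" "w \<noteq> 0" using that by auto
    then show ?thesis
      by (simp only: Phi_hom(2) that x z(2) z'(2) power_add power_int_add simp_thms)
        (intro arg_cong2[where f = Poly_Mapping.single], simp_all)
  qed
  show ?thesis unfolding acts_def
  proof (intro conjI exI[of _ "\<lambda>n. \<zeta> (n + d') * \<zeta>' n"] allI impI)
    show "x * x' \<in> Alg" using x by simp
    show "\<zeta> (n + d') * \<zeta>' n \<noteq> 0" for n using z(1) z'(1) by simp
  qed (rule eq)
qed

lemma acts_one: "acts 1 0 0 0 0 0"
  unfolding acts_def by (auto simp: Phi_one intro!: exI[of _ "\<lambda>_. 1"])

lemma acts_power:
  assumes "acts x d N E U V"
  shows "acts (x ^ k) (int k * d) (k * N) (k * E) (int k * U) (int k * V)"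
proof (induction k)
  case 0
  then show ?case using acts_one by simp
next
  case (Suc k)
  from acts_mult[OF assms this] show ?case by (simp add: algebra_simps)
qed

lemma acts_gen:
  "acts a 0 1 0 1 0" "acts b 1 1 1 0 0" "acts D 0 0 0 0 1"
  "acts (adj a) 0 1 0 (- 1) 0" "acts (adj b) (- 1) 1 1 0 0" "acts (adj D) 0 0 0 0 (- 1)"
proof -
  have q0: "q \<noteq> 0" using q_unimodular by auto
  note s = Phi_gen wshift_single weight_def al_def power_int_minus cnj_unimodular q_unimodular power_int_inverse
  show "acts a 0 1 0 1 0" unfolding acts_def using q0
    by (auto simp: s intro!: exI[of _ "\<lambda>n. q powi (- n)"] arg_cong2[where f = Poly_Mapping.single])
  show "acts b 1 1 1 0 0" unfolding acts_def
    by (auto simp: s intro!: exI[of _ "\<lambda>_. 1"] arg_cong2[where f = Poly_Mapping.single])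
  show "acts D 0 0 0 0 1" unfolding acts_def using q0
    by (auto simp: s intro!: exI[of _ "\<lambda>n. q powi (- (2 * n))"] arg_cong2[where f = Poly_Mapping.single])
  show "acts (adj a) 0 1 0 (- 1) 0" unfolding acts_def using q0
    by (auto simp: s intro!: exI[of _ "\<lambda>n. q powi n"] arg_cong2[where f = Poly_Mapping.single])
  show "acts (adj b) (- 1) 1 1 0 0" unfolding acts_def
    by (auto simp: s intro!: exI[of _ "\<lambda>_. 1"] arg_cong2[where f = Poly_Mapping.single])
  show "acts (adj D) 0 0 0 0 (- 1)" unfolding acts_def using q0
    by (auto simp: s intro!: exI[of _ "\<lambda>n. q powi (2 * n)"] arg_cong2[where f = Poly_Mapping.single])
qed

lemma acts_upow: "acts (upow D k) 0 0 0 0 k"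
  using acts_power[OF acts_gen(3), of "nat k"] acts_power[OF acts_gen(6), of "nat (- k)"]
  by (auto simp: upow_def)

text \<open>The entry in row \<open>d i\<close> and column 0 at \<open>u = w = 1\<close> collects
  the terms with the same shift as \<open>x i\<close>. Because \<open>N\<close> is common to all
  terms, the nonzero factor \<open>al y ^ N\<close> splits off and leaves a polynomial in
  \<open>y\<close> that vanishes on all real numbers. Its coefficient at \<open>E i\<close> comes
  from \<open>i\<close> alone, since shift and \<open>y\<close>-degree together determine the
  index.\<close>

lemma acts_independent:
  assumes fin: "finite I" and act: "\<And>i. i \<in> I \<Longrightarrow> acts (x i) (d i) N (E i) (U i) (V i)"
    and inj: "inj_on (\<lambda>i. (d i, E i)) I"
    and zero: "(\<Sum>i\<in>I. c i *\<^sub>C x i) = 0" and i: "i \<in> I"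
  shows "c i = 0"
proof -
  have "\<forall>i\<in>I. \<exists>\<zeta>. (\<forall>n. \<zeta> n \<noteq> 0) \<and> (\<forall>y u w n z. cmod u = 1 \<longrightarrow> cmod w = 1 \<longrightarrow> Phi y u w (x i) (Poly_Mapping.single n z) =
        Poly_Mapping.single (n + d i) (\<zeta> n * al y ^ N * complex_of_real y ^ E i * u powi U i * w powi V i * z))"
    using act unfolding acts_def by blast
  from bchoice[OF this] obtain \<zeta> where z: "\<And>i n. i \<in> I \<Longrightarrow> \<zeta> i n \<noteq> 0"
    "\<And>i y u w n z. i \<in> I \<Longrightarrow> cmod u = 1 \<Longrightarrow> cmod w = 1 \<Longrightarrow> Phi y u w (x i) (Poly_Mapping.single n z) =
        Poly_Mapping.single (n + d i) (\<zeta> i n * al y ^ N * complex_of_real y ^ E i * u powi U i * w powi V i * z)"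
    by blast
  have x: "x i \<in> Alg" if "i \<in> I" for i using act[OF that] by (simp add: acts_def)
  define J where "J = {j \<in> I. d j = d i}"
  have J: "finite J" "i \<in> J" "J \<subseteq> I" using fin i by (auto simp: J_def)
  define P where "P = (\<Sum>j\<in>J. monom (c j * \<zeta> j 0) (E j))"
  have "poly P (complex_of_real y) = 0" for y
  proof -
    have "0 = Poly_Mapping.lookup (Phi y 1 1 (\<Sum>i\<in>I. c i *\<^sub>C x i) (Poly_Mapping.single 0 1)) (d i)"
      by (simp add: zero Phi_zero)
    also have "\<dots> = (\<Sum>j\<in>I. if d j = d i then c j * \<zeta> j 0 * al y ^ N * complex_of_real y ^ E j else 0)"
      by (subst Phi_sum) (auto simp: x Phi_scaleC lookup_sum z(2) lookup_single when_def scaleC_complex simp del: single_one intro!: sum.cong)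
    also have "\<dots> = al y ^ N * poly P (complex_of_real y)"
      using fin by (auto simp: P_def poly_sum sum_distrib_left J_def sum.inter_filter poly_monom intro!: sum.cong)
    finally show ?thesis using al_nonzero by simp
  qed
  then have "range complex_of_real \<subseteq> {z. poly P z = 0}" by auto
  moreover have "infinite (range complex_of_real)"
    using infinite_UNIV_char_0 by (metis finite_imageD inj_of_real)
  ultimately have "P = 0" using poly_roots_finite finite_subset by blast
  have "coeff P (E i) = (\<Sum>j\<in>J. if j = i then c j * \<zeta> j 0 else 0)"
    unfolding P_def coeff_sum using inj J
    by (intro sum.cong) (auto simp: J_def inj_on_def)
  then have "c i * \<zeta> i 0 = 0" using \<open>P = 0\<close> J by simp
  then show ?thesis using z(1)[OF i] by simp
qed

text \<open>The entry in row and column 0 depends on the phases through the single factor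
  \<open>u powi U0 * w powi V0\<close>, but for a multiple of 1 it is constant. A nontrivial factor
  then forces the constant to be 0.\<close>

lemma acts_not_scalar:
  assumes act: "\<And>i. i \<in> I \<Longrightarrow> acts (x i) (d i) (N i) (E i) (U i) (V i)"
    and UV: "\<And>i. i \<in> I \<Longrightarrow> d i = 0 \<Longrightarrow> U i = U0 \<and> V i = V0" "(U0, V0) \<noteq> (0, 0)"
    and eq: "(\<Sum>i\<in>I. c i *\<^sub>C x i) = c0 *\<^sub>C 1"
  shows "c0 = 0"
proof -
  have "\<forall>i\<in>I. \<exists>\<zeta>. \<forall>y u w n z. cmod u = 1 \<longrightarrow> cmod w = 1 \<longrightarrow> Phi y u w (x i) (Poly_Mapping.single n z) =
        Poly_Mapping.single (n + d i) (\<zeta> n * al y ^ N i * complex_of_real y ^ E i * u powi U i * w powi V i * z)"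
    using act unfolding acts_def by blast
  from bchoice[OF this] obtain \<zeta> where z:
    "\<And>i y u w n z. i \<in> I \<Longrightarrow> cmod u = 1 \<Longrightarrow> cmod w = 1 \<Longrightarrow> Phi y u w (x i) (Poly_Mapping.single n z) =
        Poly_Mapping.single (n + d i) (\<zeta> i n * al y ^ N i * complex_of_real y ^ E i * u powi U i * w powi V i * z)"
    by blast
  have x: "x i \<in> Alg" if "i \<in> I" for i using act[OF that] by (simp add: acts_def)
  define s where "s = (\<Sum>j\<in>I. if d j = 0 then c j * \<zeta> j 0 * al 1 ^ N j else 0)"
  have main: "s * (u powi U0 * w powi V0) = c0" if "cmod u = 1" "cmod w = 1" for u w
  proof -
    have "c0 = Poly_Mapping.lookup (Phi 1 u w (\<Sum>i\<in>I. c i *\<^sub>C x i) (Poly_Mapping.single 0 1)) 0"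
      unfolding eq using that by (simp add: Phi_scaleC Phi_one scaleC_complex)
    also have "\<dots> = (\<Sum>j\<in>I. if d j = 0 then c j * (\<zeta> j 0 * al 1 ^ N j * u powi U j * w powi V j) else 0)"
      using that by (subst Phi_sum) (auto simp: x Phi_scaleC lookup_sum z lookup_single when_def scaleC_complex simp del: single_one intro!: sum.cong)
    also have "\<dots> = s * (u powi U0 * w powi V0)"
      unfolding s_def sum_distrib_right by (intro sum.cong) (auto dest: UV(1))
    finally show ?thesis by simp
  qed
  \<comment> \<open>\<open>q\<close> has modulus 1 and no nonzero integer power equal to 1, so it
    serves as test value for either phase.\<close>
  have q: "q powi k \<noteq> 1" if "k \<noteq> 0" for k
  proof (cases "k > 0")
    case True
    then show ?thesis using q_not_root[rule_format, of "nat k"] by (simp add: power_int_def)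
  next
    case False
    then show ?thesis using q_not_root[rule_format, of "nat (- k)"] that by (simp add: power_int_def field_simps)
  qed
  have "s = c0" using main[of 1 1] by simp
  moreover have "c0 * q powi U0 = c0" "c0 * q powi V0 = c0"
    using main[of q 1] main[of 1 q] \<open>s = c0\<close> q_unimodular by simp_all
  ultimately show ?thesis using q[of U0] q[of V0] UV(2) by auto
qed

end

section \<open>Letters that commute up to scalars\<close>

text \<open>Reordering letters costs nonzero scalars. Spans do not see them, so the exponents of
  \<open>q\<close> need not be tracked.\<close>

definition sim :: "'a::complex_vector \<Rightarrow> 'a \<Rightarrow> bool" (infix "\<sim>" 50) where
  "x \<sim> y \<longleftrightarrow> (\<exists>c. c \<noteq> 0 \<and> x = c *\<^sub>C y)"

lemma sim_refl [simp]: "x \<sim> x"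
  unfolding sim_def by (rule exI[of _ 1]) simp

lemma sim_sym: assumes "x \<sim> y" shows "y \<sim> x"
proof -
  obtain c where "c \<noteq> 0" "x = c *\<^sub>C y" using assms by (auto simp: sim_def)
  then show ?thesis unfolding sim_def by (intro exI[of _ "inverse c"]) simp
qed

lemma sim_trans [trans]: assumes "x \<sim> y" "y \<sim> z" shows "x \<sim> z"
proof -
  obtain c d where "c \<noteq> 0" "x = c *\<^sub>C y" "d \<noteq> 0" "y = d *\<^sub>C z" using assms by (auto simp: sim_def)
  then show ?thesis unfolding sim_def by (intro exI[of _ "c * d"]) (simp add: scaleC_scaleC)
qed

lemma sim_mult:
  fixes x :: "'a::complex_star_algebra_1"
  assumes "x \<sim> y" "x' \<sim> y'" shows "x * x' \<sim> y * y'"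
proof -
  obtain c d where "c \<noteq> 0" "x = c *\<^sub>C y" "d \<noteq> 0" "x' = d *\<^sub>C y'" using assms by (auto simp: sim_def)
  then show ?thesis unfolding sim_def
    by (intro exI[of _ "c * d"]) (simp add: scaleC_scaleC mult_scaleC_left mult_scaleC_right mult.commute)
qed

lemma sim_adj: "x \<sim> y \<Longrightarrow> adj x \<sim> adj y"
  unfolding sim_def by (auto simp: adj_scaleC intro: exI[of _ "cnj _"])

lemma sim_span: "x \<sim> y \<Longrightarrow> y \<in> cvec.span A \<Longrightarrow> x \<in> cvec.span A"
  unfolding sim_def by (auto intro: cvec.span_scale)

definition qcomm :: "'a::complex_star_algebra_1 \<Rightarrow> 'a \<Rightarrow> bool" where
  "qcomm x y \<longleftrightarrow> x * y \<sim> y * x"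

lemma qcomm_refl [simp]: "qcomm x x"
  by (simp add: qcomm_def)

lemma qcomm_sym: "qcomm x y \<Longrightarrow> qcomm y x"
  unfolding qcomm_def by (rule sim_sym)

lemma qcomm_adj: "qcomm x y \<Longrightarrow> qcomm (adj x) (adj y)"
  unfolding qcomm_def by (drule sim_adj, drule sim_sym) (simp add: adj_mult)

lemma qcomm_mult:
  assumes "qcomm x y" "qcomm x z" shows "qcomm x (y * z)"
proof -
  have "x * y * z \<sim> y * x * z" by (rule sim_mult[OF assms(1)[unfolded qcomm_def] sim_refl])
  also have "y * x * z = y * (x * z)" by (rule mult.assoc)
  also have "\<dots> \<sim> y * (z * x)" by (rule sim_mult[OF sim_refl assms(2)[unfolded qcomm_def]])
  finally show ?thesis by (simp add: qcomm_def mult.assoc)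
qed

lemma qcomm_one [simp]: "qcomm x 1"
  by (simp add: qcomm_def)

text \<open>Multiply the relation between \<open>x * y\<close> and \<open>y * x\<close> by
  \<open>y'\<close> on both sides.\<close>

lemma qcomm_inverse:
  assumes "qcomm x y" "y * y' = 1" "y' * y = 1" shows "qcomm x y'"
proof -
  have "y' * (x * y) * y' \<sim> y' * (y * x) * y'"
    by (rule sim_mult[OF sim_mult[OF sim_refl assms(1)[unfolded qcomm_def]] sim_refl])
  moreover have "y' * (x * y) * y' = y' * x * (y * y')" "y' * (y * x) * y' = (y' * y) * x * y'"
    by (simp_all only: mult.assoc)
  ultimately show ?thesis by (simp add: qcomm_def assms sim_sym)
qed

lemma qcomm_prod_list: "(\<And>y. y \<in> set ys \<Longrightarrow> qcomm x y) \<Longrightarrow> qcomm x (prod_list ys)"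
  by (induction ys) (simp_all add: qcomm_mult)

text \<open>The head of the first list occurs somewhere in the second; it is commuted past the
  prefix that precedes it there.\<close>

lemma sim_prod_list_perm:
  assumes "mset xs = mset ys" "\<And>x y. x \<in> set xs \<Longrightarrow> y \<in> set xs \<Longrightarrow> qcomm x y"
  shows "prod_list xs \<sim> prod_list ys"
  using assms
proof (induction xs arbitrary: ys)
  case (Cons x xs)
  have "x \<in> set ys" using Cons.prems(1) by (metis list.set_intros(1) set_mset_mset)
  then obtain us vs where ys: "ys = us @ x # vs" by (meson split_list)
  have set: "set ys = set (x # xs)" using Cons.prems(1) by (metis set_mset_mset)
  have "prod_list xs \<sim> prod_list (us @ vs)"
    using Cons.prems by (intro Cons.IH) (auto simp: ys)
  then have "prod_list (x # xs) \<sim> x * prod_list us * prod_list vs"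
    by (simp add: sim_mult mult.assoc)
  also have "\<dots> \<sim> prod_list us * x * prod_list vs"
  proof (rule sim_mult[OF _ sim_refl])
    show "x * prod_list us \<sim> prod_list us * x"
      using qcomm_prod_list[of us x] Cons.prems(2) set by (auto simp: qcomm_def ys)
  qed
  finally show ?case by (simp add: ys mult.assoc)
qed simp

section \<open>Independent families and tensors\<close>

text \<open>Independence of an indexed family, so that coefficients can be compared index by index;
  injectivity is a consequence.\<close>

definition indep_family :: "('i \<Rightarrow> 'a::complex_vector) \<Rightarrow> 'i set \<Rightarrow> bool" where
  "indep_family x I \<longleftrightarrow> finite I \<and> (\<forall>c. (\<Sum>i\<in>I. c i *\<^sub>C x i) = 0 \<longrightarrow> (\<forall>i\<in>I. c i = 0))"

lemma indep_family_zero: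
  "indep_family x I \<Longrightarrow> (\<Sum>i\<in>I. c i *\<^sub>C x i) = 0 \<Longrightarrow> i \<in> I \<Longrightarrow> c i = 0"
  by (simp add: indep_family_def)

lemma indep_family_coeff_eq:
  assumes "indep_family x I" "(\<Sum>i\<in>I. c i *\<^sub>C x i) = (\<Sum>i\<in>I. d i *\<^sub>C x i)" "i \<in> I"
  shows "c i = d i"
proof -
  have "(\<Sum>i\<in>I. (c i - d i) *\<^sub>C x i) = 0"
    using assms(2) by (simp add: cvec.scale_left_diff_distrib sum_subtractf)
  from indep_family_zero[OF assms(1) this assms(3)] show ?thesis by simp
qed

lemma indep_family_inj:
  assumes "indep_family x I" shows "inj_on x I"
proof (rule inj_onI)
  fix i j assume ij: "i \<in> I" "j \<in> I" "x i = x j"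
  have fin: "finite I" using assms by (simp add: indep_family_def)
  have s: "(\<Sum>k\<in>I. (if k = l then 1 else 0) *\<^sub>C x k) = x l" if "l \<in> I" for l
    using that fin by (simp add: if_distrib[of "\<lambda>c. c *\<^sub>C _"] cong: if_cong)
  have "(if i = i then 1 else 0) = (if i = j then 1 else (0 :: complex))"
    by (rule indep_family_coeff_eq[OF assms]) (simp_all only: s ij)
  then show "i = j" by (simp split: if_splits)
qed

lemma indep_family_independent:
  assumes "indep_family x I" shows "cvec.independent (x ` I)"
proof (rule cvec.independent_if_scalars_zero)
  show "finite (x ` I)" using assms by (simp add: indep_family_def)
  fix f v assume f: "(\<Sum>v\<in>x ` I. f v *\<^sub>C v) = 0" and "v \<in> x ` I"
  then obtain i where i: "i \<in> I" "v = x i" by blast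
  have "(\<Sum>i\<in>I. f (x i) *\<^sub>C x i) = 0"
    using f indep_family_inj[OF assms] by (simp add: sum.reindex)
  from indep_family_zero[OF assms this i(1)] show "f v = 0" by (simp add: i)
qed

lemma indep_family_functional:
  assumes "indep_family x I" "i \<in> I"
  obtains \<phi> :: "'a::complex_vector \<Rightarrow> complex"
  where "clinear \<phi>" "\<And>j. j \<in> I \<Longrightarrow> \<phi> (x j) = (if j = i then 1 else 0)"
proof -
  interpret p: vector_space_pair "scaleC :: complex \<Rightarrow> 'a \<Rightarrow> 'a" "scaleC :: complex \<Rightarrow> complex \<Rightarrow> complex"
    by unfold_locales
  obtain \<phi> where "clinear \<phi>" "\<forall>v\<in>x ` I. \<phi> v = (if v = x i then 1 else (0 :: complex))"
    using p.linear_independent_extend[OF indep_family_independent[OF assms(1)],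
        of "\<lambda>v. if v = x i then 1 else 0"] by blast
  then show ?thesis
    using that[of \<phi>] indep_family_inj[OF assms(1)] assms(2) by (auto simp: inj_on_def)
qed

lemma slice_zero [simp]: "slice_left \<phi> 0 = 0" "slice_right \<phi> 0 = 0"
  using slice_left_add[of \<phi> 0 0] slice_right_add[of \<phi> 0 0] by simp_all

lemma slice_left_sum: "slice_left \<phi> (\<Sum>i\<in>I. u i) = (\<Sum>i\<in>I. slice_left \<phi> (u i))"
  by (induction I rule: infinite_finite_induct) (simp_all add: slice_left_add)

lemma slice_right_sum: "slice_right \<phi> (\<Sum>i\<in>I. u i) = (\<Sum>i\<in>I. slice_right \<phi> (u i))"
  by (induction I rule: infinite_finite_induct) (simp_all add: slice_right_add)

text \<open>Slicing the left leg with the coordinate functional of \<open>x i\<close> extracts the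
  right leg at \<open>i\<close>.\<close>

lemma indep_family_tensor:
  fixes x :: "'i \<Rightarrow> 'a::complex_vector"
  assumes x: "indep_family x I" and eq: "(\<Sum>i\<in>I. x i \<boxtimes> y i) = (\<Sum>i\<in>I. x i \<boxtimes> z i)" and i: "i \<in> I"
  shows "y i = z i"
proof -
  obtain \<phi> :: "'a \<Rightarrow> complex" where \<phi>: "clinear \<phi>" "\<And>j. j \<in> I \<Longrightarrow> \<phi> (x j) = (if j = i then 1 else 0)"
    using indep_family_functional[OF x i] by blast
  have fin: "finite I" using x by (simp add: indep_family_def)
  have "slice_left \<phi> (\<Sum>i\<in>I. x i \<boxtimes> w i) = w i" for w
  proof -
    have "slice_left \<phi> (\<Sum>i\<in>I. x i \<boxtimes> w i) = (\<Sum>j\<in>I. if j = i then w j else 0)"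
      unfolding slice_left_sum using \<phi>(2) by (intro sum.cong) (auto simp: slice_left_pure[OF \<phi>(1)])
    then show ?thesis using fin i by simp
  qed
  then show ?thesis using eq by metis
qed

lemma tensor_pure_zero [simp]: "x \<boxtimes> 0 = 0" "0 \<boxtimes> y = 0"
  using tensor_pure_bilinear(4)[of x 0 0] tensor_pure_bilinear(3)[of 0 0 y] by simp_all

lemma tensor_pure_sum_left: "(\<Sum>i\<in>I. x i) \<boxtimes> y = (\<Sum>i\<in>I. x i \<boxtimes> y)"
  by (induction I rule: infinite_finite_induct) (simp_all add: tensor_pure_bilinear)

lemma tensor_pure_sum_right: "x \<boxtimes> (\<Sum>i\<in>I. y i) = (\<Sum>i\<in>I. x \<boxtimes> y i)"
  by (induction I rule: infinite_finite_induct) (simp_all add: tensor_pure_bilinear)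

text \<open>Pascal's rule, inside a noncommutative ring. It will be applied to
  \<open>b * adj b\<close> and \<open>a * adj a\<close>.\<close>

lemma binomial_commuting:
  fixes x y :: "'a::ring_1"
  assumes "x * y = y * x"
  shows "(x + y) ^ n = (\<Sum>k\<le>n. of_nat (n choose k) * (y ^ (n - k) * x ^ k))"
proof (induction n)
  case (Suc n)
  have xy: "x * y ^ m = y ^ m * x" for m using assms by (metis power_commuting_commutes)
  have nat: "z * (of_nat m * w) = of_nat m * (z * w)" for z w :: 'a and m
    by (metis mult.assoc mult_of_nat_commute)
  have "x * (y ^ k * x ^ l) = y ^ k * x ^ Suc l" for k l
    by (metis mult.assoc power_Suc xy)
  then have X: "x * (of_nat m * (y ^ k * x ^ l)) = of_nat m * (y ^ k * x ^ Suc l)" for m k l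
    by (simp only: nat)
  have "y * (\<Sum>k\<le>n. of_nat (n choose k) * (y ^ (n - k) * x ^ k)) =
      (\<Sum>k\<le>n. of_nat (n choose k) * (y ^ (Suc n - k) * x ^ k))"
    unfolding sum_distrib_left
    by (intro sum.cong refl) (simp only: nat atMost_iff Suc_diff_le power_Suc mult.assoc)
  also have "\<dots> = (\<Sum>k\<le>Suc n. of_nat (n choose k) * (y ^ (Suc n - k) * x ^ k))"
    by (simp add: binomial_eq_0)
  also have "\<dots> = y ^ Suc n + (\<Sum>k\<le>n. of_nat (n choose Suc k) * (y ^ (n - k) * x ^ Suc k))"
    by (simp only: sum.atMost_Suc_shift) simp
  finally have yS: "y * (\<Sum>k\<le>n. of_nat (n choose k) * (y ^ (n - k) * x ^ k)) =
      y ^ Suc n + (\<Sum>k\<le>n. of_nat (n choose Suc k) * (y ^ (n - k) * x ^ Suc k))" .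
  have xS: "x * (\<Sum>k\<le>n. of_nat (n choose k) * (y ^ (n - k) * x ^ k)) =
      (\<Sum>k\<le>n. of_nat (n choose k) * (y ^ (n - k) * x ^ Suc k))"
    by (simp only: sum_distrib_left X)
  have "(x + y) ^ Suc n = (\<Sum>k\<le>n. of_nat (n choose k) * (y ^ (n - k) * x ^ Suc k)) +
      (y ^ Suc n + (\<Sum>k\<le>n. of_nat (n choose Suc k) * (y ^ (n - k) * x ^ Suc k)))"
    by (simp only: power_Suc Suc.IH distrib_right xS yS[unfolded power_Suc])
  also have "\<dots> = (\<Sum>k\<le>Suc n. of_nat (Suc n choose k) * (y ^ (Suc n - k) * x ^ k))"
    by (simp only: sum.atMost_Suc_shift) (simp add: sum.distrib algebra_simps)
  finally show ?case .
qed simp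

lemma power_mult_commuting: "x * y = y * x \<Longrightarrow> x ^ n * y ^ n = (x * y) ^ n" for x :: "'a::monoid_mult"
proof (induction n)
  case (Suc n)
  have "x ^ Suc n * y ^ Suc n = x * (x ^ n * y) * y ^ n" by (simp add: mult.assoc)
  also have "x ^ n * y = y * x ^ n" using Suc.prems by (metis power_commuting_commutes)
  also have "x * (y * x ^ n) * y ^ n = x * y * (x ^ n * y ^ n)" by (simp only: mult.assoc)
  finally show ?case by (simp only: Suc.IH[OF Suc.prems] power_Suc)
qed simp

section \<open>Consequences of the relations at \<open>|q| = 1\<close>\<close>

context Uq2 begin

lemma Uq2_relations:
  "b * a = q *\<^sub>C (a * b)" "adj a * b = q *\<^sub>C (b * adj a)" "b * adj b = adj b * b"
  "a * adj a + b * adj b = 1" "a * D = D * a" "b * D = q\<^sup>2 *\<^sub>C (D * b)"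
  "D * adj D = 1" "adj D * D = 1" "adj a * a + adj b * b = 1"
proof -
  note ev = feval_diff feval_add feval_scale feval_one
        feval_fadj feval_gen feval_mult feval_fconst mult_scaleC_left q_unimodular
  have rel: "\<forall>r\<in>uq2_relators q. feval a b D r = 0"
    using universal by (simp add: universal_Uq2_def)
  have "feval a b D (fgen GenA * fadj (fgen GenA) + fgen GenB * fadj (fgen GenB) - 1) = 0"
    by (rule bspec[OF rel]) (simp add: uq2_relators_def Let_def)
  then show "a * adj a + b * adj b = 1" by (simp add: ev)
  from rel have "b * a = q *\<^sub>C (a * b) \<and> adj a * b = q *\<^sub>C (b * adj a) \<and> b * adj b = adj b * b \<and> a * D = D * a \<and> b * D = q\<^sup>2 *\<^sub>C (D * b) \<and>
    D * adj D = 1 \<and> adj D * D = 1 \<and> adj a * a + adj b * b = 1"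
    by (simp add: uq2_relators_def Let_def ev)
  then show "b * a = q *\<^sub>C (a * b)" "adj a * b = q *\<^sub>C (b * adj a)" "b * adj b = adj b * b"
    "a * D = D * a" "b * D = q\<^sup>2 *\<^sub>C (D * b)"
    "D * adj D = 1" "adj D * D = 1" "adj a * a + adj b * b = 1"
    by blast+
qed

lemma q_nonzero [simp]: "q \<noteq> 0"
  using q_unimodular by auto

text \<open>At \<open>|q| = 1\<close> the two sphere relations differ only in
  \<open>b * adj b\<close> against \<open>adj b * b\<close>, and \<open>b\<close> is normal.\<close>

lemma normal_a: "a * adj a = adj a * a"
  using Uq2_relations(3,4,9) by (metis add_right_cancel)

lemma sim_scaled: "x = c *\<^sub>C y \<Longrightarrow> c \<noteq> 0 \<Longrightarrow> x \<sim> y"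
  by (auto simp: sim_def)

text \<open>The pairs missing from the presentation follow by taking adjoints, by normality of
  \<open>a\<close>, and by inverting the unitary \<open>D\<close>.\<close>

lemma qcomm_gen:
  assumes "x \<in> {a, b, adj a, adj b, D, adj D}" "y \<in> {a, b, adj a, adj b, D, adj D}"
  shows "qcomm x y"
proof -
  have 1: "qcomm a b" "qcomm (adj a) b" "qcomm b (adj b)" "qcomm a (adj a)" "qcomm a D" "qcomm b D" "qcomm D (adj D)"
    using sim_scaled[OF Uq2_relations(1)] sim_scaled[OF Uq2_relations(2)] sim_scaled[OF Uq2_relations(6)]
    by (auto simp: qcomm_def Uq2_relations(3,5,7,8) normal_a intro: sim_sym)
  have 2: "qcomm a (adj D)" "qcomm b (adj D)"
    using qcomm_inverse[OF 1(5) Uq2_relations(7,8)] qcomm_inverse[OF 1(6) Uq2_relations(7,8)] by auto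
  have 3: "qcomm (adj a) (adj b)" "qcomm a (adj b)" "qcomm (adj a) D" "qcomm (adj b) D"
     "qcomm (adj a) (adj D)" "qcomm (adj b) (adj D)"
    using qcomm_adj[OF 1(1)] qcomm_adj[OF 1(2)] qcomm_adj[OF 2(1)] qcomm_adj[OF 2(2)]
      qcomm_adj[OF 1(5)] qcomm_adj[OF 1(6)] by (simp_all add: adj_adj)
  show ?thesis using assms 1 2 3 by (auto intro: qcomm_sym)
qed

text \<open>The unnormalised basis: its products with \<open>a\<close> and \<open>b\<close> involve
  powers of \<open>q\<close> but no square roots.\<close>

definition G :: "nat \<Rightarrow> nat \<Rightarrow> 'a" where "G n i = a ^ (n - i) * b ^ i"

definition rt :: "nat \<Rightarrow> nat \<Rightarrow> complex" where "rt n i = complex_of_real (sqrt (real (n choose i)))"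

abbreviation fv :: "nat \<Rightarrow> nat \<Rightarrow> 'a" where "fv \<equiv> fvec a b"

lemma fv_def: "fv n i = rt n i *\<^sub>C G n i"
  by (simp add: fvec_def rt_def G_def)

lemma rt_nonzero [simp]: "i \<le> n \<Longrightarrow> rt n i \<noteq> 0"
  by (simp add: rt_def)

lemma cnj_rt [simp]: "cnj (rt n i) = rt n i"
  by (simp add: rt_def)

lemma rt_square: "rt n i * rt n i = of_nat (n choose i)"
  by (simp add: rt_def flip: of_real_mult)

lemma G_in_Alg [simp]: "G n i \<in> Alg"
  by (simp add: G_def)

lemma fv_in_Alg [simp]: "fv n i \<in> Alg"
  by (simp add: fv_def)

lemma upow_in_Alg [simp]: "upow D k \<in> Alg"
  by (simp add: upow_def)

lemma acts_scaleC:
  assumes "acts x d N E U V" "c \<noteq> 0" shows "acts (c *\<^sub>C x) d N E U V"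
proof -
  have x: "x \<in> Alg" using assms by (simp add: acts_def)
  obtain \<zeta> where z: "\<forall>n. \<zeta> n \<noteq> 0" "\<And>y u w n z. cmod u = 1 \<Longrightarrow> cmod w = 1 \<Longrightarrow> Phi y u w x (Poly_Mapping.single n z) =
        Poly_Mapping.single (n + d) (\<zeta> n * al y ^ N * complex_of_real y ^ E * u powi U * w powi V * z)"
    using assms(1) unfolding acts_def by blast
  have sc: "c *\<^sub>C Poly_Mapping.single n v = Poly_Mapping.single n (c * v)" for n :: int and v
    by (rule poly_mapping_eqI) (simp add: lookup_single when_def scaleC_complex)
  show ?thesis unfolding acts_def
    using x z(1) assms(2)
    by (intro conjI exI[of _ "\<lambda>n. c * \<zeta> n"]) (simp_all add: Phi_scaleC z(2) sc mult.assoc)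
qed

lemma acts_fv:
  assumes "i \<le> n"
  shows "acts (fv n i) (int i) n i (int n - int i) 0" "acts (adj (fv n i)) (- int i) n i (int i - int n) 0"
proof -
  have "acts (G n i) (int i) n i (int n - int i) 0"
    using acts_mult[OF acts_power[OF acts_gen(1), of "n - i"] acts_power[OF acts_gen(2), of i]] assms
    by (simp add: G_def of_nat_diff)
  then show "acts (fv n i) (int i) n i (int n - int i) 0"
    using assms by (simp add: fv_def acts_scaleC)
  have "acts (adj (G n i)) (- int i) n i (int i - int n) 0"
    using acts_mult[OF acts_power[OF acts_gen(5), of i] acts_power[OF acts_gen(4), of "n - i"]] assms
    by (simp add: G_def adj_mult adj_power of_nat_diff)
  then show "acts (adj (fv n i)) (- int i) n i (int i - int n) 0"
    using assms by (simp add: fv_def adj_scaleC acts_scaleC)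
qed

lemma adj_upow: "adj (upow D k) = upow D (- k)"
  by (auto simp: upow_def adj_power adj_adj)

lemma indep_family_acts:
  assumes "finite I" "\<And>i. i \<in> I \<Longrightarrow> acts (x i) (d i) N (E i) (U i) (V i)" "inj_on (\<lambda>i. (d i, E i)) I"
  shows "indep_family x I"
  unfolding indep_family_def using acts_independent[OF assms] assms(1) by blast

lemma indep_G: "indep_family (G n) {..n}"
proof -
  have "acts (G n i) (int i) n i (int n - int i) 0" if "i \<le> n" for i
    using acts_scaleC[OF acts_fv(1)[OF that], of "inverse (rt n i)"] that by (simp add: fv_def)
  then show ?thesis
    by (intro indep_family_acts[where d = "\<lambda>i. int i" and E = "\<lambda>i. i"]) (auto intro: inj_onI)
qed

text \<open>The product has shift \<open>i - k\<close> and \<open>y\<close>-degree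
  \<open>i + k\<close>, and these two numbers recover \<open>i\<close> and \<open>k\<close>.\<close>

lemma indep_fv_adj_fv: "indep_family (\<lambda>(i, k). fv n i * adj (fv n k)) ({..n} \<times> {..n})"
proof (rule indep_family_acts)
  fix p assume "p \<in> {..n} \<times> {..n}"
  then show "acts ((\<lambda>(i, k). fv n i * adj (fv n k)) p) (int (fst p) - int (snd p)) (n + n) (fst p + snd p)
      (int (snd p) - int (fst p)) 0"
    using acts_mult[OF acts_fv(1) acts_fv(2), of "fst p" n "snd p" n] by (auto split: prod.splits)
next
  show "inj_on (\<lambda>p. (int (fst p) - int (snd p), fst p + snd p)) ({..n} \<times> {..n})"
    by (auto intro!: inj_onI)
qed auto

text \<open>When the shift vanishes, \<open>p = i\<close> and the degree in \<open>u\<close> is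
  \<open>m - n\<close> for every \<open>i\<close>. This uniformity is what
  \<open>acts_not_scalar\<close> demands.\<close>

lemma acts_adj_fv_fv:
  assumes "i \<le> n" "p \<le> m"
  shows "acts (adj (fv n i * upow D k) * (fv m p * upow D l)) (int p - int i) (n + m) (i + p)
    (int i - int n + (int m - int p)) (l - k)"
  using acts_mult[OF acts_mult[OF acts_upow acts_fv(2)[OF assms(1)]] acts_mult[OF acts_fv(1)[OF assms(2)] acts_upow], of "- k" l]
  by (simp add: adj_mult adj_upow add.commute)

lemma indep_adj_fv_fv:
  "indep_family (\<lambda>(i, p). adj (fv n i * upow D k) * (fv m p * upow D l)) ({..n} \<times> {..m})"
proof (rule indep_family_acts)
  fix z assume "z \<in> {..n} \<times> {..m}"
  then show "acts ((\<lambda>(i, p). adj (fv n i * upow D k) * (fv m p * upow D l)) z) (int (snd z) - int (fst z)) (n + m) (fst z + snd z)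
    (int (fst z) - int n + (int m - int (snd z))) (l - k)"
    using acts_adj_fv_fv by (auto split: prod.splits)
next
  show "inj_on (\<lambda>z. (int (snd z) - int (fst z), fst z + snd z)) ({..n} \<times> {..m})"
    by (auto intro!: inj_onI)
qed auto

text \<open>With \<open>X = b * adj b\<close> and \<open>Y = a * adj a\<close>, each summand is a
  term of the binomial expansion of \<open>(X + Y) ^ n = 1\<close>. Normality of \<open>a\<close>
  and \<open>b\<close> gives the same term for both orders of the factors.\<close>

lemma sum_fv:
  "(\<Sum>j\<le>n. fv n j * adj (fv n j)) = 1" "(\<Sum>j\<le>n. adj (fv n j) * fv n j) = 1"
proof -
  define X Y where "X = b * adj b" and "Y = a * adj a"
  have one: "X + Y = 1" using Uq2_relations(4) by (simp add: X_def Y_def add.commute)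
  have X': "X = 1 - Y" and Y': "Y = 1 - X" using one by (simp_all add: eq_diff_eq add.commute)
  have comm: "X * Y = Y * X" unfolding X' by (simp add: left_diff_distrib right_diff_distrib)
  have "Y * a = a * Y" by (metis Y_def mult.assoc normal_a)
  then have Xa: "X * a = a * X" unfolding X' by (simp add: left_diff_distrib right_diff_distrib)
  have "X * b = b * X" by (metis X_def mult.assoc Uq2_relations(3))
  then have Yb: "Y * b = b * Y" unfolding Y' by (simp add: left_diff_distrib right_diff_distrib)
  have bin: "(\<Sum>j\<le>n. of_nat (n choose j) *\<^sub>C (Y ^ (n - j) * X ^ j)) = 1"
  proof -
    have "of_nat m * z = of_nat m *\<^sub>C z" for m and z :: 'a
      by (induction m) (simp_all add: algebra_simps scaleC_add_left)
    then show ?thesis using binomial_commuting[OF comm, of n] one by simp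
  qed
  have 1: "fv n j * adj (fv n j) = of_nat (n choose j) *\<^sub>C (Y ^ (n - j) * X ^ j)" for j
  proof -
    have "G n j * adj (G n j) = a ^ (n - j) * (b ^ j * adj b ^ j) * adj a ^ (n - j)"
      by (simp add: G_def adj_mult adj_power mult.assoc)
    also have "b ^ j * adj b ^ j = X ^ j" by (simp add: power_mult_commuting Uq2_relations(3) X_def)
    also have "a ^ (n - j) * X ^ j = X ^ j * a ^ (n - j)"
      by (metis Xa power_commuting_commutes)
    also have "X ^ j * a ^ (n - j) * adj a ^ (n - j) = X ^ j * Y ^ (n - j)"
      by (simp add: mult.assoc power_mult_commuting normal_a Y_def)
    also have "\<dots> = Y ^ (n - j) * X ^ j" by (metis comm power_commuting_commutes)
    finally show ?thesis
      by (simp add: fv_def adj_scaleC mult_scaleC_left mult_scaleC_right scaleC_scaleC rt_square)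
  qed
  have 2: "adj (fv n j) * fv n j = of_nat (n choose j) *\<^sub>C (Y ^ (n - j) * X ^ j)" for j
  proof -
    have "adj (G n j) * G n j = adj b ^ j * (adj a ^ (n - j) * a ^ (n - j)) * b ^ j"
      by (simp add: G_def adj_mult adj_power mult.assoc)
    also have "adj a ^ (n - j) * a ^ (n - j) = Y ^ (n - j)" by (simp add: power_mult_commuting normal_a Y_def)
    also have "adj b ^ j * Y ^ (n - j) * b ^ j = adj b ^ j * (Y ^ (n - j) * b ^ j)" by (simp add: mult.assoc)
    also have "Y ^ (n - j) * b ^ j = b ^ j * Y ^ (n - j)"
      by (metis Yb power_commuting_commutes)
    also have "adj b ^ j * (b ^ j * Y ^ (n - j)) = X ^ j * Y ^ (n - j)"
      by (simp add: power_mult_commuting Uq2_relations(3) X_def flip: mult.assoc)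
    also have "\<dots> = Y ^ (n - j) * X ^ j" by (metis comm power_commuting_commutes)
    finally show ?thesis
      by (simp add: fv_def adj_scaleC mult_scaleC_left mult_scaleC_right scaleC_scaleC rt_square)
  qed
  show "(\<Sum>j\<le>n. fv n j * adj (fv n j)) = 1" "(\<Sum>j\<le>n. adj (fv n j) * fv n j) = 1"
    by (simp_all add: 1 2 bin)
qed

end

section \<open>Matrix coefficients\<close>

locale Uq2_haar = Uq2 +
  fixes \<Delta> :: "'a \<Rightarrow> ('a, 'a) tensor" and S :: "'a \<Rightarrow> 'a" and h :: "'a \<Rightarrow> complex"
    and t :: "nat \<Rightarrow> nat \<Rightarrow> nat \<Rightarrow> 'a"
  assumes comult: "comultiplication q a b D \<Delta>"
    and antip: "antipode q a b D S"
    and haar: "haar_state a b D \<Delta> h"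
    and coeffs: "matrix_coefficients a b D \<Delta> t"
begin

lemma Delta_hom:
  "x \<in> Alg \<Longrightarrow> y \<in> Alg \<Longrightarrow> \<Delta> (x + y) = \<Delta> x + \<Delta> y"
  "x \<in> Alg \<Longrightarrow> y \<in> Alg \<Longrightarrow> \<Delta> (x * y) = \<Delta> x * \<Delta> y"
  "x \<in> Alg \<Longrightarrow> \<Delta> (c *\<^sub>C x) = c *\<^sub>C \<Delta> x"
  "x \<in> Alg \<Longrightarrow> \<Delta> (adj x) = adj (\<Delta> x)"
  "\<Delta> 1 = 1"
  "\<Delta> a = a \<boxtimes> a - cnj q *\<^sub>C (b \<boxtimes> (D * adj b))"
  "\<Delta> b = a \<boxtimes> b + b \<boxtimes> (D * adj a)"
  "\<Delta> D = D \<boxtimes> D"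
  using comult by (simp_all add: comultiplication_def)

lemma Delta_zero: "\<Delta> 0 = 0"
  using Delta_hom(3)[of 0 0] by simp

lemma Delta_sum: "(\<And>i. i \<in> I \<Longrightarrow> f i \<in> Alg) \<Longrightarrow> \<Delta> (\<Sum>i\<in>I. f i) = (\<Sum>i\<in>I. \<Delta> (f i))"
  by (induction I rule: infinite_finite_induct) (simp_all add: Delta_hom(1) Delta_zero)

lemma S_hom:
  "x \<in> Alg \<Longrightarrow> y \<in> Alg \<Longrightarrow> S (x + y) = S x + S y"
  "x \<in> Alg \<Longrightarrow> y \<in> Alg \<Longrightarrow> S (x * y) = S y * S x"
  "x \<in> Alg \<Longrightarrow> S (c *\<^sub>C x) = c *\<^sub>C S x"
  "S 1 = 1" "S a = adj a" "S b = (- q) *\<^sub>C (b * adj D)" "S D = adj D"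
  "S (adj a) = a" "S (adj b) = (- inverse (cnj q)) *\<^sub>C (adj b * D)"
  using antip by (simp_all add: antipode_def)

text \<open>This value is not among those prescribed for the antipode. It is forced, since
  \<open>S\<close> reverses products and \<open>D\<close> is unitary.\<close>

lemma S_adj_D: "S (adj D) = D"
proof -
  have "S (adj D) * adj D = 1"
    using S_hom(2)[of D "adj D"] by (simp add: S_hom Uq2_relations)
  then have "S (adj D) * (adj D * D) = D" by (simp flip: mult.assoc)
  then show ?thesis by (simp add: Uq2_relations)
qed

lemma S_power: "x \<in> Alg \<Longrightarrow> S (x ^ n) = S x ^ n"
  by (induction n) (simp_all add: S_hom power_commutes)

lemma S_upow: "S (upow D k) = adj (upow D k)"
  by (simp add: upow_def S_power S_hom S_adj_D adj_power adj_adj)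

lemma t_in_Alg [simp]: "i \<le> n \<Longrightarrow> j \<le> n \<Longrightarrow> t n i j \<in> Alg"
  using coeffs by (simp add: matrix_coefficients_def)

lemma Delta_fv: "j \<le> n \<Longrightarrow> \<Delta> (fv n j) = (\<Sum>i\<le>n. fv n i \<boxtimes> t n i j)"
  using coeffs by (simp add: matrix_coefficients_def)

text \<open>The matrix coefficients in the basis \<open>G\<close>, that is, \<open>t n\<close>
  conjugated by the diagonal matrix of the \<open>rt n i\<close>.\<close>

definition tau :: "nat \<Rightarrow> nat \<Rightarrow> nat \<Rightarrow> 'a" where
  "tau n i j = (rt n i / rt n j) *\<^sub>C t n i j"

lemma tau_in_Alg [simp]: "i \<le> n \<Longrightarrow> j \<le> n \<Longrightarrow> tau n i j \<in> Alg"
  by (simp add: tau_def)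

lemma tensor_scale_move: "(c *\<^sub>C x) \<boxtimes> y = x \<boxtimes> (c *\<^sub>C y)"
  by (simp add: tensor_pure_bilinear)

lemma Delta_G:
  assumes "j \<le> n" shows "\<Delta> (G n j) = (\<Sum>i\<le>n. G n i \<boxtimes> tau n i j)"
proof -
  have "G n j = inverse (rt n j) *\<^sub>C fv n j" using assms by (simp add: fv_def)
  then have "\<Delta> (G n j) = inverse (rt n j) *\<^sub>C (\<Sum>i\<le>n. (rt n i *\<^sub>C G n i) \<boxtimes> t n i j)"
    using assms by (simp add: Delta_hom Delta_fv) (simp add: fv_def)
  also have "\<dots> = (\<Sum>i\<le>n. G n i \<boxtimes> tau n i j)"
    by (simp add: cvec.scale_sum_right tau_def tensor_pure_bilinear divide_inverse mult.commute)
  finally show ?thesis .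
qed

section \<open>The fundamental corepresentation and a recursion for the matrix coefficients\<close>

definition gen :: "nat \<Rightarrow> 'a" where "gen e = (if e = 0 then a else b)"

text \<open>The matrix of the two-dimensional corepresentation on the span of \<open>a\<close> and
  \<open>b\<close>, with \<open>c\<close> the row and \<open>e\<close> the column.\<close>

definition ent :: "nat \<Rightarrow> nat \<Rightarrow> 'a" where
  "ent c e = (if c = 0 then gen e else if e = 0 then (- cnj q) *\<^sub>C (D * adj b) else D * adj a)"

lemma gen_in_Alg [simp]: "gen e \<in> Alg"
  by (simp add: gen_def)

lemma ent_in_Alg [simp]: "ent c e \<in> Alg"
  by (simp add: ent_def del: cvec.scale_minus_left)

lemma Delta_gen: "\<Delta> (gen e) = a \<boxtimes> ent 0 e + b \<boxtimes> ent 1 e"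
  by (simp add: gen_def ent_def Delta_hom tensor_pure_bilinear del: cvec.scale_minus_left) simp

lemma G_mult_b: "G n j * b = G (Suc n) (Suc j)"
  by (simp add: G_def mult.assoc power_commutes)

lemma G_mult_a:
  assumes "j \<le> n" shows "G n j * a = q ^ j *\<^sub>C G (Suc n) j"
proof -
  have "b ^ j * a = q ^ j *\<^sub>C (a * b ^ j)"
  proof (induction j)
    case (Suc j)
    have "b ^ Suc j * a = b ^ j * (b * a)" by (simp only: power_Suc2 mult.assoc)
    also have "\<dots> = q *\<^sub>C (b ^ j * a * b)" by (simp add: Uq2_relations(1) mult_scaleC_right mult.assoc)
    also have "\<dots> = q ^ Suc j *\<^sub>C (a * (b ^ j * b))" by (simp add: Suc.IH mult_scaleC_left scaleC_scaleC mult.assoc)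
    finally show ?case by (simp add: power_commutes)
  qed simp
  moreover have "a ^ (n - j) * (a * z) = a ^ (Suc n - j) * z" for z
    using assms by (simp add: Suc_diff_le power_commutes flip: mult.assoc)
  ultimately show ?thesis by (simp add: G_def mult.assoc mult_scaleC_right)
qed

definition mu :: "nat \<Rightarrow> nat \<Rightarrow> complex" where "mu j e = (if e = 0 then q ^ j else 1)"

lemma mu_nonzero [simp]: "mu j e \<noteq> 0"
  by (simp add: mu_def)

lemma G_mult_gen:
  assumes "j \<le> n" "e \<le> 1" shows "G n j * gen e = mu j e *\<^sub>C G (Suc n) (j + e)"
proof -
  have "e = 0 \<or> e = 1" using assms(2) by auto
  then show ?thesis using assms(1) by (auto simp: gen_def mu_def G_mult_a G_mult_b)
qed

text \<open>Apply \<open>\<Delta>\<close> to \<open>G n j * gen e\<close>, a multiple of a basis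
  vector of the next degree, and compare the right legs at \<open>G (Suc n) k\<close>. That vector
  arises from \<open>G n k * a\<close>, with a factor \<open>q ^ k\<close>, and from
  \<open>G n (k - 1) * b\<close>. An interior column \<open>j + e\<close> splits in two ways, and
  both splittings are used later.\<close>

lemma tau_rec:
  assumes "j \<le> n" "e \<le> 1" "k \<le> Suc n"
  shows "mu j e *\<^sub>C tau (Suc n) k (j + e) =
    (if k \<le> n then q ^ k *\<^sub>C (tau n k j * ent 0 e) else 0) +
    (if 1 \<le> k then tau n (k - 1) j * ent 1 e else 0)"
proof -
  let ?A = "\<lambda>k. if k \<le> n then q ^ k *\<^sub>C (tau n k j * ent 0 e) else 0"
  let ?B = "\<lambda>k. if 1 \<le> k then tau n (k - 1) j * ent 1 e else 0"
  have "(\<Sum>k\<le>Suc n. G (Suc n) k \<boxtimes> (mu j e *\<^sub>C tau (Suc n) k (j + e))) =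
      mu j e *\<^sub>C (\<Sum>k\<le>Suc n. G (Suc n) k \<boxtimes> tau (Suc n) k (j + e))"
    by (simp only: cvec.scale_sum_right tensor_pure_bilinear)
  also have "\<dots> = \<Delta> (mu j e *\<^sub>C G (Suc n) (j + e))"
    using assms by (simp add: Delta_hom Delta_G del: sum.atMost_Suc)
  also have "\<dots> = \<Delta> (G n j) * \<Delta> (gen e)"
    using assms by (simp add: Delta_hom flip: G_mult_gen)
  also have "\<dots> = (\<Sum>k\<le>n. (G n k * a) \<boxtimes> (tau n k j * ent 0 e)) + (\<Sum>k\<le>n. (G n k * b) \<boxtimes> (tau n k j * ent 1 e))"
    using assms(1) by (simp add: Delta_G Delta_gen sum_distrib_right distrib_left tensor_pure_mult sum.distrib)
  also have "(\<Sum>k\<le>n. (G n k * a) \<boxtimes> (tau n k j * ent 0 e)) = (\<Sum>k\<le>n. G (Suc n) k \<boxtimes> ?A k)"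
    by (intro sum.cong) (auto simp: G_mult_a tensor_scale_move)
  also have "\<dots> = (\<Sum>k\<le>Suc n. G (Suc n) k \<boxtimes> ?A k)" by simp
  also have "(\<Sum>k\<le>n. (G n k * b) \<boxtimes> (tau n k j * ent 1 e)) = (\<Sum>k\<le>Suc n. G (Suc n) k \<boxtimes> ?B k)"
    by (simp add: sum.atMost_Suc_shift G_mult_b del: sum.atMost_Suc)
  finally have eq: "(\<Sum>k\<le>Suc n. G (Suc n) k \<boxtimes> (mu j e *\<^sub>C tau (Suc n) k (j + e))) =
      (\<Sum>k\<le>Suc n. G (Suc n) k \<boxtimes> (?A k + ?B k))"
    by (simp only: tensor_pure_bilinear sum.distrib)
  from indep_family_tensor[OF indep_G eq, of k] show ?thesis using assms(3) by simp
qed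

lemma tau_0: "tau 0 0 0 = 1"
proof -
  have "(\<Sum>i\<le>0. G 0 i \<boxtimes> tau 0 i 0) = (\<Sum>i\<le>0. G 0 i \<boxtimes> 1)"
    using Delta_G[of 0 0] by (simp add: G_def Delta_hom tensor_pure_one)
  from indep_family_tensor[OF indep_G[of 0] this, of 0] show ?thesis by simp
qed

lemma S_ent: "S (ent 0 0) = adj a" "S (ent 0 1) = (- q) *\<^sub>C (b * adj D)" "S (ent 1 0) = adj b" "S (ent 1 1) = a * adj D"
proof -
  show "S (ent 1 0) = adj b"
    unfolding ent_def
    by (simp add: S_hom mult_scaleC_left scaleC_scaleC mult.assoc Uq2_relations del: cvec.scale_minus_left)
  show "S (ent 0 0) = adj a" "S (ent 0 1) = (- q) *\<^sub>C (b * adj D)" "S (ent 1 1) = a * adj D"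
    by (simp_all add: ent_def gen_def S_hom)
qed

lemma ent_antipode:
  assumes "c \<le> 1" "e \<le> 1"
  shows "S (ent c 0) * ent 0 e + S (ent c 1) * ent 1 e = (if c = e then 1 else 0)"
proof -
  have qq: "q * cnj q = 1" "cnj q * q = 1"
    using q_unimodular complex_norm_square[of q] by (simp_all add: mult.commute)
  have DD: "adj D * (D * z) = z" for z using Uq2_relations(8) by (simp flip: mult.assoc)
  have 2: "adj b * a = cnj q *\<^sub>C (a * adj b)"
    using arg_cong[OF Uq2_relations(2), of adj] by (simp add: adj_mult adj_adj adj_scaleC)
  have 00: "S (ent 0 0) * ent 0 0 + S (ent 0 1) * ent 1 0 = 1"
    unfolding S_ent using Uq2_relations(9,3) qq
    by (simp add: ent_def gen_def mult_scaleC_left mult_scaleC_right scaleC_scaleC mult.assoc DD)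
  have 01: "S (ent 0 0) * ent 0 1 + S (ent 0 1) * ent 1 1 = 0"
    unfolding S_ent by (simp add: ent_def gen_def mult_scaleC_left mult.assoc DD Uq2_relations(2))
  have 10: "S (ent 1 0) * ent 0 0 + S (ent 1 1) * ent 1 0 = 0"
    unfolding S_ent by (simp add: ent_def gen_def mult_scaleC_right mult.assoc DD 2)
  have 11: "S (ent 1 0) * ent 0 1 + S (ent 1 1) * ent 1 1 = 1"
    unfolding S_ent using Uq2_relations(4,3) by (simp add: ent_def gen_def mult.assoc DD add.commute)
  have "c = 0 \<or> c = 1" "e = 0 \<or> e = 1" using assms by auto
  then show ?thesis using 00 01 10 11 by auto
qed

text \<open>\<open>mu\<close> is the matrix of the intertwiner from the product of the corepresentations of
  dimensions \<open>n + 1\<close> and 2 onto the one of dimension \<open>n + 2\<close>; it carries the antipode identity along.\<close>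

lemma tau_antipode:
  assumes "i \<le> n" "j \<le> n"
  shows "(\<Sum>k\<le>n. S (tau n i k) * tau n k j) = (if i = j then 1 else 0)"
  using assms
proof (induction n arbitrary: i j)
  case 0
  then show ?case by (simp add: tau_0 S_hom)
next
  case (Suc n)
  \<comment> \<open>The new column is reduced to an old column \<open>j'\<close>, with
    \<open>e = 0\<close> only when \<open>j = 0\<close>.\<close>
  obtain j' e where j: "j = j' + e" "j' \<le> n" "e \<le> 1"
  proof (cases j)
    case 0
    then show ?thesis using that[of 0 0] by simp
  next
    case (Suc j')
    then show ?thesis using that[of j' 1] \<open>j \<le> Suc n\<close> by simp
  qed
  let ?\<sigma> = "\<lambda>i k. S (tau (Suc n) i k)"
  have S_rec: "mu k c *\<^sub>C ?\<sigma> i (k + c) =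
    (if i \<le> n then q ^ i *\<^sub>C (S (ent 0 c) * S (tau n i k)) else 0) +
    (if 1 \<le> i then S (ent 1 c) * S (tau n (i - 1) k) else 0)" if "k \<le> n" "c \<le> 1" for k c
  proof -
    have "mu k c *\<^sub>C ?\<sigma> i (k + c) = S (mu k c *\<^sub>C tau (Suc n) i (k + c))"
      using that Suc.prems by (simp add: S_hom)
    also have "\<dots> = S ((if i \<le> n then q ^ i *\<^sub>C (tau n i k * ent 0 c) else 0) +
        (if 1 \<le> i then tau n (i - 1) k * ent 1 c else 0))"
      using that Suc.prems by (simp only: tau_rec)
    also have "\<dots> = S (if i \<le> n then q ^ i *\<^sub>C (tau n i k * ent 0 c) else 0) +
        S (if 1 \<le> i then tau n (i - 1) k * ent 1 c else 0)"
      using that Suc.prems by (intro S_hom) auto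
    moreover have "S 0 = 0" using S_hom(3)[of 0 0] by simp
    ultimately show ?thesis using that Suc.prems by (auto simp: S_hom)
  qed
  have "mu j' e *\<^sub>C (\<Sum>k\<le>Suc n. ?\<sigma> i k * tau (Suc n) k j) =
      (\<Sum>k\<le>Suc n. ?\<sigma> i k * (mu j' e *\<^sub>C tau (Suc n) k (j' + e)))"
    unfolding cvec.scale_sum_right j(1) by (simp only: mult_scaleC_right)
  also have "\<dots> = (\<Sum>k\<le>Suc n. ?\<sigma> i k * (if k \<le> n then q ^ k *\<^sub>C (tau n k j' * ent 0 e) else 0)) +
      (\<Sum>k\<le>Suc n. ?\<sigma> i k * (if 1 \<le> k then tau n (k - 1) j' * ent 1 e else 0))"
    unfolding sum.distrib[symmetric] distrib_left[symmetric]
    using j by (intro sum.cong refl arg_cong2[where f = "(*)"] tau_rec) auto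
  \<comment> \<open>The factor \<open>q ^ k\<close> contributed by the right-hand entry is
    \<open>mu k 0\<close>, precisely the coefficient with which \<open>S_rec\<close> is available
    for the left-hand entry. The second sum fits in the same way, since
    \<open>mu k 1 = 1\<close>.\<close>
  also have "(\<Sum>k\<le>Suc n. ?\<sigma> i k * (if k \<le> n then q ^ k *\<^sub>C (tau n k j' * ent 0 e) else 0)) =
      (\<Sum>k\<le>n. (mu k 0 *\<^sub>C ?\<sigma> i (k + 0)) * (tau n k j' * ent 0 e))"
    by (auto simp: mu_def mult_scaleC_left mult_scaleC_right intro!: sum.cong)
  also have "(\<Sum>k\<le>Suc n. ?\<sigma> i k * (if 1 \<le> k then tau n (k - 1) j' * ent 1 e else 0)) =
      (\<Sum>k\<le>n. (mu k 1 *\<^sub>C ?\<sigma> i (k + 1)) * (tau n k j' * ent 1 e))"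
    by (simp add: sum.atMost_Suc_shift mu_def del: sum.atMost_Suc)
  finally have eq: "mu j' e *\<^sub>C (\<Sum>k\<le>Suc n. ?\<sigma> i k * tau (Suc n) k j) =
      (\<Sum>k\<le>n. (mu k 0 *\<^sub>C ?\<sigma> i (k + 0)) * (tau n k j' * ent 0 e)) +
      (\<Sum>k\<le>n. (mu k 1 *\<^sub>C ?\<sigma> i (k + 1)) * (tau n k j' * ent 1 e))" .
  \<comment> \<open>\<open>S_rec\<close> places the entries of degree \<open>n\<close> next to each
    other, and the induction hypothesis collapses their sum over \<open>k\<close>. What remains is
    the antipode identity of the fundamental corepresentation.\<close>
  have key: "(\<Sum>k\<le>n. (mu k c *\<^sub>C ?\<sigma> i (k + c)) * (tau n k j' * ent c e)) =
      (if i = j' then q ^ i *\<^sub>C (S (ent 0 c) * ent c e) else 0) +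
      (if i = Suc j' then S (ent 1 c) * ent c e else 0)" if "c \<le> 1" for c
  proof -
    have e1: "(\<Sum>k\<le>n. (mu k c *\<^sub>C ?\<sigma> i (k + c)) * (tau n k j' * ent c e)) =
      (if i \<le> n then q ^ i *\<^sub>C (S (ent 0 c) * (\<Sum>k\<le>n. S (tau n i k) * tau n k j') * ent c e) else 0) +
      (if 1 \<le> i then S (ent 1 c) * (\<Sum>k\<le>n. S (tau n (i - 1) k) * tau n k j') * ent c e else 0)"
    proof -
      have "(\<Sum>k\<le>n. (mu k c *\<^sub>C ?\<sigma> i (k + c)) * (tau n k j' * ent c e)) =
        (\<Sum>k\<le>n. ((if i \<le> n then q ^ i *\<^sub>C (S (ent 0 c) * S (tau n i k)) else 0) +
          (if 1 \<le> i then S (ent 1 c) * S (tau n (i - 1) k) else 0)) * (tau n k j' * ent c e))"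
        using that by (intro sum.cong refl arg_cong2[where f = "(*)"] S_rec) auto
      then show ?thesis
        by (simp add: distrib_right sum.distrib sum_distrib_left sum_distrib_right cvec.scale_sum_right mult_scaleC_left mult.assoc)
    qed
    have e2: "(\<Sum>k\<le>n. S (tau n i k) * tau n k j') = (if i = j' then 1 else 0)" if "i \<le> n"
      using Suc.IH that j(2) by simp
    have e3: "(\<Sum>k\<le>n. S (tau n (i - 1) k) * tau n k j') = (if i = Suc j' then 1 else 0)" if "1 \<le> i"
      using Suc.IH[of "i - 1" j'] that j(2) Suc.prems by auto
    show ?thesis
      unfolding e1 by (simp add: e2 e3[simplified] cong: if_cong) (use j(2) in auto)
  qed
  have "mu j' e *\<^sub>C (\<Sum>k\<le>Suc n. ?\<sigma> i k * tau (Suc n) k j) =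
      (if i = j' then q ^ i *\<^sub>C (S (ent 0 0) * ent 0 e + S (ent 0 1) * ent 1 e) else 0) +
      (if i = Suc j' then S (ent 1 0) * ent 0 e + S (ent 1 1) * ent 1 e else 0)"
    unfolding eq key[OF zero_le_one] key[OF order_refl] by (simp add: scaleC_add_right)
  also have "\<dots> = mu j' e *\<^sub>C (if i = j then 1 else 0)"
    using j ent_antipode[of 0 e] ent_antipode[of 1 e] by (auto simp: mu_def)
  finally show ?case
    by (rule cvec.scale_left_imp_eq[OF mu_nonzero])
qed

lemma t_antipode:
  assumes "i \<le> n" "j \<le> n"
  shows "(\<Sum>k\<le>n. S (t n i k) * t n k j) = (if i = j then 1 else 0)"
proof -
  have "S (tau n i k) * tau n k j = (rt n i / rt n j) *\<^sub>C (S (t n i k) * t n k j)" if "k \<le> n" for k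
    using assms that by (simp add: tau_def S_hom mult_scaleC_left mult_scaleC_right scaleC_scaleC)
  then have "(rt n i / rt n j) *\<^sub>C (\<Sum>k\<le>n. S (t n i k) * t n k j) = (if i = j then 1 else 0)"
    using tau_antipode[OF assms] by (simp add: cvec.scale_sum_right)
  also have "\<dots> = (rt n i / rt n j) *\<^sub>C (if i = j then 1 else 0)" using assms by auto
  finally show ?thesis by (rule cvec.scale_left_imp_eq[rotated]) (use assms in simp)
qed

text \<open>The sum of the \<open>\<Delta> (fv n j * adj (fv n j))\<close> is
  \<open>1 \<boxtimes> 1\<close>. Its left leg 1 is expanded once more by \<open>sum_fv\<close>, and
  the right legs are compared over the independent products
  \<open>fv n i * adj (fv n k)\<close>.\<close>

lemma t_coisometry:
  assumes "i \<le> n" "k \<le> n"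
  shows "(\<Sum>j\<le>n. t n i j * adj (t n k j)) = (if i = k then 1 else 0)"
proof -
  let ?I = "{..n} \<times> {..n}"
  have "(\<Sum>p\<in>?I. (\<lambda>(i, k). fv n i * adj (fv n k)) p \<boxtimes> (\<lambda>(i, k). \<Sum>j\<le>n. t n i j * adj (t n k j)) p) =
      (\<Sum>j\<le>n. \<Delta> (fv n j * adj (fv n j)))"
  proof -
    have adj_sum: "adj (\<Sum>i\<le>n. u i) = (\<Sum>i\<le>n. adj (u i))" for u :: "nat \<Rightarrow> ('a, 'a) tensor"
      by (rule adj_sum)
    have "\<Delta> (fv n j * adj (fv n j)) = (\<Sum>p\<in>?I. (\<lambda>(i, k). fv n i * adj (fv n k)) p \<boxtimes> (\<lambda>(i, k). t n i j * adj (t n k j)) p)" if "j \<le> n" for j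
      using that by (simp add: Delta_hom Delta_fv adj_sum sum_product tensor_pure_adj tensor_pure_mult
          sum.cartesian_product case_prod_beta)
    then have "(\<Sum>j\<le>n. \<Delta> (fv n j * adj (fv n j))) =
        (\<Sum>j\<le>n. \<Sum>p\<in>?I. (\<lambda>(i, k). fv n i * adj (fv n k)) p \<boxtimes> (\<lambda>(i, k). t n i j * adj (t n k j)) p)"
      by simp
    also have "\<dots> = (\<Sum>p\<in>?I. (\<lambda>(i, k). fv n i * adj (fv n k)) p \<boxtimes> (\<lambda>(i, k). \<Sum>j\<le>n. t n i j * adj (t n k j)) p)"
      by (subst sum.swap) (simp add: case_prod_beta tensor_pure_sum_right)
    finally show ?thesis by simp
  qed
  also have "\<dots> = \<Delta> (\<Sum>j\<le>n. fv n j * adj (fv n j))"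
    by (rule Delta_sum[symmetric]) simp
  also have "\<dots> = (\<Sum>j\<le>n. fv n j * adj (fv n j)) \<boxtimes> 1"
    by (simp add: sum_fv Delta_hom tensor_pure_one)
  also have "\<dots> = (\<Sum>i\<le>n. \<Sum>k\<le>n. (fv n i * adj (fv n k)) \<boxtimes> (if i = k then 1 else 0))"
    by (simp add: tensor_pure_sum_left if_distrib[of "\<lambda>z. _ \<boxtimes> z"] cong: if_cong)
  also have "\<dots> = (\<Sum>p\<in>?I. (\<lambda>(i, k). fv n i * adj (fv n k)) p \<boxtimes> (\<lambda>(i, k). if i = k then 1 else 0) p)"
    by (simp add: sum.cartesian_product case_prod_beta)
  finally have "(\<Sum>p\<in>?I. (\<lambda>(i, k). fv n i * adj (fv n k)) p \<boxtimes> (\<lambda>(i, k). \<Sum>j\<le>n. t n i j * adj (t n k j)) p) =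
      (\<Sum>p\<in>?I. (\<lambda>(i, k). fv n i * adj (fv n k)) p \<boxtimes> (\<lambda>(i, k). if i = k then 1 else 0) p)" .
  from indep_family_tensor[OF indep_fv_adj_fv this, of "(i, k)"] show ?thesis using assms by simp
qed

lemma S_t:
  assumes "i \<le> n" "j \<le> n" shows "S (t n i j) = adj (t n j i)"
proof -
  have "S (t n i j) = (\<Sum>k\<le>n. S (t n i k) * (\<Sum>l\<le>n. t n k l * adj (t n j l)))"
    using assms by (simp add: t_coisometry if_distrib[of "\<lambda>z. _ * z"] cong: if_cong)
  also have "\<dots> = (\<Sum>l\<le>n. (\<Sum>k\<le>n. S (t n i k) * t n k l) * adj (t n j l))"
    unfolding sum_distrib_left sum_distrib_right by (subst sum.swap) (simp add: mult.assoc)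
  also have "\<dots> = adj (t n j i)"
    using assms by (simp add: t_antipode if_distrib[of "\<lambda>z. z * _"] cong: if_cong)
  finally show ?thesis .
qed

lemma t_isometry:
  assumes "i \<le> n" "j \<le> n"
  shows "(\<Sum>k\<le>n. adj (t n k i) * t n k j) = (if i = j then 1 else 0)"
  using t_antipode[OF assms] assms by (simp add: S_t)

section \<open>Orthogonality relations\<close>

definition el :: "nat \<Rightarrow> nat \<Rightarrow> nat \<Rightarrow> int \<Rightarrow> 'a" where
  "el n i j k = t n i j * upow D k"

lemma el_in_Alg [simp]: "i \<le> n \<Longrightarrow> j \<le> n \<Longrightarrow> el n i j k \<in> Alg"
  by (simp add: el_def)

lemma S_el: "i \<le> n \<Longrightarrow> j \<le> n \<Longrightarrow> S (t n i j * upow D k) = adj (el n j i k)"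
  by (simp add: el_def S_hom S_upow S_t adj_mult)

lemma adj_upow_upow: "adj (upow D k) * upow D k = 1"
proof -
  have "adj D ^ n * D ^ n = 1" "D ^ n * adj D ^ n = 1" for n
    by (simp_all add: power_mult_commuting Uq2_relations)
  then show ?thesis by (simp add: upow_def adj_power adj_adj)
qed

lemma Delta_power: "x \<in> Alg \<Longrightarrow> \<Delta> (x ^ n) = \<Delta> x ^ n"
  by (induction n) (simp_all add: Delta_hom)

lemma tensor_power: "(x \<boxtimes> y) ^ n = (x ^ n) \<boxtimes> (y ^ n)"
  by (induction n) (simp_all add: tensor_pure_mult tensor_pure_one)

lemma Delta_upow: "\<Delta> (upow D k) = upow D k \<boxtimes> upow D k"
  by (simp add: upow_def Delta_power Delta_hom tensor_pure_adj tensor_power)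

lemma Delta_fv_upow:
  assumes "j \<le> n" shows "\<Delta> (fv n j * upow D k) = (\<Sum>i\<le>n. (fv n i * upow D k) \<boxtimes> el n i j k)"
  using assms by (simp add: Delta_hom Delta_fv Delta_upow sum_distrib_right tensor_pure_mult el_def)

lemma clinear_h: "clinear h" and h_one: "h 1 = 1"
  using haar by (simp_all add: haar_state_def state_def)

lemma haar_identity:
  assumes "j \<le> n" "p \<le> m"
  shows "(\<Sum>z\<in>{..n} \<times> {..m}. (\<lambda>(i, r). h (adj (el n i j k) * el m r p l)) z *\<^sub>C
      (\<lambda>(i, r). adj (fv n i * upow D k) * (fv m r * upow D l)) z) =
    h (adj (fv n j * upow D k) * (fv m p * upow D l)) *\<^sub>C 1"
proof -
  have adj_sum: "adj (\<Sum>i\<le>n. u i) = (\<Sum>i\<le>n. adj (u i))" for u :: "nat \<Rightarrow> ('a, 'a) tensor"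
    by (rule adj_sum)
  have "\<Delta> (adj (fv n j * upow D k) * (fv m p * upow D l)) =
      adj (\<Delta> (fv n j * upow D k)) * \<Delta> (fv m p * upow D l)"
    by (subst Delta_hom(2), simp, simp, subst Delta_hom(4), simp, rule refl)
  also have "\<dots> = (\<Sum>z\<in>{..n} \<times> {..m}. (\<lambda>(i, r). adj (fv n i * upow D k) * (fv m r * upow D l)) z \<boxtimes>
         (\<lambda>(i, r). adj (el n i j k) * el m r p l) z)"
    using assms by (simp add: Delta_fv_upow adj_sum sum_product tensor_pure_adj tensor_pure_mult
        sum.cartesian_product case_prod_beta)
  finally have "slice_right h (\<Delta> (adj (fv n j * upow D k) * (fv m p * upow D l))) =
      (\<Sum>z\<in>{..n} \<times> {..m}. (\<lambda>(i, r). h (adj (el n i j k) * el m r p l)) z *\<^sub>C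
      (\<lambda>(i, r). adj (fv n i * upow D k) * (fv m r * upow D l)) z)"
    by (simp add: slice_right_sum slice_right_pure clinear_h case_prod_beta)
  moreover have "adj (fv n j * upow D k) * (fv m p * upow D l) \<in> Alg" by simp
  ultimately show ?thesis using haar unfolding haar_state_def by metis
qed

text \<open>The diagonal entries of the sum in \<open>haar_identity\<close> depend on the phases
  through \<open>u powi (m - n) * w powi (l - k)\<close>, which is not constant. So the scalar on
  the right vanishes, and independence kills every coefficient.\<close>

lemma orthogonal_distinct:
  assumes "(n, k) \<noteq> (m, l)" "i \<le> n" "j \<le> n" "r \<le> m" "p \<le> m"
  shows "h (adj (el n i j k) * el m r p l) = 0"
proof -
  note eq = haar_identity[OF assms(3,5), of k l]
  have "h (adj (fv n j * upow D k) * (fv m p * upow D l)) = 0"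
  proof (rule acts_not_scalar[OF _ _ _ eq])
    fix z assume "z \<in> {..n} \<times> {..m}"
    then show "acts ((\<lambda>(i, r). adj (fv n i * upow D k) * (fv m r * upow D l)) z) (int (snd z) - int (fst z)) (n + m) (fst z + snd z)
      (int (fst z) - int n + (int m - int (snd z))) (l - k)"
      using acts_adj_fv_fv by (auto split: prod.splits)
  next
    fix z :: "nat \<times> nat" assume "int (snd z) - int (fst z) = 0"
    then show "int (fst z) - int n + (int m - int (snd z)) = int m - int n \<and> l - k = l - k" by simp
  next
    show "(int m - int n, l - k) \<noteq> (0, 0)" using assms(1) by auto
  qed
  with eq have "(\<Sum>z\<in>{..n} \<times> {..m}. (\<lambda>(i, r). h (adj (el n i j k) * el m r p l)) z *\<^sub>C
      (\<lambda>(i, r). adj (fv n i * upow D k) * (fv m r * upow D l)) z) = 0" by simp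
  from indep_family_zero[OF indep_adj_fv_fv this, of "(i, r)"] show ?thesis using assms by simp
qed

text \<open>Here the scalar \<open>c\<close> stands in front of 1, the sum of the diagonal products,
  so the coefficients are \<open>c\<close> for \<open>i = r\<close> and 0 otherwise. Since
  \<open>c\<close> does not depend on \<open>i\<close>, summing over \<open>i\<close> and using the
  isometry property gives \<open>(n + 1) * c = 1\<close> or 0, according to whether
  \<open>j = p\<close>.\<close>

lemma orthogonal_same:
  assumes "i \<le> n" "j \<le> n" "r \<le> n" "p \<le> n"
  shows "h (adj (el n i j k) * el n r p k) = (if i = r \<and> j = p then 1 / of_nat (n + 1) else 0)"
proof -
  interpret h: Vector_Spaces.linear scaleC scaleC h by (rule clinear_h)
  define c where "c = h (adj (fv n j * upow D k) * (fv n p * upow D k))"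
  have "(\<Sum>i\<le>n. adj (fv n i * upow D k) * (fv n i * upow D k)) = adj (upow D k) * (\<Sum>i\<le>n. adj (fv n i) * fv n i) * upow D k"
    by (simp add: adj_mult sum_distrib_left sum_distrib_right mult.assoc)
  then have one: "(\<Sum>i\<le>n. adj (fv n i * upow D k) * (fv n i * upow D k)) = 1"
    by (simp add: sum_fv adj_upow_upow)
  have "(\<Sum>z\<in>{..n} \<times> {..n}. (\<lambda>(i, r). if i = r then c else 0) z *\<^sub>C
      (\<lambda>(i, r). adj (fv n i * upow D k) * (fv n r * upow D k)) z) =
      (\<Sum>i\<le>n. \<Sum>r\<le>n. (if i = r then c else 0) *\<^sub>C (adj (fv n i * upow D k) * (fv n r * upow D k)))"
    by (simp add: sum.cartesian_product case_prod_beta)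
  also have "\<dots> = c *\<^sub>C (\<Sum>i\<le>n. adj (fv n i * upow D k) * (fv n i * upow D k))"
    by (simp add: if_distrib[of "\<lambda>z. z *\<^sub>C _"] cvec.scale_sum_right cong: if_cong)
  finally have "(\<Sum>z\<in>{..n} \<times> {..n}. (\<lambda>(i, r). h (adj (el n i j k) * el n r p k)) z *\<^sub>C
      (\<lambda>(i, r). adj (fv n i * upow D k) * (fv n r * upow D k)) z) =
    (\<Sum>z\<in>{..n} \<times> {..n}. (\<lambda>(i, r). if i = r then c else 0) z *\<^sub>C
      (\<lambda>(i, r). adj (fv n i * upow D k) * (fv n r * upow D k)) z)"
    using haar_identity[OF assms(2,4), of k k] by (simp add: one c_def)
  from indep_family_coeff_eq[OF indep_adj_fv_fv this]
  have c: "h (adj (el n i j k) * el n r p k) = (if i = r then c else 0)" if "i \<le> n" "r \<le> n" for i r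
    using that by fastforce
  have "(\<Sum>i\<le>n. adj (el n i j k) * el n i p k) = adj (upow D k) * (\<Sum>i\<le>n. adj (t n i j) * t n i p) * upow D k"
    by (simp add: el_def adj_mult sum_distrib_left sum_distrib_right mult.assoc)
  also have "\<dots> = (if j = p then 1 else 0)"
    using assms by (simp add: t_isometry adj_upow_upow)
  finally have "h (\<Sum>i\<le>n. adj (el n i j k) * el n i p k) = (if j = p then 1 else 0)"
    by (simp add: h_one h.zero)
  moreover have "h (\<Sum>i\<le>n. adj (el n i j k) * el n i p k) = (\<Sum>i\<le>n. c)"
    unfolding h.sum using c by (intro sum.cong) auto
  ultimately have "of_nat (n + 1) * c = (if j = p then 1 else 0)" by simp
  then have "c = (if j = p then 1 / of_nat (n + 1) else 0)"
    by (metis mult.commute mult_eq_0_iff nonzero_eq_divide_eq of_nat_neq_0 add.commute plus_1_eq_Suc)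
  then show ?thesis using c[OF assms(1,3)] by simp
qed

lemma orthogonality:
  assumes "i \<le> n" "j \<le> n" "r \<le> m" "p \<le> m"
  shows "h (adj (el n i j k) * el m r p l) = (if (n, i, j, k) = (m, r, p, l) then 1 / of_nat (n + 1) else 0)"
proof (cases "(n, k) = (m, l)")
  case True
  then show ?thesis using orthogonal_same[of i n j r p k] assms by auto
next
  case False
  from orthogonal_distinct[OF this assms] show ?thesis using False by auto
qed

end

section \<open>Spanning\<close>

lemma clinear_span:
  assumes f: "clinear f" and x: "x \<in> cvec.span A" and A: "\<And>y. y \<in> A \<Longrightarrow> f y \<in> cvec.span B"
  shows "f x \<in> cvec.span B"
proof -
  interpret f: Vector_Spaces.linear scaleC scaleC f by (rule f)
  from x show ?thesis
    by (induction rule: cvec.span_induct_alt)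
      (auto simp: f.zero f.add f.scale intro: cvec.span_zero cvec.span_add cvec.span_scale A)
qed

text \<open>A vector of \<open>U\<close> outside the span of \<open>A\<close> would extend
  \<open>A\<close> to an independent set with more than \<open>card U\<close> elements inside the
  span of \<open>U\<close>.\<close>

lemma span_subset_of_card_le:
  fixes A U :: "'a::complex_vector set"
  assumes "cvec.independent A" "A \<subseteq> cvec.span U" "finite U" "card U \<le> card A"
  shows "cvec.span U \<subseteq> cvec.span A"
proof (rule cvec.span_minimal)
  show "U \<subseteq> cvec.span A"
  proof (rule ccontr)
    assume "\<not> U \<subseteq> cvec.span A"
    then obtain u where u: "u \<in> U" "u \<notin> cvec.span A" by blast
    have fin: "finite A" using cvec.independent_span_bound[OF assms(3,1,2)] by simp
    have "cvec.independent (insert u A)" using u(2) assms(1) by (rule cvec.independent_insertI)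
    moreover have "insert u A \<subseteq> cvec.span U" using u(1) assms(2) by (auto intro: cvec.span_base)
    ultimately have "card (insert u A) \<le> card U"
      using cvec.independent_span_bound[OF assms(3)] by blast
    moreover have "u \<notin> A" using u(2) cvec.span_base by blast
    ultimately show False using fin assms(4) by simp
  qed
qed (rule cvec.subspace_span)

section \<open>Words in four letters and an upper bound for their span\<close>

context Uq2 begin

text \<open>Up to scalars, \<open>a\<close>, \<open>b\<close>, \<open>Dbs\<close> and
  \<open>Das\<close> are the entries of the fundamental corepresentation; hence words of length
  \<open>n\<close> produce the coefficients of degree \<open>n\<close>.\<close>

definition Dbs :: 'a where "Dbs = D * adj b"
definition Das :: 'a where "Das = D * adj a"

abbreviation ltrs :: "'a set" where "ltrs \<equiv> {a, b, Dbs, Das}"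

lemma qcomm_letters:
  assumes "x \<in> {a, b, Dbs, Das, D, adj D}" "y \<in> {a, b, Dbs, Das, D, adj D}"
  shows "qcomm x y"
proof -
  have 1: "qcomm x y" if "x \<in> {a, b, adj a, adj b, D, adj D}" "y \<in> {a, b, Dbs, Das, D, adj D}" for x y
    using that qcomm_gen[of x] unfolding Dbs_def Das_def by (auto intro: qcomm_mult)
  have "qcomm y z" if "z \<in> {a, b, adj a, adj b, D, adj D}" for z
    using 1[OF that assms(2)] by (rule qcomm_sym)
  then have "qcomm y x" using assms(1) unfolding Dbs_def Das_def by (auto intro: qcomm_mult)
  then show ?thesis by (rule qcomm_sym)
qed

definition E :: "nat \<Rightarrow> 'a set" where
  "E n = cvec.span {prod_list xs | xs. set xs \<subseteq> ltrs \<and> length xs = n}"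

lemma E_word: "set xs \<subseteq> ltrs \<Longrightarrow> prod_list xs \<in> E (length xs)"
  unfolding E_def by (rule cvec.span_base) blast

lemma E_add: "x \<in> E n \<Longrightarrow> y \<in> E n \<Longrightarrow> x + y \<in> E n"
  unfolding E_def by (rule cvec.span_add)

lemma E_scale: "x \<in> E n \<Longrightarrow> c *\<^sub>C x \<in> E n"
  unfolding E_def by (rule cvec.span_scale)

lemma E_zero: "0 \<in> E n"
  unfolding E_def by (rule cvec.span_zero)

lemma E_mult_letter: "x \<in> E n \<Longrightarrow> y \<in> ltrs \<Longrightarrow> x * y \<in> E (Suc n)"
  unfolding E_def
proof (rule clinear_span[OF clinear_times_right])
  fix z assume y: "y \<in> ltrs" and "z \<in> {prod_list xs | xs. set xs \<subseteq> ltrs \<and> length xs = n}"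
  then obtain xs where "z = prod_list xs" "set xs \<subseteq> ltrs" "length xs = n" by blast
  then show "z * y \<in> cvec.span {prod_list xs | xs. set xs \<subseteq> ltrs \<and> length xs = Suc n}"
    using y by (intro cvec.span_base) (auto intro!: exI[of _ "xs @ [y]"])
qed

text \<open>Read as a formula for \<open>D\<close>, this is the quantum determinant of the
  fundamental corepresentation; it gives \<open>D\<close> degree 2 in the letters.\<close>

lemma a_mult_Das: "a * Das = D - inverse (q\<^sup>2) *\<^sub>C (b * Dbs)"
proof -
  have "D = D * (a * adj a + b * adj b)" by (simp only: Uq2_relations(4) mult_1_right)
  also have "\<dots> = a * Das + D * b * adj b"
    by (simp add: distrib_left Das_def Uq2_relations(5) flip: mult.assoc)
  also have "D * b = inverse (q\<^sup>2) *\<^sub>C (b * D)" by (simp add: Uq2_relations(6) scaleC_scaleC)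
  finally show ?thesis by (simp add: Dbs_def mult_scaleC_left mult.assoc eq_diff_eq)
qed

lemma E_mult_D: assumes "x \<in> E n" shows "x * D \<in> E (n + 2)"
proof -
  have "D = a * Das + inverse (q\<^sup>2) *\<^sub>C (b * Dbs)" by (simp add: a_mult_Das)
  then have "x * D = x * a * Das + inverse (q\<^sup>2) *\<^sub>C (x * b * Dbs)"
    by (metis distrib_left mult.assoc mult_scaleC_right)
  then show ?thesis using assms by (simp add: E_add E_scale E_mult_letter)
qed

definition mono :: "nat \<Rightarrow> nat \<Rightarrow> nat \<Rightarrow> nat \<Rightarrow> 'a" where
  "mono p r s u = a ^ p * b ^ r * Dbs ^ s * Das ^ u"

abbreviation mono_word :: "nat \<Rightarrow> nat \<Rightarrow> nat \<Rightarrow> nat \<Rightarrow> 'a list" where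
  "mono_word p r s u \<equiv> replicate p a @ replicate r b @ replicate s Dbs @ replicate u Das"

lemma mono_word: "mono p r s u = prod_list (mono_word p r s u)"
  by (simp add: mono_def mult.assoc)

lemma mono_in_E: "mono p r s u \<in> E (p + r + s + u)"
  using E_word[of "mono_word p r s u"] by (auto simp: mono_word add.assoc set_replicate_conv_if)

lemma sim_mono:
  assumes "set xs \<subseteq> ltrs" "mset xs = mset (mono_word p r s u)"
  shows "prod_list xs \<sim> mono p r s u"
  unfolding mono_word
proof (rule sim_prod_list_perm[OF assms(2)])
  fix x y assume "x \<in> set xs" "y \<in> set xs"
  then show "qcomm x y" using assms(1) by (intro qcomm_letters) auto
qed

lemma word_sim_mono:
  assumes "set xs \<subseteq> ltrs"
  obtains p r s u where "prod_list xs \<sim> mono p r s u" "length xs = p + r + s + u"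
proof -
  have "\<exists>p r s u. mset xs = mset (mono_word p r s u)"
    using assms
  proof (induction xs)
    case Nil
    show ?case by (rule exI[of _ 0], rule exI[of _ 0], rule exI[of _ 0], rule exI[of _ 0]) simp
  next
    case (Cons x xs)
    then obtain p r s u where xs: "mset xs = mset (mono_word p r s u)" by auto
    have "x = a \<or> x = b \<or> x = Dbs \<or> x = Das" using Cons.prems by auto
    then consider "x = a" | "x = b" | "x = Dbs" | "x = Das" by blast
    then show ?case
    proof cases
      case 1
      then have "mset (x # xs) = mset (mono_word (Suc p) r s u)" using xs by simp
      then show ?thesis by blast
    next
      case 2
      then have "mset (x # xs) = mset (mono_word p (Suc r) s u)" using xs by simp
      then show ?thesis by blast
    next
      case 3
      then have "mset (x # xs) = mset (mono_word p r (Suc s) u)" using xs by simp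
      then show ?thesis by blast
    next
      case 4
      then have "mset (x # xs) = mset (mono_word p r s (Suc u))" using xs by simp
      then show ?thesis by blast
    qed
  qed
  then obtain p r s u where eq: "mset xs = mset (mono_word p r s u)" by blast
  moreover have "length xs = p + r + s + u"
    using arg_cong[OF eq, of size] by simp
  ultimately show ?thesis using that sim_mono[OF assms] by blast
qed

text \<open>The ordered monomials of degree \<open>n\<close> that do not contain both
  \<open>a\<close> and \<open>Das\<close>. Those without \<open>a\<close> are indexed by
  \<open>x = r\<close>, \<open>y = s\<close>; those with \<open>p > 0\<close> and without
  \<open>Das\<close> by \<open>x = p + s\<close>, \<open>y = p + r\<close>, so that
  \<open>x + y - n = p\<close>. The square of pairs makes the count \<open>(n + 1)^2\<close>
  visible.\<close>

definition reduced :: "nat \<Rightarrow> 'a set" where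
  "reduced n = (\<lambda>(x, y). if x + y \<le> n then mono 0 x y (n - x - y) else mono (x + y - n) (n - x) (n - y) 0) `
     ({..n} \<times> {..n})"

lemma finite_reduced: "finite (reduced n)"
  by (simp add: reduced_def)

lemma card_reduced: "card (reduced n) \<le> (n + 1)\<^sup>2"
proof -
  have "card (reduced n) \<le> card ({..n} \<times> {..n})" unfolding reduced_def by (rule card_image_le) simp
  then show ?thesis by (simp add: power2_eq_square)
qed

text \<open>The relation for \<open>a * Das\<close> trades a factor \<open>a * Das\<close> for \<open>D\<close> and \<open>b * Dbs\<close>.\<close>

lemma mono_reduce:
  "mono p r s u \<in> cvec.span (reduced (p + r + s + u) \<union> {y * D | y m. m + 2 = p + r + s + u \<and> y \<in> E m})"
  (is "_ \<in> ?V p r s u")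
proof (induction p arbitrary: r s u)
  case 0
  have "mono 0 r s u \<in> reduced (0 + r + s + u)"
    unfolding reduced_def by (rule image_eqI[of _ _ "(r, s)"]) auto
  then show ?case by (intro cvec.span_base) simp
next
  case (Suc p)
  show ?case
  proof (cases u)
    case 0
    have "mono (Suc p) r s 0 \<in> reduced (Suc p + r + s + 0)"
      unfolding reduced_def by (rule image_eqI[of _ _ "(Suc p + s, Suc p + r)"]) auto
    then show ?thesis unfolding 0 by (intro cvec.span_base) simp
  next
    case u: (Suc u')
    \<comment> \<open>One \<open>a\<close> and one \<open>Das\<close> are brought together at the
      front, where the determinant relation applies.\<close>
    have "prod_list (a # Das # mono_word p r s u') \<sim> mono (Suc p) r s u"
      by (rule sim_mono) (auto simp: u set_replicate_conv_if)
    then have "mono (Suc p) r s u \<sim> a * Das * mono p r s u'"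
      by (simp add: mono_word sim_sym mult.assoc del: prod_list.append)
    also have "a * Das * mono p r s u' = D * mono p r s u' - inverse (q\<^sup>2) *\<^sub>C (b * Dbs * mono p r s u')"
      by (simp add: a_mult_Das left_diff_distrib mult_scaleC_left)
    finally have main: "mono (Suc p) r s u \<sim> D * mono p r s u' - inverse (q\<^sup>2) *\<^sub>C (b * Dbs * mono p r s u')" .
    have "qcomm D (mono p r s u')"
      unfolding mono_word
      by (rule qcomm_prod_list, rule qcomm_letters) (auto simp: set_replicate_conv_if split: if_splits)
    then have "D * mono p r s u' \<sim> mono p r s u' * D" by (simp only: qcomm_def)
    moreover have "mono p r s u' * D \<in> ?V (Suc p) r s u"
      using mono_in_E[of p r s u'] by (intro cvec.span_base) (auto simp: u)
    ultimately have 1: "D * mono p r s u' \<in> ?V (Suc p) r s u" by (rule sim_span)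
    have "prod_list (b # Dbs # mono_word p r s u') \<sim> mono p (Suc r) (Suc s) u'"
      by (rule sim_mono) (auto simp: set_replicate_conv_if)
    then have "b * Dbs * mono p r s u' \<sim> mono p (Suc r) (Suc s) u'"
      by (simp add: mono_word mult.assoc del: prod_list.append)
    \<comment> \<open>The total degree is unchanged while the exponent of \<open>a\<close> has
      dropped, so the induction hypothesis covers this term.\<close>
    moreover have "mono p (Suc r) (Suc s) u' \<in> ?V (Suc p) r s u"
      using Suc.IH[of "Suc r" "Suc s" u'] by (simp add: u)
    ultimately have "b * Dbs * mono p r s u' \<in> ?V (Suc p) r s u" by (rule sim_span)
    then show ?thesis by (rule sim_span[OF main cvec.span_diff[OF 1 cvec.span_scale]])
  qed
qed

lemma E_reduce: "E n \<subseteq> cvec.span (reduced n \<union> {y * D | y m. m + 2 = n \<and> y \<in> E m})"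
  unfolding E_def[of n]
proof (rule cvec.span_minimal[OF _ cvec.subspace_span], rule subsetI)
  fix x assume "x \<in> {prod_list xs | xs. set xs \<subseteq> ltrs \<and> length xs = n}"
  then obtain xs where xs: "x = prod_list xs" "set xs \<subseteq> ltrs" "length xs = n" by blast
  obtain p r s u where "prod_list xs \<sim> mono p r s u" "length xs = p + r + s + u"
    using word_sim_mono[OF xs(2)] by blast
  then have "x \<sim> mono p r s u" "p + r + s + u = n" using xs by simp_all
  with mono_reduce[of p r s u] show "x \<in> cvec.span (reduced n \<union> {y * D | y m. m + 2 = n \<and> y \<in> E m})"
    by (simp only: sim_span)
qed

lemma upow_mult:
  "upow D k * D = upow D (k + 1)" "upow D k * adj D = upow D (k - 1)"
  "D * upow D k = upow D (k + 1)" "adj D * upow D k = upow D (k - 1)"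
proof -
  have 1: "upow D k * D = upow D (k + 1)" for k
  proof (cases "0 \<le> k")
    case True
    then show ?thesis by (simp add: upow_def nat_add_distrib power_commutes)
  next
    case False
    then obtain n where n: "k = - int (Suc n)" by (metis negD not_le)
    have neg: "upow D (- int m) = adj D ^ m" for m by (cases m) (simp_all add: upow_def del: of_nat_Suc)
    have "upow D k * D = adj D ^ Suc n * D" unfolding n by (simp only: neg)
    also have "\<dots> = adj D ^ n" by (simp only: power_Suc2 mult.assoc Uq2_relations mult_1_right)
    also have "\<dots> = upow D (k + 1)" by (simp add: n flip: neg)
    finally show ?thesis .
  qed
  then show "upow D k * D = upow D (k + 1)" .
  have 2: "upow D k * adj D = upow D (k - 1)" for k
    using 1[of "k - 1"] Uq2_relations(7) by (metis diff_add_cancel mult.assoc mult.right_neutral)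
  then show "upow D k * adj D = upow D (k - 1)" .
  show "D * upow D k = upow D (k + 1)" "adj D * upow D k = upow D (k - 1)"
    using arg_cong[OF 2[of "- k"], of adj] arg_cong[OF 1[of "- k"], of adj]
    by (simp_all add: adj_mult adj_adj adj_upow add.commute)
qed

lemma upow_add: "upow D k * upow D l = upow D (k + l)"
proof (induction l rule: int_induct[where k = 0])
  case base
  show ?case by (simp add: upow_def)
next
  case (step1 i)
  have "upow D k * upow D (i + 1) = upow D k * upow D i * D" by (simp add: mult.assoc upow_mult)
  then show ?case by (simp add: step1 upow_mult add.assoc)
next
  case (step2 i)
  have "upow D k * upow D (i - 1) = upow D k * upow D i * adj D" by (simp add: mult.assoc upow_mult)
  then show ?case by (simp add: step2 upow_mult add_diff_eq)
qed

text \<open>\<open>D\<close> and \<open>adj D\<close> commute with all letters up to scalars and are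
  collected on the right.\<close>

lemma word_sim_upow:
  "set xs \<subseteq> {a, b, Dbs, Das, D, adj D} \<Longrightarrow> \<exists>ys k. set ys \<subseteq> ltrs \<and> prod_list xs \<sim> prod_list ys * upow D k"
proof (induction xs)
  case Nil
  have "prod_list [] \<sim> prod_list [] * upow D 0" by (simp add: upow_def)
  then show ?case by (metis empty_subsetI list.set(1))
next
  case (Cons x xs)
  then obtain ys k where ys: "set ys \<subseteq> ltrs" "prod_list xs \<sim> prod_list ys * upow D k" by auto
  have main: "prod_list (x # xs) \<sim> x * (prod_list ys * upow D k)"
    using ys(2) by (simp add: sim_mult)
  show ?case
  proof (cases "x \<in> ltrs")
    case True
    then have "set (x # ys) \<subseteq> ltrs" "prod_list (x # xs) \<sim> prod_list (x # ys) * upow D k"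
      using main ys(1) by (simp_all add: mult.assoc)
    then show ?thesis by blast
  next
    case False
    then have x: "x = D \<or> x = adj D" using Cons.prems by auto
    then obtain l where l: "x * upow D k = upow D l" using upow_mult by blast
    have "qcomm x (prod_list ys)"
      using x ys(1) qcomm_letters[of x] by (intro qcomm_prod_list) auto
    then have "x * prod_list ys * upow D k \<sim> prod_list ys * x * upow D k"
      unfolding qcomm_def by (rule sim_mult[OF _ sim_refl])
    then have "x * (prod_list ys * upow D k) \<sim> prod_list ys * upow D l"
      by (simp add: mult.assoc l)
    with main have "prod_list (x # xs) \<sim> prod_list ys * upow D l" by (rule sim_trans)
    then show ?thesis using ys(1) by blast
  qed
qed

text \<open>These six letters suffice because \<open>adj a = adj D * Das\<close> and
  \<open>adj b = adj D * Dbs\<close>, while the adjoints of \<open>Dbs\<close> and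
  \<open>Das\<close> are \<open>b * adj D\<close> and \<open>a * adj D\<close>.\<close>

lemma Oq_subset_words:
  "Alg \<subseteq> cvec.span {prod_list xs | xs. set xs \<subseteq> {a, b, Dbs, Das, D, adj D}}" (is "_ \<subseteq> cvec.span ?W")
  unfolding Oq_def
proof (rule hull_minimal)
  have base: "prod_list xs \<in> ?W" if "set xs \<subseteq> {a, b, Dbs, Das, D, adj D}" for xs using that by blast
  have W1: "x * y \<in> ?W" if "x \<in> ?W" "y \<in> ?W" for x y
  proof -
    from that obtain xs ys where "x = prod_list xs" "y = prod_list ys"
      "set (xs @ ys) \<subseteq> {a, b, Dbs, Das, D, adj D}" by auto
    then show ?thesis using base[of "xs @ ys"] by simp
  qed
  have one: "1 \<in> ?W" using base[of "[]"] by simp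
  have mult: "x * y \<in> cvec.span ?W" if "x \<in> cvec.span ?W" "y \<in> cvec.span ?W" for x y
  proof (rule clinear_span[OF clinear_times_right that(1)])
    fix z assume "z \<in> ?W"
    then show "z * y \<in> cvec.span ?W"
      by (intro clinear_span[OF clinear_times_left that(2)] cvec.span_base W1)
  qed
  have letter: "x \<in> ?W" if "x \<in> {a, b, Dbs, Das, D, adj D}" for x
    using base[of "[x]"] that by simp
  have "adj D * Das = adj a" "adj D * Dbs = adj b"
    using Uq2_relations(8) by (simp_all add: Das_def Dbs_def flip: mult.assoc)
  then have "adj a \<in> ?W" "adj b \<in> ?W"
    using W1[of "adj D" Das] W1[of "adj D" Dbs] letter by auto
  moreover have "adj Dbs \<in> ?W" "adj Das \<in> ?W"
    using W1[of b "adj D"] W1[of a "adj D"] letter by (auto simp: Dbs_def Das_def adj_mult adj_adj)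
  ultimately have adj_letter: "adj x \<in> ?W" if "x \<in> {a, b, Dbs, Das, D, adj D}" for x
    using that letter by (auto simp: adj_adj)
  have adj_word: "adj (prod_list xs) \<in> ?W" if "set xs \<subseteq> {a, b, Dbs, Das, D, adj D}" for xs
    using that
  proof (induction xs)
    case (Cons x xs)
    then show ?case using W1 adj_letter by (simp add: adj_mult)
  qed (simp only: prod_list.Nil adj_one one)
  have adj: "adj x \<in> cvec.span ?W" if "x \<in> cvec.span ?W" for x
    using that
  proof (induction rule: cvec.span_induct_alt)
    case base
    then show ?case by (simp add: cvec.span_zero)
  next
    case (step c x y)
    then obtain xs where "x = prod_list xs" "set xs \<subseteq> {a, b, Dbs, Das, D, adj D}" by blast
    then have "adj x \<in> ?W" using adj_word by (simp only:)
    then have "adj x \<in> cvec.span ?W" by (rule cvec.span_base)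
    with step.IH show ?case unfolding adj_add adj_scaleC by (intro cvec.span_add cvec.span_scale)
  qed
  show "star_subalgebra (cvec.span ?W)"
    unfolding star_subalgebra_def using one mult adj
    by (auto simp only: intro: cvec.span_base cvec.span_add cvec.span_scale)
  show "{a, b, D} \<subseteq> cvec.span ?W"
  proof
    fix x assume "x \<in> {a, b, D}"
    then have "x \<in> {a, b, Dbs, Das, D, adj D}" by auto
    then show "x \<in> cvec.span ?W" by (rule cvec.span_base[OF letter])
  qed
qed

end

section \<open>Comparison of the upper bound with the orthogonal elements\<close>

context Uq2_haar begin

definition els :: "'a set" where "els = {el m i j k | m i j k. i \<le> m \<and> j \<le> m}"

lemma h_els:
  assumes "x \<in> els" "y \<in> els" shows "h (adj x * y) = 0 \<longleftrightarrow> x \<noteq> y"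
proof -
  obtain m i j k where x: "x = el m i j k" "i \<le> m" "j \<le> m" using assms(1) by (auto simp: els_def)
  obtain n r p l where y: "y = el n r p l" "r \<le> n" "p \<le> n" using assms(2) by (auto simp: els_def)
  have xx: "h (adj x * x) \<noteq> 0" unfolding x(1) using x by (subst orthogonality) (simp_all del: of_nat_Suc of_nat_add)
  show ?thesis
  proof
    show "x \<noteq> y" if "h (adj x * y) = 0" using xx that by auto
    show "h (adj x * y) = 0" if "x \<noteq> y"
      using that x y by (auto simp: orthogonality)
  qed
qed

text \<open>Each such element has nonzero norm and is orthogonal to those with other indices. This
  makes the cardinalities in the dimension count exact.\<close>

lemma el_eq_iff:
  assumes "i \<le> m" "j \<le> m" "r \<le> n" "p \<le> n"
  shows "el m i j k = el n r p l \<longleftrightarrow> (m, i, j, k) = (n, r, p, l)"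
proof
  assume eq: "el m i j k = el n r p l"
  have "h (adj (el m i j k) * el m i j k) \<noteq> 0"
    using assms by (subst orthogonality) (simp_all del: of_nat_Suc of_nat_add)
  then have "h (adj (el m i j k) * el n r p l) \<noteq> 0" using eq by simp
  then show "(m, i, j, k) = (n, r, p, l)" using assms by (subst (asm) orthogonality) (auto split: if_splits)
qed simp

lemma independent_els: "cvec.independent els"
  unfolding cvec.independent_explicit_finite_subsets
proof (intro allI impI ballI)
  interpret h: Vector_Spaces.linear scaleC scaleC h by (rule clinear_h)
  fix A and u :: "'a \<Rightarrow> complex" and v assume A: "A \<subseteq> els" "finite A" "(\<Sum>v\<in>A. u v *\<^sub>C v) = 0" "v \<in> A"
  have "0 = h (adj v * (\<Sum>w\<in>A. u w *\<^sub>C w))" by (simp add: A(3) h.zero)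
  also have "\<dots> = (\<Sum>w\<in>A. u w * h (adj v * w))"
    by (simp add: sum_distrib_left mult_scaleC_right h.sum h.scale scaleC_complex)
  also have "\<dots> = (\<Sum>w\<in>A. if w = v then u v * h (adj v * v) else 0)"
    using A h_els by (intro sum.cong) auto
  also have "\<dots> = u v * h (adj v * v)" using A by simp
  finally show "u v = 0" using h_els[of v v] A by auto
qed

definition T :: "nat \<Rightarrow> 'a set" where
  "T n = {el m i j (int k) | m i j k. m + 2 * k = n \<and> i \<le> m \<and> j \<le> m}"

definition B :: "nat \<Rightarrow> 'a set" where
  "B n = (\<lambda>(i, j). el n i j 0) ` ({..n} \<times> {..n})"

lemma card_B: "card (B n) = (n + 1)\<^sup>2"
proof -
  have "inj_on (\<lambda>(i, j). el n i j 0) ({..n} \<times> {..n})"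
    by (rule inj_onI) (auto simp: el_eq_iff)
  then show ?thesis by (simp add: B_def card_image power2_eq_square)
qed

lemma el_mult_D: "el m i j k * D = el m i j (k + 1)"
  by (simp add: el_def mult.assoc upow_mult)

text \<open>The set of \<open>m\<close> with \<open>m + 2 = n\<close> is a singleton or empty, so
  the recursion also holds for \<open>n < 2\<close> without truncated subtraction.\<close>

lemma T_rec: "T n = B n \<union> (\<lambda>x. x * D) ` (\<Union>m\<in>{m. m + 2 = n}. T m)"
proof (intro Set.set_eqI iffI)
  fix x assume "x \<in> T n"
  then obtain m i j k where x: "x = el m i j (int k)" "m + 2 * k = n" "i \<le> m" "j \<le> m" by (auto simp: T_def)
  show "x \<in> B n \<union> (\<lambda>x. x * D) ` (\<Union>m\<in>{m. m + 2 = n}. T m)"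
  proof (cases k)
    case 0
    then show ?thesis using x by (auto simp: B_def)
  next
    case (Suc k')
    then have "el m i j (int k') \<in> T (m + 2 * k')" "x = el m i j (int k') * D"
      using x by (auto simp: T_def el_mult_D add.commute)
    then show ?thesis using x(2) Suc by auto
  qed
next
  fix x assume "x \<in> B n \<union> (\<lambda>x. x * D) ` (\<Union>m\<in>{m. m + 2 = n}. T m)"
  then consider i j where "x = el n i j 0" "i \<le> n" "j \<le> n"
    | m i j k where "x = el m i j (int k) * D" "m + 2 * k + 2 = n" "i \<le> m" "j \<le> m"
    by (auto simp: B_def T_def)
  then show "x \<in> T n"
  proof cases
    case 1
    show ?thesis unfolding T_def mem_Collect_eq
    proof (intro exI conjI)
      show "x = el n i j (int 0)" "n + 2 * 0 = n" using 1 by simp_all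
    qed (use 1 in auto)
  next
    case 2
    then have "x = el m i j (int (Suc k))" "m + 2 * Suc k = n" by (auto simp: el_mult_D add.commute)
    then show ?thesis using 2 unfolding T_def by blast
  qed
qed

lemma T_subset_els: "T n \<subseteq> els"
  by (auto simp: T_def els_def)

text \<open>Each step of \<open>tau_rec\<close> appends one entry of the fundamental
  corepresentation, which is a letter up to a scalar.\<close>

lemma tau_in_E: "i \<le> n \<Longrightarrow> j \<le> n \<Longrightarrow> tau n i j \<in> E n"
proof (induction n arbitrary: i j)
  case 0
  then show ?case using E_word[of "[]"] by (simp add: tau_0)
next
  case (Suc n)
  obtain j' e where j: "j = j' + e" "j' \<le> n" "e \<le> 1"
  proof (cases j)
    case 0
    then show ?thesis using that[of 0 0] by simp
  next
    case (Suc j')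
    then show ?thesis using that[of j' 1] \<open>j \<le> Suc n\<close> by simp
  qed
  have ent: "x * ent c e \<in> E (Suc n)" if "x \<in> E n" for x c
    using that by (auto simp: ent_def gen_def mult_scaleC_right E_mult_letter simp flip: Dbs_def Das_def simp del: cvec.scale_minus_left intro!: E_scale)
  have "mu j' e *\<^sub>C tau (Suc n) i (j' + e) \<in> E (Suc n)"
    using j Suc.prems by (subst tau_rec) (auto intro!: E_add E_scale E_zero ent Suc.IH)
  from E_scale[OF this, of "inverse (mu j' e)"] show ?case by (simp add: j(1))
qed

lemma T_subset_E: "T n \<subseteq> E n"
proof -
  have "el m i j (int k) \<in> E (m + 2 * k)" if "i \<le> m" "j \<le> m" for m i j k
  proof (induction k)
    case 0
    have "t m i j = (rt m j / rt m i) *\<^sub>C tau m i j" using that by (simp add: tau_def scaleC_scaleC)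
    then show ?case using tau_in_E[OF that] by (simp add: el_def upow_def E_scale)
  next
    case (Suc k)
    then show ?case using E_mult_D[OF Suc] by (simp add: el_mult_D add.commute)
  qed
  then show ?thesis by (auto simp: T_def)
qed

text \<open>By induction the part \<open>E m * D\<close> of the reduction is spanned by
  \<open>TD\<close>, so \<open>E n\<close> lies in a span of at most
  \<open>(n + 1)^2 + card TD\<close> vectors. That is exactly the size of the independent set
  \<open>T n\<close>, which lies in \<open>E n\<close>. Finiteness is carried along for the
  cardinalities.\<close>

lemma E_subset_span_T: "finite (T n) \<and> E n \<subseteq> cvec.span (T n)"
proof (induction n rule: less_induct)
  case (less n)
  define TD where "TD = (\<lambda>x. x * D) ` (\<Union>m\<in>{m. m + 2 = n}. T m)"
  have T: "T n = B n \<union> TD" unfolding TD_def by (rule T_rec)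
  have "{m. m + 2 = n} \<subseteq> {..n}" by auto
  then have fin: "finite {m. m + 2 = n}" using finite_subset by blast
  have finTD: "finite TD" unfolding TD_def using less fin by auto
  have finT: "finite (T n)" by (simp add: T finTD B_def)
  have "B n \<inter> TD = {}"
    by (auto simp: B_def TD_def T_def el_mult_D el_eq_iff)
  then have card: "card (T n) = (n + 1)\<^sup>2 + card TD"
    using card_Un_disjoint[of "B n" TD] finTD by (simp add: T card_B) (simp add: B_def)
  let ?U = "reduced n \<union> TD"
  have "E n \<subseteq> cvec.span ?U"
  proof (rule subset_trans[OF E_reduce cvec.span_minimal[OF _ cvec.subspace_span]], rule subsetI)
    fix x assume "x \<in> reduced n \<union> {y * D |y m. m + 2 = n \<and> y \<in> E m}"
    then consider "x \<in> reduced n" | y m where "x = y * D" "m + 2 = n" "y \<in> E m" by blast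
    then show "x \<in> cvec.span ?U"
    proof cases
      case 1
      then show ?thesis by (intro cvec.span_base) simp
    next
      case 2
      then have "y \<in> cvec.span (T m)" using less[of m] by auto
      then have "y * D \<in> cvec.span ?U"
        by (rule clinear_span[OF clinear_times_right])
          (use 2(2) in \<open>auto simp: TD_def intro!: cvec.span_base\<close>)
      then show ?thesis by (simp add: 2)
    qed
  qed
  moreover have "cvec.span ?U \<subseteq> cvec.span (T n)"
  proof (rule span_subset_of_card_le)
    show "cvec.independent (T n)" using independent_els T_subset_els by (rule cvec.independent_mono)
    show "T n \<subseteq> cvec.span ?U" using T_subset_E calculation by blast
    show "finite ?U" using finite_reduced finTD by simp
    show "card ?U \<le> card (T n)"
      using card_Un_le[of "reduced n" TD] card_reduced[of n] card by linarith
  qed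
  ultimately show ?case using finT by blast
qed

text \<open>Powers of \<open>D\<close> of either sign only change the last index of an element
  \<open>el\<close>, and all integers are allowed there.\<close>

lemma Alg_subset_span_els: "Alg \<subseteq> cvec.span els"
proof (rule subset_trans[OF Oq_subset_words cvec.span_minimal[OF _ cvec.subspace_span]], rule subsetI)
  fix x assume "x \<in> {prod_list xs | xs. set xs \<subseteq> {a, b, Dbs, Das, D, adj D}}"
  then obtain xs where xs: "x = prod_list xs" "set xs \<subseteq> {a, b, Dbs, Das, D, adj D}" by blast
  obtain ys k where ys: "set ys \<subseteq> ltrs" "prod_list xs \<sim> prod_list ys * upow D k"
    using word_sim_upow[OF xs(2)] by blast
  have "prod_list ys \<in> cvec.span (T (length ys))" using E_word[OF ys(1)] E_subset_span_T by blast
  then have "prod_list ys * upow D k \<in> cvec.span els"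
    by (rule clinear_span[OF clinear_times_right])
      (force simp: T_def els_def el_def mult.assoc upow_add intro!: cvec.span_base)
  with ys(2) show "x \<in> cvec.span els" unfolding xs(1) by (rule sim_span)
qed

end

section \<open>The Fourier transform\<close>

text \<open>Positivity makes \<open>h (adj y * y)\<close> real. For
  \<open>y = x + c *\<^sub>C 1\<close>, the cases \<open>c = 1\<close> and \<open>c = \<i>\<close>
  yield the imaginary and the real part of the claim.\<close>

lemma state_adj:
  fixes h :: "'a::cstar_algebra_1 \<Rightarrow> complex"
  assumes "state h" shows "h (adj x) = cnj (h x)"
proof -
  interpret h: Vector_Spaces.linear scaleC scaleC h using assms by (simp add: state_def)
  have real: "Im (h (adj y * y)) = 0" for y
    using assms by (simp add: state_def complex_is_Real_iff)
  have one: "h 1 = 1" using assms by (simp add: state_def)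
  have "Im (c * h (adj x) + cnj c * h x) = 0" for c
  proof -
    have "adj (x + c *\<^sub>C 1) * (x + c *\<^sub>C 1) = adj x * x + c *\<^sub>C adj x + cnj c *\<^sub>C x + (cnj c * c) *\<^sub>C 1"
      by (simp add: adj_add adj_scaleC distrib_left distrib_right mult_scaleC_left mult_scaleC_right
          scaleC_scaleC scaleC_add_right mult.commute)
    then have "h (adj (x + c *\<^sub>C 1) * (x + c *\<^sub>C 1)) = h (adj x * x) + c * h (adj x) + cnj c * h x + cnj c * c"
      by (simp add: h.add h.scale scaleC_complex one)
    moreover have "Im (cnj c * c) = 0" by simp
    ultimately show ?thesis using real[of x] real[of "x + c *\<^sub>C 1"] by (simp add: algebra_simps)
  qed
  from this[of 1] this[of \<i>] show ?thesis by (simp add: complex_eq_iff)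
qed

lemma Sum_any_superset:
  "finite A \<Longrightarrow> (\<And>x. g x \<noteq> 0 \<Longrightarrow> x \<in> A) \<Longrightarrow> Sum_any g = sum g A"
  by (rule Sum_any.expand_superset) auto

context Uq2_haar begin

definition fcoef :: "'a \<Rightarrow> nat \<Rightarrow> nat \<Rightarrow> nat \<Rightarrow> int \<Rightarrow> complex" where
  "fcoef f n i j k = h (adj (el n i j k) * f)"

abbreviation F :: "'a \<Rightarrow> nat \<times> int \<Rightarrow> complex mat" where "F \<equiv> fourier D S h t"

text \<open>The transposed position comes from \<open>S (t n i j) = adj (t n j i)\<close>: the
  matrix entry at \<open>(j, i)\<close> is the inner product with \<open>el n i j k\<close>.\<close>

lemma F_entry: "i \<le> n \<Longrightarrow> j \<le> n \<Longrightarrow> F f (n, k) $$ (j, i) = fcoef f n i j k"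
  by (simp add: fourier_def fcoef_def S_el)

lemma F_dim: "F f (n, k) \<in> carrier_mat (n + 1) (n + 1)"
  by (simp add: fourier_def)

lemma F_dims [simp]: "dim_row (F f (n, k)) = n + 1" "dim_col (F f (n, k)) = n + 1"
  by (simp_all add: fourier_def)

lemma F_eqI:
  assumes "\<And>n k. M (n, k) \<in> carrier_mat (n + 1) (n + 1)"
    and "\<And>n k i j. i \<le> n \<Longrightarrow> j \<le> n \<Longrightarrow> M (n, k) $$ (j, i) = fcoef f n i j k"
  shows "F f = M"
proof
  fix p :: "nat \<times> int"
  obtain n k where p: "p = (n, k)" by fastforce
  show "F f p = M p"
    unfolding p using assms(1)[of n k] F_dim[of f n k] assms(2)[of _ n _ k]
    by (intro eq_matI) (auto simp: F_entry)
qed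

lemma clinear_fcoef: "clinear (\<lambda>f. fcoef f n i j k)"
  using clinear_h unfolding clinear_iff fcoef_def by (simp add: distrib_left mult_scaleC_right)

lemma fcoef_add: "fcoef (f + g) n i j k = fcoef f n i j k + fcoef g n i j k"
  using clinear_fcoef[of n i j k] by (simp add: clinear_iff)

lemma fcoef_scale: "fcoef (c *\<^sub>C f) n i j k = c * fcoef f n i j k"
  using clinear_fcoef[of n i j k] by (simp add: clinear_iff scaleC_complex)

lemma fcoef_sum: "fcoef (\<Sum>x\<in>I. g x) n i j k = (\<Sum>x\<in>I. fcoef (g x) n i j k)"
proof -
  interpret l: Vector_Spaces.linear scaleC scaleC "\<lambda>f. fcoef f n i j k" by (rule clinear_fcoef)
  show ?thesis by (rule l.sum)
qed

lemma fcoef_el: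
  assumes "i \<le> n" "j \<le> n" "r \<le> m" "p \<le> m"
  shows "fcoef (el m r p l) n i j k = (if (n, i, j, k) = (m, r, p, l) then 1 / of_nat (n + 1) else 0)"
  unfolding fcoef_def by (rule orthogonality[OF assms])

text \<open>The \<open>(n, k)\<close> summand of the inversion formula for an arbitrary array of
  coefficients, so that it serves both inversion and surjectivity. The factor \<open>n + 1\<close>
  cancels the squared norm \<open>1 / (n + 1)\<close>.\<close>

definition synth :: "(nat \<Rightarrow> nat \<Rightarrow> nat \<Rightarrow> int \<Rightarrow> complex) \<Rightarrow> nat \<times> int \<Rightarrow> 'a" where
  "synth c = (\<lambda>(n, k). of_nat (n + 1) *\<^sub>C (\<Sum>i\<le>n. \<Sum>j\<le>n. c n i j k *\<^sub>C el n i j k))"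

lemma synth_in_Alg: "synth c p \<in> Alg"
  by (cases p) (auto simp: synth_def intro!: Oq_closed(4) Oq_sum el_in_Alg)

text \<open>Only indices up to \<open>n\<close> count, since the entries \<open>t n i j\<close> are
  unconstrained beyond them.\<close>

definition supp :: "(nat \<Rightarrow> nat \<Rightarrow> nat \<Rightarrow> int \<Rightarrow> complex) \<Rightarrow> (nat \<times> int) set" where
  "supp c = {(n, k). \<exists>i\<le>n. \<exists>j\<le>n. c n i j k \<noteq> 0}"

lemma synth_zero: "p \<notin> supp c \<Longrightarrow> synth c p = 0"
  by (cases p) (auto simp: synth_def supp_def)

lemma synth_add: "synth (\<lambda>n i j k. c n i j k + d n i j k) p = synth c p + synth d p"
  by (cases p) (simp add: synth_def scaleC_add_left scaleC_add_right sum.distrib)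

lemma synth_scale: "synth (\<lambda>n i j k. z * c n i j k) p = z *\<^sub>C synth c p"
  by (cases p) (simp add: synth_def cvec.scale_sum_right scaleC_scaleC mult.assoc mult.left_commute del: of_nat_add of_nat_Suc)

lemma fcoef_synth:
  assumes "i \<le> n" "j \<le> n"
  shows "fcoef (synth c p) n i j k = (if p = (n, k) then c n i j k else 0)"
proof -
  obtain m l where p: "p = (m, l)" by fastforce
  have "fcoef (synth c p) n i j k = of_nat (m + 1) * (\<Sum>r\<le>m. \<Sum>s\<le>m. c m r s l * fcoef (el m r s l) n i j k)"
    by (simp add: p synth_def fcoef_scale fcoef_sum del: of_nat_add of_nat_Suc)
  also have "(\<Sum>r\<le>m. \<Sum>s\<le>m. c m r s l * fcoef (el m r s l) n i j k) =
      (\<Sum>r\<le>m. \<Sum>s\<le>m. if r = i \<and> s = j \<and> (n, k) = (m, l) then c m i j l * (1 / of_nat (n + 1)) else 0)"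
    using assms by (intro sum.cong) (auto simp: fcoef_el)
  also have "\<dots> = (if (n, k) = (m, l) then c m i j l * (1 / of_nat (n + 1)) else 0)"
  proof (cases "(n, k) = (m, l)")
    case True
    have "(\<Sum>s\<le>m. if r = i \<and> s = j then z else 0) = (if r = i then z else 0)" for r and z :: complex
      using assms True by simp
    then show ?thesis using True assms by simp
  qed auto
  finally show ?thesis by (auto simp: p simp del: of_nat_add of_nat_Suc)
qed

lemma synth_el:
  assumes "r \<le> m" "s \<le> m"
  shows "synth (fcoef (el m r s l)) (m, l) = el m r s l"
proof -
  have "(\<Sum>i\<le>m. \<Sum>j\<le>m. fcoef (el m r s l) m i j l *\<^sub>C el m i j l) =
      (\<Sum>i\<le>m. \<Sum>j\<le>m. if i = r then if j = s then (1 / of_nat (m + 1)) *\<^sub>C el m r s l else 0 else 0)"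
    using assms by (intro sum.cong) (auto simp: fcoef_el)
  also have "\<dots> = (\<Sum>i\<le>m. if i = r then (1 / of_nat (m + 1)) *\<^sub>C el m r s l else 0)"
    using assms by (intro sum.cong) (auto simp: sum.delta)
  also have "\<dots> = (1 / of_nat (m + 1)) *\<^sub>C el m r s l" using assms by (simp add: sum.delta)
  finally show ?thesis
    by (simp add: synth_def scaleC_scaleC del: of_nat_add of_nat_Suc)
qed

lemma supp_el:
  assumes "r \<le> m" "s \<le> m" shows "supp (fcoef (el m r s l)) = {(m, l)}"
proof -
  have "fcoef (el m r s l) m r s l \<noteq> 0"
    using assms by (subst fcoef_el) (simp_all del: of_nat_add of_nat_Suc)
  then have "(m, l) \<in> supp (fcoef (el m r s l))" using assms by (auto simp: supp_def)
  moreover have "p = (m, l)" if "p \<in> supp (fcoef (el m r s l))" for p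
    using that assms by (auto simp: supp_def fcoef_el split: if_splits)
  ultimately show ?thesis by blast
qed

lemma expansion:
  assumes "f \<in> Alg"
  shows "finite (supp (fcoef f))" "f = Sum_any (synth (fcoef f))"
proof -
  have "finite (supp (fcoef f)) \<and> f = (\<Sum>p\<in>supp (fcoef f). synth (fcoef f) p)"
    using subsetD[OF Alg_subset_span_els assms]
  proof (induction rule: cvec.span_induct_alt)
    case base
    have "fcoef 0 n i j k = 0" for n i j k using fcoef_scale[of 0 0] by simp
    then have "supp (fcoef 0) = {}" by (auto simp: supp_def)
    then show ?case by simp
  next
    case (step c x f)
    obtain m r s l where x: "x = el m r s l" "r \<le> m" "s \<le> m" using step.hyps by (auto simp: els_def)
    have fcoef: "fcoef (c *\<^sub>C x + f) = (\<lambda>n i j k. c * fcoef x n i j k + fcoef f n i j k)"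
      by (simp add: fun_eq_iff fcoef_add fcoef_scale)
    \<comment> \<open>The support of a sum may shrink by cancellation, so all three sums are
      compared over one finite superset.\<close>
    let ?A = "insert (m, l) (supp (fcoef f))"
    have fin: "finite ?A" using step by simp
    have suppx: "supp (fcoef x) = {(m, l)}" using x by (simp add: supp_el)
    have sub: "supp (fcoef (c *\<^sub>C x + f)) \<subseteq> ?A"
    proof
      fix p assume "p \<in> supp (fcoef (c *\<^sub>C x + f))"
      then have "p \<in> supp (fcoef x) \<or> p \<in> supp (fcoef f)" unfolding fcoef supp_def by fastforce
      then show "p \<in> ?A" using suppx by auto
    qed
    have "(\<Sum>p\<in>supp (fcoef (c *\<^sub>C x + f)). synth (fcoef (c *\<^sub>C x + f)) p) = (\<Sum>p\<in>?A. synth (fcoef (c *\<^sub>C x + f)) p)"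
      using fin sub by (intro sum.mono_neutral_left) (auto simp: synth_zero)
    also have "\<dots> = c *\<^sub>C (\<Sum>p\<in>?A. synth (fcoef x) p) + (\<Sum>p\<in>?A. synth (fcoef f) p)"
      unfolding fcoef synth_add synth_scale by (simp only: sum.distrib cvec.scale_sum_right)
    also have "(\<Sum>p\<in>?A. synth (fcoef x) p) = (\<Sum>p\<in>{(m, l)}. synth (fcoef x) p)"
      using fin suppx by (intro sum.mono_neutral_right) (auto simp: synth_zero)
    also have "\<dots> = x" using x by (simp add: synth_el)
    also have "(\<Sum>p\<in>?A. synth (fcoef f) p) = (\<Sum>p\<in>supp (fcoef f). synth (fcoef f) p)"
      using fin by (intro sum.mono_neutral_right) (auto simp: synth_zero)
    also have "\<dots> = f" using step.IH by simp
    finally show ?case using finite_subset[OF sub fin] by simp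
  qed
  \<comment> \<open>\<open>Sum_any\<close> is 0 by default on an infinite support; the finiteness
    just proved identifies it with the finite sum.\<close>
  then show "finite (supp (fcoef f))" "f = Sum_any (synth (fcoef f))"
    using Sum_any_superset[of "supp (fcoef f)" "synth (fcoef f)"] synth_zero by metis+
qed

text \<open>It suffices to expand \<open>g\<close>: since \<open>h\<close> commutes with
  conjugation, \<open>h (adj f * el n i j k)\<close> is the conjugate of a coefficient of
  \<open>f\<close>.\<close>

lemma inner_product_expansion:
  assumes "f \<in> Alg" "g \<in> Alg"
  shows "h (adj f * g) = Sum_any (\<lambda>(n, k). of_nat (n + 1) * (\<Sum>i\<le>n. \<Sum>j\<le>n. cnj (fcoef f n i j k) * fcoef g n i j k))"
proof -
  interpret h: Vector_Spaces.linear scaleC scaleC h by (rule clinear_h)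
  have adj: "h (adj f * el n i j k) = cnj (fcoef f n i j k)" for n i j k
    using state_adj[of h "adj (el n i j k) * f"] haar
    by (simp add: haar_state_def fcoef_def adj_mult adj_adj)
  have g: "g = (\<Sum>p\<in>supp (fcoef g). synth (fcoef g) p)"
    using expansion[OF assms(2)] Sum_any_superset[of "supp (fcoef g)" "synth (fcoef g)"] synth_zero by metis
  have "h (adj f * g) = (\<Sum>p\<in>supp (fcoef g). h (adj f * synth (fcoef g) p))"
    by (subst (1) g) (simp add: sum_distrib_left h.sum)
  also have "\<dots> = (\<Sum>(n, k)\<in>supp (fcoef g). of_nat (n + 1) * (\<Sum>i\<le>n. \<Sum>j\<le>n. cnj (fcoef f n i j k) * fcoef g n i j k))"
    by (intro sum.cong) (auto simp: synth_def mult_scaleC_right sum_distrib_left h.sum h.scale scaleC_complex adj mult.commute mult.left_commute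
        simp del: of_nat_add of_nat_Suc)
  also have "\<dots> = Sum_any (\<lambda>(n, k). of_nat (n + 1) * (\<Sum>i\<le>n. \<Sum>j\<le>n. cnj (fcoef f n i j k) * fcoef g n i j k))"
    using expansion(1)[OF assms(2)]
    by (intro Sum_any_superset[symmetric]) (auto simp: supp_def intro!: sum.neutral)
  finally show ?thesis .
qed

lemma mat_inner_F: "mat_inner (F f (n, k)) (F g (n, k)) = (\<Sum>i\<le>n. \<Sum>j\<le>n. cnj (fcoef f n i j k) * fcoef g n i j k)"
proof -
  have d: "F f (n, k) \<in> carrier_mat (Suc n) (Suc n)" "F g (n, k) \<in> carrier_mat (Suc n) (Suc n)"
    using F_dim by simp_all
  have "mat_inner (F f (n, k)) (F g (n, k)) =
      (\<Sum>i<Suc n. \<Sum>j<Suc n. cnj (F f (n, k) $$ (j, i)) * F g (n, k) $$ (j, i))"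
    using d unfolding mat_inner_def mat_trace_def
    by (auto simp: mat_adjoint_def mat_of_rows_def scalar_prod_def lessThan_atLeast0 intro!: sum.cong)
  also have "\<dots> = (\<Sum>i\<le>n. \<Sum>j\<le>n. cnj (fcoef f n i j k) * fcoef g n i j k)"
    by (intro sum.cong) (auto simp: F_entry)
  finally show ?thesis .
qed

lemma inj_F: "inj_on F Alg"
proof (rule inj_onI)
  fix f g assume fg: "f \<in> Alg" "g \<in> Alg" "F f = F g"
  have "fcoef f n i j k = fcoef g n i j k" if "i \<le> n" "j \<le> n" for n i j k
    using F_entry[OF that, of f k] F_entry[OF that, of g k] fg(3) by simp
  then have "synth (fcoef f) p = synth (fcoef g) p" for p by (cases p) (simp add: synth_def)
  then have "synth (fcoef f) = synth (fcoef g)" by (rule ext)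
  then show "f = g" using expansion(2)[OF fg(1)] expansion(2)[OF fg(2)] by simp
qed

lemma F_in_dual: "f \<in> Alg \<Longrightarrow> F f \<in> dual_algebra"
proof -
  assume f: "f \<in> Alg"
  have "{(n, k). F f (n, k) \<noteq> 0\<^sub>m (n + 1) (n + 1)} \<subseteq> supp (fcoef f)"
  proof safe
    fix n k assume ne: "F f (n, k) \<noteq> 0\<^sub>m (n + 1) (n + 1)"
    show "(n, k) \<in> supp (fcoef f)"
    proof (rule ccontr)
      assume "(n, k) \<notin> supp (fcoef f)"
      then have "F f (n, k) = 0\<^sub>m (n + 1) (n + 1)"
        using F_dim[of f n k] by (intro eq_matI) (auto simp: F_entry supp_def)
      with ne show False by simp
    qed
  qed
  then show "F f \<in> dual_algebra"
    using finite_subset expansion(1)[OF f] F_dim by (auto simp: dual_algebra_def)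
qed

lemma F_surj:
  assumes M: "M \<in> dual_algebra" shows "\<exists>f\<in>Alg. F f = M"
proof -
  \<comment> \<open>The indices are exchanged as in \<open>F_entry\<close>.\<close>
  define c where "c n i j k = M (n, k) $$ (j, i)" for n i j k
  define A where "A = {(n, k). M (n, k) \<noteq> 0\<^sub>m (n + 1) (n + 1)}"
  define f where "f = (\<Sum>p\<in>A. synth c p)"
  have A: "finite A" and dim: "\<And>n k. M (n, k) \<in> carrier_mat (n + 1) (n + 1)"
    using M by (simp_all add: dual_algebra_def A_def)
  have "F f = M"
  proof (rule F_eqI[OF dim])
    fix n i j :: nat and k :: int assume ij: "i \<le> n" "j \<le> n"
    have "fcoef f n i j k = (\<Sum>p\<in>A. if p = (n, k) then c n i j k else 0)"
      using ij by (simp add: f_def fcoef_sum fcoef_synth)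
    also have "\<dots> = (if (n, k) \<in> A then c n i j k else 0)" using A by simp
    also have "\<dots> = c n i j k" using ij by (auto simp: A_def c_def)
    finally show "M (n, k) $$ (j, i) = fcoef f n i j k" by (simp add: c_def)
  qed
  moreover have "f \<in> Alg" unfolding f_def by (intro Oq_sum synth_in_Alg)
  ultimately show ?thesis by blast
qed

lemma bij_F: "bij_betw F Alg dual_algebra"
  unfolding bij_betw_def using inj_F F_in_dual F_surj by blast

lemma F_add: "F (f + g) = dual_add (F f) (F g)"
  using F_dim[of f] F_dim[of g]
  by (intro F_eqI) (simp_all add: dual_add_def F_entry fcoef_add)

lemma F_scale: "F (c *\<^sub>C f) = dual_scale c (F f)"
  using F_dim[of f]
  by (intro F_eqI) (simp_all add: dual_scale_def F_entry fcoef_scale)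

text \<open>The coefficient stands without complex conjugation: \<open>F\<close> is linear, and a
  conjugate would make the right-hand side antilinear in \<open>f\<close>.\<close>

lemma F_inversion:
  assumes "f \<in> Alg"
  shows "f = Sum_any (\<lambda>(n, k). of_nat (n + 1) *\<^sub>C
       (\<Sum>i\<le>n. \<Sum>j\<le>n. F f (n, k) $$ (j, i) *\<^sub>C (t n i j * upow D k)))"
proof -
  have "(\<lambda>(n, k). of_nat (n + 1) *\<^sub>C (\<Sum>i\<le>n. \<Sum>j\<le>n. F f (n, k) $$ (j, i) *\<^sub>C (t n i j * upow D k))) = synth (fcoef f)"
    by (auto simp: synth_def fun_eq_iff F_entry el_def simp del: of_nat_add of_nat_Suc)
  then show ?thesis using expansion(2)[OF assms] by simp
qed

lemma Plancherel:
  assumes "f \<in> Alg" "g \<in> Alg"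
  shows "h (adj f * g) = Sum_any (\<lambda>(n, k). of_nat (n + 1) *
      (\<Sum>i\<le>n. \<Sum>j\<le>n. cnj (F f (n, k) $$ (j, i)) * F g (n, k) $$ (j, i)))"
    and "h (adj f * g) = Sum_any (\<lambda>(n, k). of_nat (n + 1) * mat_inner (F f (n, k)) (F g (n, k)))"
proof -
  have "(\<Sum>i\<le>n. \<Sum>j\<le>n. cnj (F f (n, k) $$ (j, i)) * F g (n, k) $$ (j, i)) =
      (\<Sum>i\<le>n. \<Sum>j\<le>n. cnj (fcoef f n i j k) * fcoef g n i j k)" for n k
    by (simp add: F_entry)
  then show "h (adj f * g) = Sum_any (\<lambda>(n, k). of_nat (n + 1) *
      (\<Sum>i\<le>n. \<Sum>j\<le>n. cnj (F f (n, k) $$ (j, i)) * F g (n, k) $$ (j, i)))"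
    and "h (adj f * g) = Sum_any (\<lambda>(n, k). of_nat (n + 1) * mat_inner (F f (n, k)) (F g (n, k)))"
    using inner_product_expansion[OF assms] by (simp_all only: mat_inner_F)
qed

end

theorem theorem6p7:
  fixes q :: complex and a b D :: "'a::cstar_algebra_1"
    and \<Delta> :: "'a \<Rightarrow> ('a, 'a) tensor" and S :: "'a \<Rightarrow> 'a" and h :: "'a \<Rightarrow> complex"
    and t :: "nat \<Rightarrow> nat \<Rightarrow> nat \<Rightarrow> 'a"
  assumes "cmod q = 1" and "\<forall>n>0. q ^ n \<noteq> 1"
    and "universal_Uq2 q a b D"
    and "comultiplication q a b D \<Delta>"
    and "antipode q a b D S"
    and "haar_state a b D \<Delta> h"
    and "matrix_coefficients a b D \<Delta> t"
  defines "F \<equiv> fourier D S h t"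
  shows "bij_betw F (Oq a b D) dual_algebra \<and>
    (\<forall>f\<in>Oq a b D. \<forall>g\<in>Oq a b D. F (f + g) = dual_add (F f) (F g)) \<and>
    (\<forall>c. \<forall>f\<in>Oq a b D. F (c *\<^sub>C f) = dual_scale c (F f)) \<and>
    (\<forall>f\<in>Oq a b D. f = Sum_any (\<lambda>(n, k). of_nat (n + 1) *\<^sub>C
       (\<Sum>i\<le>n. \<Sum>j\<le>n. F f (n, k) $$ (j, i) *\<^sub>C (t n i j * upow D k)))) \<and>
    (\<forall>f\<in>Oq a b D. \<forall>g\<in>Oq a b D.
       h (adj f * g) = Sum_any (\<lambda>(n, k). of_nat (n + 1) *
         (\<Sum>i\<le>n. \<Sum>j\<le>n. cnj (F f (n, k) $$ (j, i)) * F g (n, k) $$ (j, i))) \<and>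
       h (adj f * g) = Sum_any (\<lambda>(n, k). of_nat (n + 1) * mat_inner (F f (n, k)) (F g (n, k))))"
proof -
  interpret Uq2_haar q a b D \<Delta> S h t
    by unfold_locales (fact assms)+
  show ?thesis
    unfolding F_def
    by (intro conjI ballI allI bij_F F_add F_scale F_inversion Plancherel)
qed

end
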